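(* Let $X$ be an $n$-dimensional compact complex manifold and $G=\mathbb C^n/\Lambda\subset\mathrm{Aut}^0(X)$ a divisorial semi-torus with Lie algebra $\mathfrak g$. Choose complex coordinates on $\mathbb C^n=\mathbb C^k\oplus\mathbb C^l$ ($k+l=n$) such that $\Lambda_{\mathbb R}:=\Lambda\otimes\mathbb R=\mathbb C^k\oplus\mathrm{Re}(\mathbb C^l)$. Denote by $i:M(l,\mathbb C)\to M(n,\mathbb C)$ the embedding which fills up an $l\times l$-matrix (placed in the block corresponding to the factor $\mathbb C^l$) with zeroes. Then, sending a $G$-invariant Kähler metric to its constant coefficient matrix, $$K_G(X,D_{\mathfrak g})\subset M(n,\mathbb C)/i(M(l,\mathbb R))$$ is the cone generated by (the classes of) positive definite hermitian matrices. In particular, $$\dim K_G(X,D_{\mathfrak g})=n^2-\tfrac12 l(l+1).$$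
   Context: A complex Lie group $G$ is a semi-torus if $G=\mathbb C^n/\Lambda$ for some $n$ and some discrete subgroup $\Lambda\subset\mathbb C^n$ with $\Lambda\otimes\mathbb C=\mathbb C^n$ (i.e. $\Lambda$ spans $\mathbb C^n$ over $\mathbb C$). $\Lambda_{\mathbb R}$ is the real span of $\Lambda$ in $\mathbb C^n$; $\mathrm{Re}(\mathbb C^l)=\mathbb R^l\subset\mathbb C^l$. A Lie group $G\subset \mathrm{Aut}(X)$ is divisorial if $\dim G=\dim X$ and its action on $X$ has an open orbit. $\mathfrak g$ is identified with a subspace of $H^0(X,T_X)$ and $D_{\mathfrak g}\in|-K_X|$ is the divisor of zeros of the section $s^{(1)}\wedge\dots\wedge s^{(n)}$ of $-K_X$ for a basis $s^{(1)},\dots,s^{(n)}$ of $\mathfrak g$. For abelian $G$ acting effectively, $X\setminus D_{\mathfrak g}$ is the open orbit and is identified with $G=\mathbb C^n/\Lambda$; a $G$-invariant metric on it has constant coefficients in the coordinates induced from $\mathbb C^n$, so it is identified with a positive definite hermitian $n\times n$ matrix. $M_G(X,D)$ denotes the set of $G$-invariant Kähler metrics on $X\setminus D$. Two Kähler metrics $g,g'$ on $X\setminus D$ are equivalent, $g\sim g'$, if $\omega_g-\omega_{g'}=i\partial\bar\partial\phi$ for some $\phi\in C^\infty(X\setminus D,\mathbb R)$. The $G$-Kähler cone is $K_G(X,D):=M_G(X,D)/\sim$; dimension means real dimension. $M(m,\mathbb K)$ denotes $m\times m$ matrices over $\mathbb K$. *)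

theory Defs
  imports "HOL-Analysis.Analysis"
begin

section \<open>Holomorphic and smooth maps of several variables\<close>

text \<open>The matrix is a complex one, so differentiability is complex differentiability in several
  variables. Only used on open sets.\<close>

definition holo_on :: "(complex^'n) set \<Rightarrow> (complex^'n \<Rightarrow> complex^'m) \<Rightarrow> bool" where
  "holo_on S f \<longleftrightarrow>
     (\<forall>p\<in>S. \<exists>A :: complex^'n^'m. (f has_derivative (\<lambda>v. A *v v)) (at p))"

primrec Cr_on :: "nat \<Rightarrow> 'a::real_normed_vector set \<Rightarrow> ('a \<Rightarrow> 'b::real_normed_vector) \<Rightarrow> bool" where
  "Cr_on 0 S f \<longleftrightarrow> continuous_on S f"
| "Cr_on (Suc r) S f \<longleftrightarrow> (\<forall>p\<in>S. f differentiable (at p)) \<and>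
     (\<forall>v. Cr_on r S (\<lambda>p. frechet_derivative f (at p) v))"

definition smooth_on :: "'a::real_normed_vector set \<Rightarrow> ('a \<Rightarrow> 'b::real_normed_vector) \<Rightarrow> bool" where
  "smooth_on S f \<longleftrightarrow> (\<forall>r. Cr_on r S f)"

text \<open>The Wirtinger derivatives with respect to the \<open>j\<close>-th coordinate and its conjugate.\<close>

definition dz :: "'n \<Rightarrow> (complex^'n \<Rightarrow> complex) \<Rightarrow> complex^'n \<Rightarrow> complex" where
  "dz j f p = (frechet_derivative f (at p) (axis j 1)
                - \<i> * frechet_derivative f (at p) (axis j \<i>)) / 2"

definition dzbar :: "'n \<Rightarrow> (complex^'n \<Rightarrow> complex) \<Rightarrow> complex^'n \<Rightarrow> complex" where
  "dzbar j f p = (frechet_derivative f (at p) (axis j 1)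
                + \<i> * frechet_derivative f (at p) (axis j \<i>)) / 2"

section \<open>Complex manifolds and their automorphisms\<close>

text \<open>A manifold is a topological type with a holomorphic atlas. A chart is a pair of its domain and
  a coordinate map; the values of the latter outside the domain are irrelevant.\<close>

type_synonym ('a, 'n) chart = "'a set \<times> ('a \<Rightarrow> complex^'n)"

abbreviation cdom :: "('a, 'n) chart \<Rightarrow> 'a set" where "cdom a \<equiv> fst a"
abbreviation cmap :: "('a, 'n) chart \<Rightarrow> 'a \<Rightarrow> complex^'n" where "cmap a \<equiv> snd a"
abbreviation cinv :: "('a, 'n) chart \<Rightarrow> complex^'n \<Rightarrow> 'a" where "cinv a \<equiv> inv_into (fst a) (snd a)"

definition complex_manifold ::
    "('a::{t2_space,second_countable_topology}, 'n::finite) chart set \<Rightarrow> bool" where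
  "complex_manifold \<A> \<longleftrightarrow>
     connected (UNIV :: 'a set) \<and>
     (\<Union>a\<in>\<A>. cdom a) = UNIV \<and>
     (\<forall>a\<in>\<A>. open (cdom a) \<and> open (cmap a ` cdom a) \<and>
        homeomorphism (cdom a) (cmap a ` cdom a) (cmap a) (cinv a)) \<and>
     (\<forall>a\<in>\<A>. \<forall>b\<in>\<A>. holo_on (cmap a ` (cdom a \<inter> cdom b)) (cmap b \<circ> cinv a))"

definition compact_complex_manifold ::
    "('a::{t2_space,second_countable_topology}, 'n::finite) chart set \<Rightarrow> bool" where
  "compact_complex_manifold \<A> \<longleftrightarrow> complex_manifold \<A> \<and> compact (UNIV :: 'a set)"

definition holo_map :: "('a::topological_space, 'n::finite) chart set \<Rightarrow> ('a \<Rightarrow> 'a) \<Rightarrow> bool" where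
  "holo_map \<A> f \<longleftrightarrow> continuous_on UNIV f \<and>
     (\<forall>a\<in>\<A>. \<forall>b\<in>\<A>. holo_on (cmap a ` (cdom a \<inter> f -` cdom b)) (cmap b \<circ> f \<circ> cinv a))"

definition Aut :: "('a::topological_space, 'n::finite) chart set \<Rightarrow> ('a \<Rightarrow> 'a) set" where
  "Aut \<A> = {f. bij f \<and> holo_map \<A> f \<and> holo_map \<A> (inv f)}"

text \<open>The topology of the Lie group \<open>Aut(X)\<close>, for compact \<open>X\<close>, is the compact-open topology.\<close>

definition Aut_topology :: "('a::topological_space, 'n::finite) chart set \<Rightarrow> ('a \<Rightarrow> 'a) topology" where
  "Aut_topology \<A> = topology_generated_by {{f \<in> Aut \<A>. f ` K \<subseteq> V} |K V. compact K \<and> open V}"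

definition Aut0 :: "('a::topological_space, 'n::finite) chart set \<Rightarrow> ('a \<Rightarrow> 'a) set" where
  "Aut0 \<A> = connected_component_of_set (Aut_topology \<A>) id"

section \<open>Divisorial semi-tori\<close>

text \<open>The lattices \<open>\<Lambda>\<close> for which the group \<open>\<complex>\<^sup>n/\<Lambda>\<close> is a semi-torus; \<^term>\<open>vec.span\<close> is the complex
  span, whereas \<^term>\<open>span\<close> is the real span.\<close>

definition semi_torus_lattice :: "(complex^'n::finite) set \<Rightarrow> bool" where
  "semi_torus_lattice \<Lambda> \<longleftrightarrow>
     0 \<in> \<Lambda> \<and> (\<forall>u\<in>\<Lambda>. \<forall>v\<in>\<Lambda>. u + v \<in> \<Lambda>) \<and> (\<forall>u\<in>\<Lambda>. - u \<in> \<Lambda>) \<and>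
     discrete \<Lambda> \<and> vec.span \<Lambda> = UNIV"

text \<open>Holomorphy of the action map \<open>\<complex>\<^sup>n \<times> X \<rightarrow> X\<close>, jointly in both variables.\<close>

definition holo_action ::
    "('a::topological_space, 'n::finite) chart set \<Rightarrow> (complex^'n \<Rightarrow> 'a \<Rightarrow> 'a) \<Rightarrow> bool" where
  "holo_action \<A> \<rho> \<longleftrightarrow> continuous_on UNIV (\<lambda>(z, x). \<rho> z x) \<and>
     (\<forall>a\<in>\<A>. \<forall>b\<in>\<A>. \<forall>z. \<forall>x\<in>cdom a. \<rho> z x \<in> cdom b \<longrightarrow>
        (\<exists>(A :: complex^'n^'n) (B :: complex^'n^'n).
           ((\<lambda>(y, p). cmap b (\<rho> y (cinv a p))) has_derivative (\<lambda>(v, w). A *v v + B *v w))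
             (at (z, cmap a x))))"

text \<open>\<open>G\<close> is a complex Lie subgroup of \<open>Aut\<^sup>0(X)\<close> isomorphic to \<open>\<complex>\<^sup>n/\<Lambda>\<close>. The isomorphism is given by
  the homomorphism \<open>\<rho>\<close> from \<open>\<complex>\<^sup>n\<close> onto \<open>G\<close> with kernel \<open>\<Lambda>\<close>. Thus \<open>\<rho>\<close> is the exponential map of \<open>G\<close>
  and \<open>\<complex>\<^sup>n\<close> is identified with the Lie algebra of \<open>G\<close>.\<close>

definition quotient_subgroup ::
    "('a::topological_space, 'n::finite) chart set \<Rightarrow> (complex^'n) set \<Rightarrow> (complex^'n \<Rightarrow> 'a \<Rightarrow> 'a)
       \<Rightarrow> ('a \<Rightarrow> 'a) set \<Rightarrow> bool" where
  "quotient_subgroup \<A> \<Lambda> \<rho> G \<longleftrightarrow>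
     G \<subseteq> Aut0 \<A> \<and> range \<rho> = G \<and>
     (\<forall>z w. \<rho> (z + w) = \<rho> z \<circ> \<rho> w) \<and> {z. \<rho> z = id} = \<Lambda> \<and> holo_action \<A> \<rho>"

text \<open>The other condition in the definition of a divisorial group, \<open>dim G = dim X\<close>, is expressed by
  the types: the index type of the charts is that of the space \<open>\<complex>\<^sup>n\<close> covering \<open>G\<close>.\<close>

definition has_open_orbit :: "('a::topological_space \<Rightarrow> 'a) set \<Rightarrow> bool" where
  "has_open_orbit G \<longleftrightarrow> (\<exists>x. open ((\<lambda>f. f x) ` G))"

definition divisorial_semi_torus ::
    "('a::topological_space, 'n::finite) chart set \<Rightarrow> (complex^'n) set \<Rightarrow> (complex^'n \<Rightarrow> 'a \<Rightarrow> 'a)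
       \<Rightarrow> ('a \<Rightarrow> 'a) set \<Rightarrow> bool" where
  "divisorial_semi_torus \<A> \<Lambda> \<rho> G \<longleftrightarrow>
     semi_torus_lattice \<Lambda> \<and> quotient_subgroup \<A> \<Lambda> \<rho> G \<and> has_open_orbit G"

text \<open>The components, in the chart \<open>a\<close>, of the vector field on \<open>X\<close> given by the element \<open>v\<close> of the
  Lie algebra.\<close>

definition fund_field :: "(complex^'n \<Rightarrow> 'a \<Rightarrow> 'a) \<Rightarrow> complex^'n \<Rightarrow> ('a, 'n::finite) chart \<Rightarrow> 'a
    \<Rightarrow> complex^'n" where
  "fund_field \<rho> v a x = frechet_derivative (\<lambda>z. cmap a (\<rho> z x)) (at 0) v"

text \<open>The support of \<open>D\<^sub>\<gg>\<close>; the determinant is the coefficient of \<open>s\<^sup>1 \<and> \<dots> \<and> s\<^sup>n\<close> with respect to the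
  frame of \<open>-K\<^sub>X\<close> given by the chart, where \<open>s\<^sup>j\<close> is the vector field of the \<open>j\<close>-th unit vector. The
  multiplicities of the divisor play no role in its complement.\<close>

definition D_supp ::
    "('a, 'n::finite) chart set \<Rightarrow> (complex^'n \<Rightarrow> 'a \<Rightarrow> 'a) \<Rightarrow> 'a set" where
  "D_supp \<A> \<rho> = {x. \<forall>a\<in>\<A>. x \<in> cdom a \<longrightarrow> det (\<chi> i j. fund_field \<rho> (axis j 1) a x $ i) = 0}"

section \<open>Invariant Kaehler metrics\<close>

definition hermitian_mat :: "complex^'n^'n \<Rightarrow> bool" where
  "hermitian_mat H \<longleftrightarrow> (\<forall>j k. H $ j $ k = cnj (H $ k $ j))"

definition pos_def_hermitian :: "complex^'n^'n::finite \<Rightarrow> bool" where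
  "pos_def_hermitian H \<longleftrightarrow> hermitian_mat H \<and>
     (\<forall>v. v \<noteq> 0 \<longrightarrow> 0 < Re (\<Sum>j\<in>UNIV. \<Sum>k\<in>UNIV. H $ j $ k * v $ j * cnj (v $ k)))"

text \<open>Sesquilinear forms are given on the tangent spaces by matrices, one for each chart: the tensor
  \<open>\<Sum>\<^sub>j\<^sub>k h\<^sub>j\<^sub>k dz\<^sub>j \<otimes> d\<bar>z\<^sub>k\<close> has the matrix \<open>h\<close> in the chart with coordinates \<open>z\<close>. The \<open>(1,1)\<close>-form of such
  a tensor is \<open>i \<Sum>\<^sub>j\<^sub>k h\<^sub>j\<^sub>k dz\<^sub>j \<and> d\<bar>z\<^sub>k\<close>. With \<open>A\<close> the Jacobian matrix of a holomorphic map,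
  \<open>pull A H\<close> is the matrix of the pull-back.\<close>

type_synonym ('a, 'n) herm_tensor = "('a, 'n) chart \<Rightarrow> 'a \<Rightarrow> complex^'n^'n"

definition pull :: "complex^'n^'n \<Rightarrow> complex^'n^'n \<Rightarrow> complex^'n^'n::finite" where
  "pull A H = transpose A ** H ** map_matrix cnj A"

text \<open>The map \<open>f\<close> pulls back the tensor \<open>h\<close>, at the points of \<open>W\<close>, to itself. For \<open>f\<close> the identity,
  this is the compatibility of the matrices of \<open>h\<close> in different charts.\<close>

definition preserves_tensor ::
    "('a, 'n::finite) chart set \<Rightarrow> 'a set \<Rightarrow> ('a \<Rightarrow> 'a) \<Rightarrow> ('a, 'n) herm_tensor \<Rightarrow> bool" where
  "preserves_tensor \<A> W f h \<longleftrightarrow>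
     (\<forall>a\<in>\<A>. \<forall>b\<in>\<A>. \<forall>x\<in>W. x \<in> cdom a \<and> f x \<in> cdom b \<longrightarrow>
        h a x = pull (jacobian (cmap b \<circ> f \<circ> cinv a) (at (cmap a x))) (h b (f x)))"

text \<open>\<open>d\<omega> = 0\<close> for \<open>\<omega> = i \<Sum>\<^sub>j\<^sub>k h\<^sub>j\<^sub>k dz\<^sub>j \<and> d\<bar>z\<^sub>k\<close>: the conjuncts are the vanishing of the components of
  \<open>\<partial>\<omega>\<close> and of \<open>\<bar>\<partial>\<omega>\<close>.\<close>

definition closed_form_on :: "(complex^'n) set \<Rightarrow> (complex^'n \<Rightarrow> complex^'n^'n::finite) \<Rightarrow> bool" where
  "closed_form_on S h \<longleftrightarrow>
     (\<forall>p\<in>S. \<forall>j k m. dz m (\<lambda>q. h q $ j $ k) p = dz j (\<lambda>q. h q $ m $ k) p \<and>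
                    dzbar m (\<lambda>q. h q $ j $ k) p = dzbar k (\<lambda>q. h q $ j $ m) p)"

text \<open>Kaehler metrics on the open set \<open>W\<close>. The last conjunct only fixes the irrelevant values of the
  function representing a metric.\<close>

definition kaehler_metric ::
    "('a, 'n::finite) chart set \<Rightarrow> 'a set \<Rightarrow> ('a, 'n) herm_tensor \<Rightarrow> bool" where
  "kaehler_metric \<A> W g \<longleftrightarrow>
     preserves_tensor \<A> W id g \<and>
     (\<forall>a\<in>\<A>. (\<forall>x\<in>cdom a \<inter> W. pos_def_hermitian (g a x)) \<and>
        smooth_on (cmap a ` (cdom a \<inter> W)) (\<lambda>p. g a (cinv a p)) \<and>
        closed_form_on (cmap a ` (cdom a \<inter> W)) (\<lambda>p. g a (cinv a p))) \<and>
     (\<forall>a x. \<not> (a \<in> \<A> \<and> x \<in> cdom a \<inter> W) \<longrightarrow> g a x = 0)"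

definition invariant_metrics ::
    "('a, 'n::finite) chart set \<Rightarrow> ('a \<Rightarrow> 'a) set \<Rightarrow> 'a set \<Rightarrow> ('a, 'n) herm_tensor set" where
  "invariant_metrics \<A> G D = {g. kaehler_metric \<A> (- D) g \<and> (\<forall>f\<in>G. preserves_tensor \<A> (- D) f g)}"

text \<open>The \<open>(1,1)\<close>-form of the tensor \<open>h\<close> is \<open>i\<partial>\<bar>\<partial>\<phi>\<close> for a smooth real function \<open>\<phi>\<close> on \<open>W\<close>.\<close>

definition ddbar_exact ::
    "('a, 'n::finite) chart set \<Rightarrow> 'a set \<Rightarrow> ('a, 'n) herm_tensor \<Rightarrow> bool" where
  "ddbar_exact \<A> W h \<longleftrightarrow> (\<exists>\<phi> :: 'a \<Rightarrow> real.
     \<forall>a\<in>\<A>. smooth_on (cmap a ` (cdom a \<inter> W)) (\<lambda>p. \<phi> (cinv a p)) \<and>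
       (\<forall>x\<in>cdom a \<inter> W.
          h a x = (\<chi> j k. dz j (dzbar k (\<lambda>p. complex_of_real (\<phi> (cinv a p)))) (cmap a x))))"

definition kaehler_equiv ::
    "('a, 'n::finite) chart set \<Rightarrow> ('a \<Rightarrow> 'a) set \<Rightarrow> 'a set
       \<Rightarrow> (('a, 'n) herm_tensor \<times> ('a, 'n) herm_tensor) set" where
  "kaehler_equiv \<A> G D = {(g, g'). g \<in> invariant_metrics \<A> G D \<and> g' \<in> invariant_metrics \<A> G D \<and>
     ddbar_exact \<A> (- D) (\<lambda>a x. g a x - g' a x)}"

definition kaehler_class ::
    "('a, 'n::finite) chart set \<Rightarrow> ('a \<Rightarrow> 'a) set \<Rightarrow> 'a set \<Rightarrow> ('a, 'n) herm_tensor
       \<Rightarrow> ('a, 'n) herm_tensor set" where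
  "kaehler_class \<A> G D g = kaehler_equiv \<A> G D `` {g}"

definition kaehler_cone ::
    "('a, 'n::finite) chart set \<Rightarrow> ('a \<Rightarrow> 'a) set \<Rightarrow> 'a set \<Rightarrow> ('a, 'n) herm_tensor set set" where
  "kaehler_cone \<A> G D = invariant_metrics \<A> G D // kaehler_equiv \<A> G D"

text \<open>The real dimension of the cone, that is, of its linear span in the real vector space of tensors
  modulo those whose form is \<open>i\<partial>\<bar>\<partial>\<close>-exact. It is the supremum of the numbers of linearly independent
  classes in the cone.\<close>

definition classes_independent ::
    "('a, 'n::finite) chart set \<Rightarrow> 'a set \<Rightarrow> ('a, 'n) herm_tensor set set \<Rightarrow> bool" where
  "classes_independent \<A> D T \<longleftrightarrow>
     (\<forall>(g :: ('a, 'n) herm_tensor set \<Rightarrow> ('a, 'n) herm_tensor) (u :: ('a, 'n) herm_tensor set \<Rightarrow> real).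
        (\<forall>t\<in>T. g t \<in> t) \<and> ddbar_exact \<A> (- D) (\<lambda>a x. \<Sum>t\<in>T. u t *\<^sub>R g t a x) \<longrightarrow>
        (\<forall>t\<in>T. u t = 0))"

definition kaehler_cone_dim ::
    "('a, 'n::finite) chart set \<Rightarrow> ('a \<Rightarrow> 'a) set \<Rightarrow> 'a set \<Rightarrow> enat" where
  "kaehler_cone_dim \<A> G D =
     (SUP T \<in> {T. T \<subseteq> kaehler_cone \<A> G D \<and> finite T \<and> classes_independent \<A> D T}. enat (card T))"

text \<open>The matrix \<open>C\<close> is a linear change of coordinates on \<open>\<complex>\<^sup>n\<close>, with new coordinates \<open>w = C z\<close>. In the
  coordinates induced by \<open>w\<close> on the orbit of \<open>x\<^sub>0\<close>, the coefficient matrix of \<open>g\<close> is constantly \<open>H\<close>.\<close>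

definition const_coeff_matrix ::
    "('a, 'n::finite) chart set \<Rightarrow> (complex^'n \<Rightarrow> 'a \<Rightarrow> 'a) \<Rightarrow> complex^'n^'n \<Rightarrow> 'a
       \<Rightarrow> ('a, 'n) herm_tensor \<Rightarrow> complex^'n^'n \<Rightarrow> bool" where
  "const_coeff_matrix \<A> \<rho> C x0 g H \<longleftrightarrow>
     (let orb = (\<lambda>w. \<rho> (matrix_inv C *v w) x0) in
      \<forall>w. \<forall>a\<in>\<A>. orb w \<in> cdom a \<longrightarrow>
        H = pull (jacobian (\<lambda>w'. cmap a (orb w')) (at w)) (g a (orb w)))"

section \<open>The quotient space of matrices\<close>

text \<open>The set \<open>L\<close> consists of the indices of the coordinates of the summand \<open>\<complex>\<^sup>l\<close>, so that \<open>l = card L\<close>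
  and \<open>k = card (- L)\<close>, either of which may be zero; \<open>l \<times> l\<close>-matrices are indexed by \<open>L \<times> L\<close>.\<close>

definition split_real_span :: "'n set \<Rightarrow> (complex^'n) set" where
  "split_real_span L = {w. \<forall>j\<in>L. w $ j \<in> \<real>}"

definition block_embed :: "'n set \<Rightarrow> ('n \<Rightarrow> 'n \<Rightarrow> complex) \<Rightarrow> complex^'n^'n" where
  "block_embed L M = (\<chi> i j. if i \<in> L \<and> j \<in> L then M i j else 0)"

definition real_block :: "'n set \<Rightarrow> (complex^'n^'n) set" where
  "real_block L = block_embed L ` {M. \<forall>i\<in>L. \<forall>j\<in>L. M i j \<in> \<real>}"

definition coset :: "'v::real_vector set \<Rightarrow> 'v \<Rightarrow> 'v set" where
  "coset W A = (\<lambda>B. A + B) ` W"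

text \<open>The convex cone generated by a set of elements of a quotient vector space. Only positive
  multiples are allowed, so that zero does not automatically belong to the cone.\<close>

inductive_set generated_cone :: "'v::real_vector set set \<Rightarrow> 'v set set" for S where
  base: "s \<in> S \<Longrightarrow> s \<in> generated_cone S"
| scale: "s \<in> generated_cone S \<Longrightarrow> 0 < c \<Longrightarrow> (\<lambda>x. c *\<^sub>R x) ` s \<in> generated_cone S"
| add: "s \<in> generated_cone S \<Longrightarrow> t \<in> generated_cone S \<Longrightarrow>
          {x + y |x y. x \<in> s \<and> y \<in> t} \<in> generated_cone S"

end

theory Submission
  imports Defs "HOL-Complex_Analysis.Conformal_Mappings"
begin

text \<open>The complement of \<open>D\<^sub>\<gg>\<close> is a single orbit: all orbits in it are open, and it is connected because
  in a chart \<open>D\<^sub>\<gg>\<close> is the zero set of a function which is holomorphic on complex lines. The stabilizer of a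
  point of it is \<open>\<Lambda>\<close>, since an element that fixes the dense orbit pointwise is the identity. Hence the
  invariant tensors are those which pull back to constant matrices under the orbit map, and closedness
  and smoothness are read off from its local inverses. If the form of a constant matrix \<open>H\<close> is
  \<open>i\<partial>\<bar>\<partial>\<phi>\<close>, averaging the periodic function \<open>\<phi>\<close> over the parallelograms spanned by two
  periods shows that the form vanishes on \<open>\<Lambda> \<times> \<Lambda>\<close>, hence on the real span of \<open>\<Lambda>\<close>, which says that
  \<open>H\<close> lies in the real block. Conversely the form of a real symmetric block \<open>H\<close> is \<open>i\<partial>\<bar>\<partial>\<close> of the
  periodic function \<open>2 \<Sum> H\<^sub>j\<^sub>k Im w\<^sub>j Im w\<^sub>k\<close>.\<close>

section \<open>Complex differentiable functions of several variables\<close>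

text \<open>The manifold and the action come with no more than complex differentiability at each
  point, whereas three steps ask for more: the inverse function theorem for the orbit map wants a
  continuous derivative, metrics and potentials must be smooth of every order, and closedness rests
  on symmetric second derivatives. All of this is obtained from Cauchy estimates on complex lines
  whose constants are uniform in the base point. For the determinant that cuts out
  \<open>D_supp\<close>, holomorphy on lines is enough, because two points are always compared on
  the complex line through them, where the zeros are countable. Elements of
  \<open>real_block L\<close> need not be hermitian, but combinations of coefficient matrices of
  metrics are. Hence two classes are compared modulo \<open>Herm \<inter> real_block L\<close>, the
  real symmetric matrices in the block, of dimension l (l + 1) / 2; the hermitian matrices have
  dimension n^2, and the dimension of the cone is the difference. To attain it by metrics, a basis
  of the hermitian matrices has to be completed by positive definite ones.\<close>

abbreviation fder :: "('a::real_normed_vector \<Rightarrow> 'b::real_normed_vector) \<Rightarrow> 'a \<Rightarrow> 'a \<Rightarrow> 'b" where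
  "fder f p \<equiv> frechet_derivative f (at p)"

text \<open>Commuting with \<open>\<i>\<close> is all that has to be asked: a Frechet derivative is
  real linear, so it becomes complex linear (\<open>linear_vsmult\<close>). Continuity of the
  derivative in \<open>p\<close> is a consequence, by \<open>hol_fder\<close>.\<close>

definition hol :: "(complex^'n) set \<Rightarrow> (complex^'n \<Rightarrow> complex) \<Rightarrow> bool" where
  "hol S f \<longleftrightarrow> (\<forall>p\<in>S. \<exists>D. (f has_derivative D) (at p) \<and> (\<forall>v. D (\<i> *s v) = \<i> * D v))"

lemma norm_vsmult: "norm (c *s v) = norm c * norm (v :: complex^'n)"
  by (simp add: norm_vec_def norm_mult L2_set_right_distrib)

lemma vsmult_split: "c *s (v :: complex^'n) = Re c *\<^sub>R v + Im c *\<^sub>R (\<i> *s v)"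
proof -
  have "c * (v $ i) = Re c *\<^sub>R v $ i + Im c *\<^sub>R (\<i> * v $ i)" for i
    by (simp add: complex_eq_iff)
  then show ?thesis by (simp add: vec_eq_iff)
qed

lemma bounded_linear_vsmult_left: "bounded_linear (\<lambda>c. c *s (w :: complex^'n))"
proof (rule bounded_linearI')
  show "(a + b) *s w = a *s w + b *s w" for a b by (simp add: vector_sadd_rdistrib)
  show "(r *\<^sub>R a) *s w = r *\<^sub>R (a *s w)" for r a
    by (simp add: vec_eq_iff)
qed

lemma linear_vsmult:
  assumes "linear (D :: complex^'n \<Rightarrow> complex)" "\<And>v. D (\<i> *s v) = \<i> * D v"
  shows "D (c *s v) = c * D v"
proof -
  have "D (c *s v) = Re c *\<^sub>R D v + Im c *\<^sub>R (\<i> * D v)"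
    by (subst vsmult_split) (simp add: assms(2) linear_add[OF assms(1)] linear_scale[OF assms(1)])
  also have "\<dots> = c * D v" by (simp add: complex_eq_iff)
  finally show ?thesis .
qed

lemma hol_has_derivative:
  assumes "hol S f" "p \<in> S" shows "(f has_derivative fder f p) (at p)"
  using assms unfolding hol_def by (metis frechet_derivative_at)

lemma hol_fder_vsmult:
  assumes "hol S f" "p \<in> S" shows "fder f p (c *s v) = c * fder f p v"
proof -
  obtain D where D: "(f has_derivative D) (at p)" "\<And>v. D (\<i> *s v) = \<i> * D v"
    using assms unfolding hol_def by blast
  have "fder f p = D" using D(1) by (metis frechet_derivative_at)
  then show ?thesis using linear_vsmult[OF has_derivative_linear[OF D(1)] D(2)] by simp
qed

lemma hol_linear_fder: "hol S f \<Longrightarrow> p \<in> S \<Longrightarrow> linear (fder f p)"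
  by (rule has_derivative_linear[OF hol_has_derivative])

lemma hol_subset: "hol S f \<Longrightarrow> T \<subseteq> S \<Longrightarrow> hol T f"
  unfolding hol_def by blast

lemma hol_continuous_on: "hol S f \<Longrightarrow> continuous_on S f"
  by (meson continuous_at_imp_continuous_on hol_has_derivative has_derivative_continuous)

lemma hol_line:
  assumes "hol S f" "p + t *s w \<in> S"
  shows "((\<lambda>t. f (p + t *s w)) has_field_derivative fder f (p + t *s w) w) (at t)"
proof -
  have "((\<lambda>t. p + t *s w) has_derivative (\<lambda>h. h *s w)) (at t)"
    by (rule has_derivative_eq_rhs, rule has_derivative_add[OF has_derivative_const
          bounded_linear_imp_has_derivative[OF bounded_linear_vsmult_left]]) simp
  from has_derivative_compose[OF this hol_has_derivative[OF assms]]
  have "((\<lambda>t. f (p + t *s w)) has_derivative (\<lambda>h. fder f (p + t *s w) (h *s w))) (at t)" .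
  then show ?thesis
    unfolding has_field_derivative_def
    by (simp add: hol_fder_vsmult[OF assms] mult.commute[of _ "fder f (p + t *s w) w"])
qed

text \<open>Discs of radius \<open>R/4\<close> about points of norm at most \<open>R/2\<close> stay
  in \<open>ball 0 R\<close>, so Cauchy's inequality bounds the second derivative by 2 M / (R/4)^2 =
  32 M / R^2 and the first by M / (R/4). Taylor's formula at 0, divided by \<open>s\<close>, gives
  the first estimate. Both depend on \<open>h\<close> only through \<open>M\<close>.\<close>

lemma difference_quotient_bound:
  fixes h :: "complex \<Rightarrow> complex"
  assumes h: "h holomorphic_on ball 0 R" and M: "\<And>t. t \<in> ball 0 R \<Longrightarrow> norm (h t) \<le> M"
    and R: "0 < R" and s: "norm s \<le> R / 2" "s \<noteq> 0"
  shows "norm ((h s - h 0) / s - deriv h 0) \<le> 32 * M / R^2 * norm s"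
    and "norm (deriv h 0) \<le> 4 * M / R"
proof -
  have sub: "cball z (R/4) \<subseteq> ball 0 R" if "norm z \<le> R/2" for z
  proof
    fix y assume "y \<in> cball z (R/4)"
    then have "norm (y - z) \<le> R/4" by (simp add: dist_norm norm_minus_commute)
    then have "norm y \<le> R/4 + R/2" using norm_triangle_ineq[of "y - z" z] that by simp
    then show "y \<in> ball 0 R" using R by simp
  qed
  have cauchy: "norm ((deriv ^^ n) h z) \<le> fact n * M / (R/4)^n" if "norm z \<le> R/2" for z n
  proof (rule Cauchy_inequality)
    show "h holomorphic_on ball z (R/4)"
      by (rule holomorphic_on_subset[OF h]) (use sub[OF that] ball_subset_cball in blast)
    show "continuous_on (cball z (R/4)) h"
      by (rule continuous_on_subset[OF holomorphic_on_imp_continuous_on[OF h] sub[OF that]])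
    show "norm (h x) \<le> M" if "norm (z - x) = R/4" for x
      using that sub[OF \<open>norm z \<le> R/2\<close>] by (intro M) (auto simp: dist_norm)
  qed (use R in auto)
  have "norm ((deriv ^^ 0) h s - (\<Sum>i\<le>1. (deriv ^^ i) h 0 * (s - 0) ^ i / fact i))
          \<le> (32 * M / R^2) * norm (s - 0) ^ Suc 1 / fact 1"
  proof (rule complex_Taylor[where S = "cball 0 (R/2)" and f = "\<lambda>i. (deriv ^^ i) h"])
    fix i :: nat and x :: complex assume "x \<in> cball 0 (R/2)" "i \<le> 1"
    then have "(deriv ^^ i) h holomorphic_on ball 0 R" "x \<in> ball 0 R"
      using R h by (auto intro: holomorphic_higher_deriv)
    then show "((deriv ^^ i) h has_field_derivative (deriv ^^ Suc i) h x) (at x within cball 0 (R/2))"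
      by (simp add: holomorphic_derivI)
  next
    fix x :: complex assume "x \<in> cball 0 (R/2)"
    then show "norm ((deriv ^^ Suc 1) h x) \<le> 32 * M / R^2"
      using cauchy[of x 2] by (simp add: numeral_2_eq_2 power2_eq_square field_simps)
  qed (use s R in auto)
  then have "norm (h s - (h 0 + deriv h 0 * s)) \<le> (32 * M / R^2) * norm s ^ 2"
    by (simp add: numeral_2_eq_2)
  moreover have "(h s - h 0) / s - deriv h 0 = (h s - (h 0 + deriv h 0 * s)) / s"
    using s by (simp add: field_simps)
  ultimately show "norm ((h s - h 0) / s - deriv h 0) \<le> 32 * M / R^2 * norm s"
    using s by (simp add: norm_divide power2_eq_square field_simps)
  show "norm (deriv h 0) \<le> 4 * M / R"
    using cauchy[of 0 1] R by (simp add: field_simps)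
qed

text \<open>The one-variable estimate on the line through \<open>q\<close> in direction
  \<open>w\<close>; the bound on \<open>norm w\<close> keeps the parameter disc of radius
  \<open>R\<close> inside the ball. The constants involve neither \<open>q\<close> nor
  \<open>w\<close>, which later makes the convergence of difference quotients uniform.\<close>

lemma hol_quotient_bound:
  fixes f :: "complex^'n \<Rightarrow> complex"
  assumes f: "hol (ball q R) f" and M: "\<And>y. y \<in> ball q R \<Longrightarrow> norm (f y) \<le> M" and R: "0 < R"
    and w: "norm w \<le> 1"
  shows "s \<noteq> 0 \<Longrightarrow> norm s \<le> R / 2 \<Longrightarrow>
           norm ((f (q + s *s w) - f q) / s - fder f q w) \<le> 32 * M / R^2 * norm s"
    and "norm (fder f q w) \<le> 4 * M / R"
proof -
  have inb: "q + t *s w \<in> ball q R" if "t \<in> ball 0 R" for t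
  proof -
    have "norm (t *s w) \<le> norm t" using w by (simp add: norm_vsmult mult_left_le)
    with that show ?thesis by (simp add: dist_norm)
  qed
  let ?h = "\<lambda>t. f (q + t *s w)"
  have hol: "?h holomorphic_on ball 0 R"
    unfolding holomorphic_on_def field_differentiable_def
    using hol_line[OF f inb] DERIV_subset by blast
  have d: "deriv ?h 0 = fder f q w"
    using hol_line[OF f inb, of 0] R by (intro DERIV_imp_deriv) simp
  show "norm ((f (q + s *s w) - f q) / s - fder f q w) \<le> 32 * M / R^2 * norm s"
    if "s \<noteq> 0" "norm s \<le> R / 2"
    using difference_quotient_bound(1)[OF hol M[OF inb] R that(2,1)] d by simp
  show "norm (fder f q w) \<le> 4 * M / R"
    using difference_quotient_bound(2)[OF hol M[OF inb] R, of "R/2"] d R by simp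
qed

lemma vsmult_of_real: "complex_of_real r *s (w :: complex^'n) = r *\<^sub>R w"
  unfolding vec_eq_iff vector_smult_component vector_scaleR_component
  by (simp add: scaleR_conv_of_real)

text \<open>The radius is doubled so that every point of \<open>ball p R\<close> is the centre of a
  ball of radius \<open>R\<close> on which the same bound \<open>M\<close> holds.\<close>

lemma hol_bounded_nbhd:
  fixes f :: "complex^'n \<Rightarrow> complex"
  assumes "open S" "hol S f" "p \<in> S"
  obtains R M where "0 < R" "ball p (2*R) \<subseteq> S" "\<And>y. y \<in> ball p (2*R) \<Longrightarrow> norm (f y) \<le> M"
proof -
  obtain e where e: "0 < e" "cball p e \<subseteq> S" using assms open_contains_cball by blast
  have "compact (f ` cball p e)"
    by (intro compact_continuous_image continuous_on_subset[OF hol_continuous_on[OF assms(2)]] e) simp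
  then obtain M where "\<And>y. y \<in> cball p e \<Longrightarrow> norm (f y) \<le> M"
    using compact_imp_bounded bounded_iff by (metis imageI)
  with e show ?thesis by (intro that[of "e/2" M]) auto
qed

text \<open>The derivative in direction \<open>w\<close> is a limit of difference quotients that are
  holomorphic in \<open>t\<close>, and by \<open>hol_quotient_bound\<close> the limit is locally
  uniform; hence it is holomorphic. The line direction \<open>v\<close> is independent of
  \<open>w\<close>.\<close>

lemma hol_fder_line:
  fixes f :: "complex^'n \<Rightarrow> complex"
  assumes S: "open S" and f: "hol S f" and w: "norm w \<le> 1"
  shows "(\<lambda>t. fder f (p + t *s v) w) holomorphic_on {t. p + t *s v \<in> S}"
proof -
  have cont: "continuous_on UNIV (\<lambda>t. p + t *s v)"
    by (intro continuous_intros linear_continuous_on bounded_linear_vsmult_left)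
  have "\<exists>f'. ((\<lambda>t. fder f (p + t *s v) w) has_field_derivative f') (at t0)"
    if t0: "p + t0 *s v \<in> S" for t0
  proof -
    obtain R M where R: "0 < R" "ball (p + t0 *s v) (2*R) \<subseteq> S"
        "\<And>y. y \<in> ball (p + t0 *s v) (2*R) \<Longrightarrow> norm (f y) \<le> M"
      using hol_bounded_nbhd[OF S f t0] by metis
    have "open ((\<lambda>t. p + t *s v) -` ball (p + t0 *s v) R)"
      using cont by (simp add: continuous_on_open_vimage)
    moreover have "t0 \<in> (\<lambda>t. p + t *s v) -` ball (p + t0 *s v) R" using R(1) by simp
    ultimately obtain d where "0 < d" "cball t0 d \<subseteq> (\<lambda>t. p + t *s v) -` ball (p + t0 *s v) R"
      by (metis open_contains_cball)
    then have d: "0 < d" "\<And>t. t \<in> cball t0 d \<Longrightarrow> p + t *s v \<in> ball (p + t0 *s v) R"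
      by blast+
    have sub: "ball q R \<subseteq> ball (p + t0 *s v) (2*R)" if "q \<in> ball (p + t0 *s v) R" for q
    proof
      fix y assume "y \<in> ball q R"
      then show "y \<in> ball (p + t0 *s v) (2*R)" using that dist_triangle[of "p + t0 *s v" y q] by auto
    qed
    \<comment> \<open>Nonzero steps tending to 0 that never exceed \<open>R/2\<close>, the range in
      which \<open>hol_quotient_bound\<close> applies.\<close>
    define s where "s n = complex_of_real (R / 2 * inverse (real (Suc n)))" for n
    have ns: "norm (s n) = R / 2 * inverse (real (Suc n))" for n
      using R(1) unfolding s_def norm_of_real by (simp add: abs_mult)
    have s: "s n \<noteq> 0" "norm (s n) \<le> R/2" for n
    proof -
      show "s n \<noteq> 0" using R(1) ns[of n] by (metis divide_eq_0_iff inverse_nonzero_iff_nonzero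
          less_numeral_extra(3) mult_eq_0_iff norm_zero of_nat_eq_0_iff old.nat.distinct(2) zero_neq_numeral)
      show "norm (s n) \<le> R/2" using R(1) unfolding ns by (simp add: field_simps)
    qed
    have s0: "(\<lambda>n. norm (s n)) \<longlonglongrightarrow> 0"
      using tendsto_mult_right_zero[OF LIMSEQ_inverse_real_of_nat] unfolding ns .
    have sinb: "q + s n *s w \<in> ball q R" for q n
    proof -
      have "norm (s n *s w) \<le> norm (s n)" using w by (simp add: norm_vsmult mult_left_le)
      then show ?thesis using s(2)[of n] R(1) by (simp add: dist_norm)
    qed
    let ?F = "\<lambda>n t. (f ((p + s n *s w) + t *s v) - f (p + t *s v)) / s n"
    have "(\<lambda>t. fder f (p + t *s v) w) holomorphic_on ball t0 d"
    proof (rule holomorphic_uniform_sequence[where f = ?F])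
      show "?F n holomorphic_on ball t0 d" for n
      proof -
        have 1: "p + t *s v \<in> S" "(p + s n *s w) + t *s v \<in> S" if "t \<in> ball t0 d" for t
        proof -
          have a: "p + t *s v \<in> ball (p + t0 *s v) R" using d(2) that by auto
          show "p + t *s v \<in> S" using a sub[OF a] R by (metis centre_in_ball subsetD)
          show "(p + s n *s w) + t *s v \<in> S"
            using sinb[of "p + t *s v" n] sub[OF a] R(2) by (metis (no_types, lifting) add.assoc add.commute subsetD)
        qed
        have "(\<lambda>t. f (p + t *s v)) holomorphic_on ball t0 d" "(\<lambda>t. f ((p + s n *s w) + t *s v)) holomorphic_on ball t0 d"
          unfolding holomorphic_on_def field_differentiable_def
          using hol_line[OF f 1(1)] hol_line[OF f 1(2)] DERIV_subset by blast+
        then show ?thesis by (intro holomorphic_intros) (use s in auto)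
      qed
      fix x assume "x \<in> ball t0 d"
      then obtain e where e: "e > 0" "cball x e \<subseteq> ball t0 d"
        using open_contains_cball open_ball by blast
      have bnd: "norm (?F n t - fder f (p + t *s v) w) \<le> 32 * M / R^2 * norm (s n)" if "t \<in> cball x e" for t n
      proof -
        have "t \<in> cball t0 d" using that e by auto
        note q = d(2)[OF this]
        have "norm ((f ((p + t *s v) + s n *s w) - f (p + t *s v)) / s n - fder f (p + t *s v) w) \<le> 32 * M / R^2 * norm (s n)"
        proof (rule hol_quotient_bound)
          show "hol (ball (p + t *s v) R) f"
            using hol_subset[OF f] sub[OF q] R by blast
          show "norm (f y) \<le> M" if "y \<in> ball (p + t *s v) R" for y
            using that sub[OF q] R by blast
        qed (use s R w in auto)
        then show ?thesis by (simp add: add_ac)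
      qed
      have "uniform_limit (cball x e) ?F (\<lambda>t. fder f (p + t *s v) w) sequentially"
        unfolding uniform_limit_iff
      proof (intro allI impI)
        fix \<epsilon> :: real assume "0 < \<epsilon>"
        have "(\<lambda>n. 32 * M / R^2 * norm (s n)) \<longlonglongrightarrow> 0"
          by (rule tendsto_mult_right_zero[OF s0])
        then have "\<forall>\<^sub>F n in sequentially. 32 * M / R^2 * norm (s n) < \<epsilon>"
          using order_tendstoD(2) \<open>0 < \<epsilon>\<close> by blast
        then show "\<forall>\<^sub>F n in sequentially. \<forall>t\<in>cball x e. dist (?F n t) (fder f (p + t *s v) w) < \<epsilon>"
          proof eventually_elim
            case (elim n)
            then show ?case using bnd[of _ n] unfolding dist_norm by (meson le_less_trans)
          qed
      qed
      with e show "\<exists>e>0. cball x e \<subseteq> ball t0 d \<and> uniform_limit (cball x e) ?F (\<lambda>t. fder f (p + t *s v) w) sequentially"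
        by blast
    qed simp
    then show ?thesis using d(1) by (metis centre_in_ball holomorphic_derivI open_ball)
  qed
  then show ?thesis
    unfolding holomorphic_on_def field_differentiable_def using DERIV_subset by blast
qed

lemma hol_fder_scale_bound:
  fixes f :: "complex^'n \<Rightarrow> complex"
  assumes f: "hol (ball q R) f" and M: "\<And>y. y \<in> ball q R \<Longrightarrow> norm (f y) \<le> M" and R: "0 < R"
  shows "norm (fder f q u) \<le> 4 * M / R * norm u"
proof (cases "u = 0")
  case True
  then show ?thesis using linear_0[OF hol_linear_fder[OF f, of q]] R by simp
next
  case False
  then have "norm (fder f q ((1 / norm u) *\<^sub>R u)) \<le> 4 * M / R"
    by (intro hol_quotient_bound(2)[OF f M R]) auto
  then show ?thesis
    using False linear_scale[OF hol_linear_fder[OF f, of q]] R by (simp add: field_simps)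
qed

text \<open>The derivative of \<open>\<partial>\<^sub>w f\<close> is obtained by differentiating the difference quotients in the direction
  \<open>w\<close> term by term, which also gives the symmetry of the second derivative.\<close>

lemma hol_fder_unit:
  fixes f :: "complex^'n \<Rightarrow> complex"
  assumes S: "open S" and f: "hol S f" and w: "norm w \<le> 1" and p: "p \<in> S"
  shows "\<exists>D. ((\<lambda>q. fder f q w) has_derivative D) (at p) \<and> (\<forall>v. D (\<i> *s v) = \<i> * D v) \<and>
           (\<forall>u. norm u \<le> 1 \<longrightarrow> D u = deriv (\<lambda>t. fder f (p + t *s w) u) 0)"
proof -
  \<comment> \<open>Three nested balls: \<open>q\<close> varies in \<open>ball p R\<close>, its
    translates \<open>q + t *s w\<close> in \<open>ball p (2*R)\<close>, and the derivative at a
    translate is estimated on a ball of radius \<open>2*R\<close>, which reaches out to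
    \<open>4*R\<close>.\<close>
  obtain R M where R: "0 < R" "ball p (2*(2*R)) \<subseteq> S"
        "\<And>y. y \<in> ball p (2*(2*R)) \<Longrightarrow> norm (f y) \<le> M"
  proof -
    obtain R0 M where "0 < R0" "ball p (2*R0) \<subseteq> S" "\<And>y. y \<in> ball p (2*R0) \<Longrightarrow> norm (f y) \<le> M"
      using hol_bounded_nbhd[OF S f p] by metis
    then show ?thesis by (intro that[of "R0/2" M]) auto
  qed
  have sub: "ball q r1 \<subseteq> ball p (r1 + r2)" if "q \<in> ball p r2" for q r1 r2
  proof
    fix y assume "y \<in> ball q r1"
    then show "y \<in> ball p (r1 + r2)" using that dist_triangle[of p y q] by auto
  qed
  have inS: "ball p R \<subseteq> S" "ball p (2*R) \<subseteq> S" "ball p (2*(2*R)) \<subseteq> S"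
    using R subset_ball[of R "2*(2*R)" p] subset_ball[of "2*R" "2*(2*R)" p] by auto
  have M0: "0 \<le> M" using R(3)[of p] R(1) norm_ge_zero[of "f p"] by (simp del: norm_ge_zero)
  have bd1: "norm (fder f y u) \<le> 4 * M / (2*R) * norm u" if "y \<in> ball p (2*R)" for y u
  proof (rule hol_fder_scale_bound)
    have "ball y (2*R) \<subseteq> ball p (2*(2*R))" using sub[OF that, of "2*R"] by simp
    then show "hol (ball y (2*R)) f" "\<And>z. z \<in> ball y (2*R) \<Longrightarrow> norm (f z) \<le> M"
      using hol_subset[OF f] R by blast+
  qed (use R in auto)
  \<comment> \<open>By \<open>bd1\<close> the number \<open>2 * M / R\<close> bounds the derivatives
    in directions of norm at most 1 on \<open>ball p (2*R)\<close>; it replaces \<open>M\<close> in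
    \<open>difference_quotient_bound\<close>.\<close>
  define C where "C = 32 * (2 * M / R) / R^2"
  \<comment> \<open>The candidate for the derivative exchanges the directions: the derivative in
    direction \<open>u\<close> is differentiated along \<open>w\<close>. Rescaling makes
    \<open>u\<close> a unit vector, and for \<open>u = 0\<close> the factor \<open>norm u\<close>
    yields 0.\<close>
  define g' where "g' q u = norm u * deriv (\<lambda>t. fder f (q + t *s w) ((1 / norm u) *\<^sub>R u)) 0" for q u
  have inb: "q + t *s w \<in> ball q R" if "t \<in> ball 0 R" for t q
  proof -
    have "norm (t *s w) \<le> norm t" using w by (simp add: norm_vsmult mult_left_le)
    with that show ?thesis by (simp add: dist_norm)
  qed
  have bd2: "norm ((fder f (q + s *s w) u - fder f q u) / s - deriv (\<lambda>t. fder f (q + t *s w) u) 0) \<le> C * norm s"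
    if q: "q \<in> ball p R" and u: "norm u \<le> 1" and s: "s \<noteq> 0" "norm s \<le> R/2" for q u s
  proof -
    have qq: "q + t *s w \<in> ball p (2*R)" if "t \<in> ball 0 R" for t
      using inb[OF that, of q] sub[OF q, of R] by (metis mult_2 subsetD)
    have "norm (((\<lambda>t. fder f (q + t *s w) u) s - (\<lambda>t. fder f (q + t *s w) u) 0) / s
                - deriv (\<lambda>t. fder f (q + t *s w) u) 0) \<le> 32 * (4 * M / (2*R)) / R^2 * norm s"
    proof (rule difference_quotient_bound)
      show "(\<lambda>t. fder f (q + t *s w) u) holomorphic_on ball 0 R"
        by (rule holomorphic_on_subset[OF hol_fder_line[OF S f u]]) (use qq inS in auto)
      fix t :: complex assume "t \<in> ball 0 R"
      note bd1[OF qq[OF this], of u]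
      also have "4 * M / (2*R) * norm u \<le> 4 * M / (2*R)"
        using u M0 R(1) by (intro mult_left_le) auto
      finally show "norm (fder f (q + t *s w) u) \<le> 4 * M / (2*R)" .
    qed (use R s in auto)
    then show ?thesis by (simp add: C_def)
  qed
  define s where "s n = R / 2 * inverse (real (Suc n))" for n
  have s: "0 < s n" "norm (s n) \<le> R/2" for n
    using R(1) by (auto simp: s_def abs_mult field_simps simp del: of_nat_Suc)
  have s0: "s \<longlonglongrightarrow> 0"
    using tendsto_mult_right_zero[OF LIMSEQ_inverse_real_of_nat] unfolding s_def .
  have qs: "q + s n *\<^sub>R w \<in> ball p (2*R)" if "q \<in> ball p R" for q n
  proof -
    have "q + complex_of_real (s n) *s w \<in> ball q R"
      by (rule inb) (use s[of n] R(1) in auto)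
    then show ?thesis using sub[OF that, of R] by (auto simp: vsmult_of_real)
  qed
  let ?F = "\<lambda>n q. (f (q + s n *\<^sub>R w) - f q) / s n"
  let ?F' = "\<lambda>n q u. (fder f (q + s n *\<^sub>R w) u - fder f q u) / s n"
  \<comment> \<open>Being uniform in \<open>q\<close> and linear in \<open>norm u\<close>, this is
    uniform convergence of the derivatives in operator norm, as
    \<open>has_derivative_sequence\<close> requires.\<close>
  have F'b: "norm (?F' n q u - g' q u) \<le> C * s n * norm u" if q: "q \<in> ball p R" for n q u
  proof (cases "u = 0")
    case True
    then show ?thesis using linear_0 hol_linear_fder[OF f] inS qs[OF q] q by (simp add: g'_def subset_iff linear_0)
  next
    case False
    let ?u = "(1 / norm u) *\<^sub>R u"
    have lin: "linear (fder f (q + s n *\<^sub>R w))" "linear (fder f q)"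
      using hol_linear_fder[OF f] inS qs[OF q] q by blast+
    have "norm ((fder f (q + complex_of_real (s n) *s w) ?u - fder f q ?u) / complex_of_real (s n)
            - deriv (\<lambda>t. fder f (q + t *s w) ?u) 0) \<le> C * norm (complex_of_real (s n))"
      using False s[of n] by (intro bd2[OF q]) auto
    then have *: "norm (?F' n q ?u - deriv (\<lambda>t. fder f (q + t *s w) ?u) 0) \<le> C * s n"
      using s(1)[of n] by (simp add: vsmult_of_real)
    have "?F' n q u - g' q u = norm u * (?F' n q ?u - deriv (\<lambda>t. fder f (q + t *s w) ?u) 0)"
      unfolding g'_def linear_scale[OF lin(1), of _ u] linear_scale[OF lin(2), of _ u]
        scaleR_conv_of_real[where 'a = complex]
      using False s(1)[of n] by (simp add: field_simps)
    then have "norm (?F' n q u - g' q u) = norm u * norm (?F' n q ?u - deriv (\<lambda>t. fder f (q + t *s w) ?u) 0)"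
      by (simp add: norm_mult)
    also have "\<dots> \<le> norm u * (C * s n)"
      by (intro mult_left_mono *) simp
    finally show ?thesis by (simp add: mult_ac)
  qed
  have lim: "(\<lambda>n. ?F n q) \<longlonglongrightarrow> fder f q w" if q: "q \<in> ball p R" for q
  proof -
    have "norm (?F n q - fder f q w) \<le> 32 * M / R^2 * s n" for n
    proof -
      have "ball q R \<subseteq> ball p (2*(2*R))" using sub[OF q, of R] subset_ball[of "2*R" "2*(2*R)" p] R(1) by auto
      then have "norm ((f (q + complex_of_real (s n) *s w) - f q) / complex_of_real (s n) - fder f q w)
          \<le> 32 * M / R^2 * norm (complex_of_real (s n))"
        using s[of n] R w by (intro hol_quotient_bound hol_subset[OF f]) auto
      then show ?thesis using s(1)[of n] by (simp add: vsmult_of_real)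
    qed
    moreover have "(\<lambda>n. 32 * M / R^2 * s n) \<longlonglongrightarrow> 0" by (rule tendsto_mult_right_zero[OF s0])
    ultimately have "(\<lambda>n. ?F n q - fder f q w) \<longlonglongrightarrow> 0"
      by (metis (no_types, lifting) Lim_null_comparison eventuallyI)
    then show ?thesis using Lim_null by blast
  qed
  have pR: "p \<in> ball p R" using R(1) by simp
  have "\<exists>g. \<forall>x\<in>ball p R. (\<lambda>n. ?F n x) \<longlonglongrightarrow> g x \<and> (g has_derivative g' x) (at x within ball p R)"
  proof (rule has_derivative_sequence[where f' = ?F' and ?x0.0 = p and l = "fder f p w"])
    fix n x assume x: "x \<in> ball p R"
    have "((\<lambda>q. f (q + s n *\<^sub>R w)) has_derivative fder f (x + s n *\<^sub>R w)) (at x within ball p R)"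
    proof (rule has_derivative_compose[of "\<lambda>q. q + s n *\<^sub>R w" "\<lambda>h. h"])
      show "((\<lambda>q. q + s n *\<^sub>R w) has_derivative (\<lambda>h. h)) (at x within ball p R)"
        by (auto intro!: derivative_eq_intros)
    qed (use hol_has_derivative[OF f] qs[OF x] inS in blast)
    moreover have "(f has_derivative fder f x) (at x within ball p R)"
      using hol_has_derivative[OF f] x inS has_derivative_at_withinI by blast
    ultimately have "((\<lambda>q. f (q + s n *\<^sub>R w) - f q) has_derivative (\<lambda>u. fder f (x + s n *\<^sub>R w) u - fder f x u)) (at x within ball p R)"
      by (rule has_derivative_diff)
    from has_derivative_mult_left[OF this, of "inverse (complex_of_real (s n))"]
    show "(?F n has_derivative ?F' n x) (at x within ball p R)"
      by (simp add: divide_inverse)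
  next
    fix e :: real assume "0 < e"
    have "(\<lambda>n. C * s n) \<longlonglongrightarrow> 0" by (rule tendsto_mult_right_zero[OF s0])
    then have "\<forall>\<^sub>F n in sequentially. C * s n < e" using order_tendstoD(2) \<open>0 < e\<close> by blast
    then show "\<forall>\<^sub>F n in sequentially. \<forall>x\<in>ball p R. \<forall>h. norm (?F' n x h - g' x h) \<le> e * norm h"
    proof eventually_elim
      case (elim n)
      then show ?case using F'b
        by (meson less_eq_real_def mult_right_mono norm_ge_zero order_trans)
    qed
  qed (rule convex_ball pR lim[OF pR])+
  then obtain g where g: "\<And>x. x \<in> ball p R \<Longrightarrow> (\<lambda>n. ?F n x) \<longlonglongrightarrow> g x"
      "\<And>x. x \<in> ball p R \<Longrightarrow> (g has_derivative g' x) (at x within ball p R)" by blast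
  have "g x = fder f x w" if "x \<in> ball p R" for x
    using LIMSEQ_unique[OF g(1) lim] that by blast
  then have "((\<lambda>q. fder f q w) has_derivative g' p) (at p within ball p R)"
    using has_derivative_transform[OF pR _ g(2)[OF pR]] by metis
  then have der: "((\<lambda>q. fder f q w) has_derivative g' p) (at p)"
    using R(1) by (metis at_within_open open_ball pR)
  have limF': "(\<lambda>n. ?F' n p u) \<longlonglongrightarrow> g' p u" for u
  proof -
    have "(\<lambda>n. C * s n * norm u) \<longlonglongrightarrow> 0"
      using tendsto_mult_left_zero[OF tendsto_mult_right_zero[OF s0]] by simp
    then have "(\<lambda>n. ?F' n p u - g' p u) \<longlonglongrightarrow> 0"
      using F'b[OF pR] by (metis (no_types, lifting) Lim_null_comparison eventuallyI)
    then show ?thesis using Lim_null by blast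
  qed
  have ci: "g' p (\<i> *s v) = \<i> * g' p v" for v
  proof (rule LIMSEQ_unique)
    show "(\<lambda>n. ?F' n p (\<i> *s v)) \<longlonglongrightarrow> g' p (\<i> *s v)" by (rule limF')
    have e: "?F' n p (\<i> *s v) = \<i> * ?F' n p v" for n
    proof -
      have "p + s n *\<^sub>R w \<in> S" using qs[OF pR] inS by blast
      then show ?thesis
        unfolding hol_fder_vsmult[OF f \<open>p + s n *\<^sub>R w \<in> S\<close>] hol_fder_vsmult[OF f p]
        by (simp add: right_diff_distrib)
    qed
    show "(\<lambda>n. ?F' n p (\<i> *s v)) \<longlonglongrightarrow> \<i> * g' p v"
      unfolding e by (rule tendsto_mult_left[OF limF'])
  qed
  have "g' p u = deriv (\<lambda>t. fder f (p + t *s w) u) 0" if u: "norm u \<le> 1" for u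
  proof (rule LIMSEQ_unique[OF limF'])
    have "norm (?F' n p u - deriv (\<lambda>t. fder f (p + t *s w) u) 0) \<le> C * s n" for n
      using bd2[OF pR u, of "complex_of_real (s n)"] s[of n] by (simp add: vsmult_of_real)
    moreover have "(\<lambda>n. C * s n) \<longlonglongrightarrow> 0" by (rule tendsto_mult_right_zero[OF s0])
    ultimately have "(\<lambda>n. ?F' n p u - deriv (\<lambda>t. fder f (p + t *s w) u) 0) \<longlonglongrightarrow> 0"
      by (metis (no_types, lifting) Lim_null_comparison eventuallyI)
    then show "(\<lambda>n. ?F' n p u) \<longlonglongrightarrow> deriv (\<lambda>t. fder f (p + t *s w) u) 0" using Lim_null by blast
  qed
  with der ci show ?thesis by blast
qed

lemma hol_scaleR: 
  assumes "hol S f" shows "hol S (\<lambda>p. r *\<^sub>R f p)"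
  unfolding hol_def
proof
  fix p assume "p \<in> S"
  then obtain D where "(f has_derivative D) (at p)" "\<forall>v. D (\<i> *s v) = \<i> * D v"
    using assms unfolding hol_def by blast
  then show "\<exists>D. ((\<lambda>p. r *\<^sub>R f p) has_derivative D) (at p) \<and> (\<forall>v. D (\<i> *s v) = \<i> * D v)"
    by (intro exI[of _ "\<lambda>v. r *\<^sub>R D v"]) (auto intro: has_derivative_scaleR_right)
qed

lemma hol_cong:
  assumes "open S" "\<And>p. p \<in> S \<Longrightarrow> f p = g p" "hol S f" shows "hol S g"
  unfolding hol_def
proof
  fix p assume p: "p \<in> S"
  then obtain D where "(f has_derivative D) (at p)" "\<forall>v. D (\<i> *s v) = \<i> * D v"
    using assms unfolding hol_def by blast
  then show "\<exists>D. (g has_derivative D) (at p) \<and> (\<forall>v. D (\<i> *s v) = \<i> * D v)"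
    using has_derivative_transform_within_open[of f D p UNIV S g] assms p by auto
qed

text \<open>The bootstrap to derivatives of all orders. The direction is rescaled to length 1 to
  bring it into the range of \<open>hol_fder_unit\<close>.\<close>

theorem hol_fder:
  assumes S: "open S" and f: "hol S (f :: complex^'n \<Rightarrow> complex)"
  shows "hol S (\<lambda>q. fder f q w)"
proof (cases "w = 0")
  case True
  have "hol S (\<lambda>q. 0)" unfolding hol_def by (intro ballI exI[of _ "\<lambda>_. 0"]) auto
  then show ?thesis by (rule hol_cong[OF S, rotated]) (use linear_0 hol_linear_fder[OF f] True in auto)
next
  case False
  let ?w = "(1 / norm w) *\<^sub>R w"
  have "hol S (\<lambda>q. fder f q ?w)"
    using hol_fder_unit[OF S f, of ?w] False unfolding hol_def by fastforce
  then have "hol S (\<lambda>q. norm w *\<^sub>R fder f q ?w)" by (rule hol_scaleR)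
  then show ?thesis
    by (rule hol_cong[OF S, rotated]) (use False linear_scale hol_linear_fder[OF f] in \<open>auto simp: linear_scale\<close>)
qed

text \<open>For directions in the unit ball this is the last clause of \<open>hol_fder_unit\<close>,
  where the derivative of the limit was found with the directions exchanged. Both sides are
  homogeneous in \<open>w\<close> and \<open>u\<close>, which gives the general case.\<close>

theorem hol_fder_symmetric:
  assumes S: "open S" and f: "hol S (f :: complex^'n \<Rightarrow> complex)" and p: "p \<in> S"
  shows "fder (\<lambda>q. fder f q w) p u = fder (\<lambda>q. fder f q u) p w"
proof -
  have unit: "fder (\<lambda>q. fder f q w) p u = fder (\<lambda>q. fder f q u) p w" if wu: "norm w \<le> 1" "norm u \<le> 1" for w u
  proof -
    obtain D where D: "((\<lambda>q. fder f q w) has_derivative D) (at p)"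
       "D u = deriv (\<lambda>t. fder f (p + t *s w) u) 0"
      using hol_fder_unit[OF S f wu(1) p] wu(2) by blast
    have "deriv (\<lambda>t. fder f (p + t *s w) u) 0 = fder (\<lambda>q. fder f q u) p w"
      using hol_line[OF hol_fder[OF S f, of u], of p 0 w] p by (intro DERIV_imp_deriv) simp
    then show ?thesis using D by (metis frechet_derivative_at)
  qed
  have lin2: "fder (\<lambda>q. fder f q (r *\<^sub>R a)) p b = r *\<^sub>R fder (\<lambda>q. fder f q a) p b" for r a b
  proof -
    have "((\<lambda>q. r *\<^sub>R fder f q a) has_derivative (\<lambda>b. r *\<^sub>R fder (\<lambda>q. fder f q a) p b)) (at p)"
      by (intro has_derivative_scaleR_right hol_has_derivative[OF hol_fder[OF S f] p])
    then have "((\<lambda>q. fder f q (r *\<^sub>R a)) has_derivative (\<lambda>b. r *\<^sub>R fder (\<lambda>q. fder f q a) p b)) (at p)"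
      by (rule has_derivative_transform_within_open[OF _ S p])
        (use hol_linear_fder[OF f] in \<open>auto simp: linear_scale\<close>)
    then show ?thesis by (metis frechet_derivative_at)
  qed
  have lin1: "fder (\<lambda>q. fder f q a) p (r *\<^sub>R b) = r *\<^sub>R fder (\<lambda>q. fder f q a) p b" for r a b
    by (rule linear_scale[OF hol_linear_fder[OF hol_fder[OF S f] p]])
  show ?thesis
  proof (cases "w = 0 \<or> u = 0")
    case True
    then show ?thesis using lin1[of _ 0 "0"] lin2[of 0 "0"] lin1[of w 0 0] lin1[of u 0 0] lin2[of 0 0 u] lin2[of 0 0 w] by auto
  next
    case False
    have "fder (\<lambda>q. fder f q ((1 / norm w) *\<^sub>R w)) p ((1 / norm u) *\<^sub>R u)
        = fder (\<lambda>q. fder f q ((1 / norm u) *\<^sub>R u)) p ((1 / norm w) *\<^sub>R w)"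
      using False by (intro unit) auto
    then show ?thesis unfolding lin1 lin2 using False by (simp add: mult.commute)
  qed
qed

section \<open>Smooth functions\<close>

lemma fder_cong_open:
  assumes "open S" "p \<in> S" "\<And>x. x \<in> S \<Longrightarrow> f x = g x"
  shows "fder f p = fder g p" "f differentiable (at p) \<longleftrightarrow> g differentiable (at p)"
proof -
  have "(f has_derivative D) (at p) \<longleftrightarrow> (g has_derivative D) (at p)" for D
    using has_derivative_transform_within_open[OF _ assms(1,2), of f D UNIV g]
      has_derivative_transform_within_open[OF _ assms(1,2), of g D UNIV f] assms(3) by fastforce
  then show "fder f p = fder g p" "f differentiable (at p) \<longleftrightarrow> g differentiable (at p)"
    unfolding frechet_derivative_def differentiable_def by simp_all
qed

lemma fder_eqI: "(f has_derivative D) (at p) \<Longrightarrow> fder f p = D"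
  by (metis frechet_derivative_at)

lemma differentiable_has_fder: "f differentiable (at p) \<Longrightarrow> (f has_derivative fder f p) (at p)"
  using frechet_derivative_works by blast

lemma Cr_on_cong:
  assumes "open S" "\<And>x. x \<in> S \<Longrightarrow> f x = g x" "Cr_on r S f" shows "Cr_on r S g"
  using assms(2,3)
proof (induction r arbitrary: f g)
  case 0
  then show ?case using continuous_on_cong by force
next
  case (Suc r)
  have eq: "fder f p = fder g p" "f differentiable (at p) \<longleftrightarrow> g differentiable (at p)" if "p \<in> S" for p
    by (rule fder_cong_open[OF assms(1) that], rule Suc.prems(1), assumption)+
  have "Cr_on r S (\<lambda>p. fder g p v)" for v
    by (rule Suc.IH[of "\<lambda>p. fder f p v"]) (use Suc.prems eq in auto)
  then show ?case using Suc.prems eq by auto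
qed

text \<open>For metrics and potentials smoothness is known only near each point, through local
  inverses of the orbit map; this puts the pieces together.\<close>

lemma Cr_on_local:
  assumes "\<And>p. p \<in> S \<Longrightarrow> \<exists>U. open U \<and> p \<in> U \<and> Cr_on r U f"
  shows "Cr_on r S f"
  using assms
proof (induction r arbitrary: f)
  case 0
  then show ?case
    by (metis Cr_on.simps(1) continuous_at_imp_continuous_on continuous_on_eq_continuous_at)
next
  case (Suc r)
  have "Cr_on r S (\<lambda>p. fder f p v)" for v
    by (rule Suc.IH) (use Suc.prems in \<open>auto; blast\<close>)
  moreover have "f differentiable (at p)" if "p \<in> S" for p
    using Suc.prems[OF that] by auto
  ultimately show ?case by simp
qed

lemma Cr_on_Suc: "Cr_on (Suc r) S f \<Longrightarrow> Cr_on r S f"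
proof (induction r arbitrary: f)
  case 0
  then show ?case
    by (auto intro!: continuous_at_imp_continuous_on differentiable_imp_continuous_within)
next
  case (Suc r)
  then show ?case by auto
qed

lemma Cr_on_const: "Cr_on r S (\<lambda>_. c)"
  by (induction r arbitrary: c) (auto simp: frechet_derivative_const)

lemma Cr_on_add:
  assumes "Cr_on r S f" "Cr_on r S g" "open S"
  shows "Cr_on r S (\<lambda>x. f x + g x)"
  using assms(1,2)
proof (induction r arbitrary: f g)
  case 0
  then show ?case by (auto intro: continuous_on_add)
next
  case (Suc r)
  have d: "((\<lambda>x. f x + g x) has_derivative (\<lambda>v. fder f p v + fder g p v)) (at p)" if "p \<in> S" for p
    using Suc.prems that by (intro has_derivative_add differentiable_has_fder) auto
  have "Cr_on r S (\<lambda>p. fder (\<lambda>x. f x + g x) p v)" for v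
    by (rule Cr_on_cong[OF assms(3), of "\<lambda>p. fder f p v + fder g p v"])
      (use Suc fder_eqI[OF d] in auto)
  then show ?case using d by (auto simp: differentiable_def)
qed

lemma Cr_on_sum:
  assumes "finite I" "\<And>i. i \<in> I \<Longrightarrow> Cr_on r S (f i)" "open S"
  shows "Cr_on r S (\<lambda>x. \<Sum>i\<in>I. f i x)"
  using assms(1,2) by (induction I rule: finite_induct) (auto intro: Cr_on_const Cr_on_add[OF _ _ assms(3)])

lemma (in bounded_bilinear) Cr_on:
  assumes "Cr_on r S f" "Cr_on r S g" "open S"
  shows "Cr_on r S (\<lambda>x. prod (f x) (g x))"
  using assms(1,2)
proof (induction r arbitrary: f g)
  case 0
  then show ?case by (auto intro: continuous_on)
next
  case (Suc r)
  have d: "((\<lambda>x. prod (f x) (g x)) has_derivative (\<lambda>v. prod (f p) (fder g p v) + prod (fder f p v) (g p))) (at p)" if "p \<in> S" for p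
    using Suc.prems that by (intro FDERIV differentiable_has_fder) auto
  have "Cr_on r S (\<lambda>p. fder (\<lambda>x. prod (f x) (g x)) p v)" for v
  proof (rule Cr_on_cong[OF assms(3)])
    show "Cr_on r S (\<lambda>p. prod (f p) (fder g p v) + prod (fder f p v) (g p))"
      using Suc.prems Cr_on_Suc[OF Suc.prems(1)] Cr_on_Suc[OF Suc.prems(2)]
      by (intro Cr_on_add assms(3) Suc.IH) auto
  qed (use fder_eqI[OF d] in auto)
  then show ?case using d by (auto simp: differentiable_def)
qed

lemmas Cr_on_mult = bounded_bilinear.Cr_on[OF bounded_bilinear_mult]
lemmas Cr_on_scaleR = bounded_bilinear.Cr_on[OF bounded_bilinear_scaleR]

lemma (in bounded_linear) Cr_on:
  assumes "Cr_on r S g" "open S"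
  shows "Cr_on r S (\<lambda>x. f (g x))"
  using assms(1)
proof (induction r arbitrary: g)
  case 0
  then show ?case by (auto intro: continuous_on)
next
  case (Suc r)
  have d: "((\<lambda>x. f (g x)) has_derivative (\<lambda>v. f (fder g p v))) (at p)" if "p \<in> S" for p
    using Suc.prems that by (intro has_derivative differentiable_has_fder) auto
  have "Cr_on r S (\<lambda>p. fder (\<lambda>x. f (g x)) p v)" for v
    by (rule Cr_on_cong[OF assms(2), of "\<lambda>p. f (fder g p v)"]) (use Suc fder_eqI[OF d] in auto)
  then show ?case using d by (auto simp: differentiable_def)
qed

lemma Cr_on_id: "Cr_on r S (\<lambda>x. x)"
  by (cases r) (auto simp: frechet_derivative_ident intro: Cr_on_const)

lemma Cr_on_linear: "bounded_linear f \<Longrightarrow> open S \<Longrightarrow> Cr_on r S f"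
  using bounded_linear.Cr_on[OF _ Cr_on_id] by blast

section \<open>Vector-valued smooth maps and compositions\<close>

lemma bounded_linear_axis: "bounded_linear (axis i :: 'b::real_normed_vector \<Rightarrow> 'b^'n)"
proof (rule bounded_linear_intro[where K = 1])
  show "norm (axis i x :: 'b^'n) \<le> norm x * 1" for x :: 'b
  proof -
    have "norm (axis i x :: 'b^'n) \<le> (\<Sum>j\<in>UNIV. norm ((axis i x :: 'b^'n) $ j))"
      unfolding norm_vec_def by (rule L2_set_le_sum) simp
    also have "\<dots> = (\<Sum>j\<in>UNIV. if j = i then norm x else 0)"
      by (intro sum.cong) (auto simp: axis_def)
    finally show ?thesis by simp
  qed
qed (auto simp: vec_eq_iff axis_def)

lemma Cr_on_vec:
  fixes f :: "'a::real_normed_vector \<Rightarrow> ('b::real_normed_vector)^'n"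
  assumes "\<And>i. Cr_on r S (\<lambda>x. f x $ i)" "open S"
  shows "Cr_on r S f"
proof -
  have "Cr_on r S (\<lambda>x. \<Sum>i\<in>UNIV. axis i (f x $ i))"
    by (intro Cr_on_sum bounded_linear.Cr_on[OF bounded_linear_axis] assms) auto
  moreover have "(\<Sum>i\<in>UNIV. axis i (f x $ i)) = f x" for x
    by (simp add: vec_eq_iff axis_def if_distrib cong: if_cong)
  ultimately show ?thesis by simp
qed

lemma has_derivative_expand_basis:
  fixes u :: "'b::euclidean_space \<Rightarrow> 'c::real_normed_vector"
  assumes "(u has_derivative D) F"
  shows "D w = (\<Sum>b\<in>Basis. (w \<bullet> b) *\<^sub>R D b)"
proof -
  note lin = has_derivative_linear[OF assms]
  have "D w = D (\<Sum>b\<in>Basis. (w \<bullet> b) *\<^sub>R b)" by (simp add: euclidean_representation)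
  then show ?thesis by (simp only: linear_sum[OF lin] linear_scale[OF lin])
qed

text \<open>Expanding \<open>fder F p v\<close> in the basis writes the derivative of the
  composition as a sum of products whose second factors are derivatives of \<open>u\<close> in fixed
  directions, composed with \<open>F\<close>. The induction hypothesis covers these;
  \<open>F\<close> has every order of smoothness, so only the order of \<open>u\<close> has to
  decrease.\<close>

lemma Cr_on_compose:
  fixes F :: "'a::real_normed_vector \<Rightarrow> 'b::euclidean_space" and u :: "'b \<Rightarrow> 'c::real_normed_vector"
  assumes F: "smooth_on S F" and S: "open S" "F ` S \<subseteq> T" and u: "Cr_on r T u"
  shows "Cr_on r S (\<lambda>x. u (F x))"
  using u
proof (induction r arbitrary: u)
  case 0
  have "continuous_on S F" using F unfolding smooth_on_def by (metis Cr_on.simps(1))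
  with 0 show ?case using S continuous_on_compose2 by auto
next
  case (Suc r)
  have dF: "F differentiable (at p)" "Cr_on r S (\<lambda>p. fder F p v)" if "p \<in> S" for p v
    using F that unfolding smooth_on_def by (metis Cr_on.simps(2))+
  have d: "((\<lambda>x. u (F x)) has_derivative (\<lambda>v. fder u (F p) (fder F p v))) (at p)" if "p \<in> S" for p
  proof (rule has_derivative_compose[OF differentiable_has_fder[OF dF(1)[OF that]]])
    have "F p \<in> T" using S that by blast
    then show "(u has_derivative fder u (F p)) (at (F p))"
      using Suc.prems by (intro differentiable_has_fder) simp
  qed
  have "Cr_on r S (\<lambda>p. fder (\<lambda>x. u (F x)) p v)" for v
  proof (rule Cr_on_cong[OF S(1)])
    show "Cr_on r S (\<lambda>p. \<Sum>b\<in>Basis. (fder F p v \<bullet> b) *\<^sub>R fder u (F p) b)"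
    proof (intro Cr_on_sum Cr_on_scaleR S(1) bounded_linear.Cr_on[OF bounded_linear_inner_left])
      show "Cr_on r S (\<lambda>p. fder F p v)" using F unfolding smooth_on_def by (metis Cr_on.simps(2))
      show "Cr_on r S (\<lambda>p. fder u (F p) b)" for b using Suc by auto
    qed auto
    fix p assume p: "p \<in> S"
    then have "u differentiable (at (F p))" using Suc.prems S by auto
    from has_derivative_expand_basis[OF differentiable_has_fder[OF this], of "fder F p v"]
    show "(\<Sum>b\<in>Basis. (fder F p v \<bullet> b) *\<^sub>R fder u (F p) b) = fder (\<lambda>x. u (F x)) p v"
      by (simp add: fder_eqI[OF d[OF p]])
  qed
  then show ?case using d by (auto simp: differentiable_def)
qed

lemma hol_Cr_on: "open S \<Longrightarrow> hol S (f :: complex^'n \<Rightarrow> complex) \<Longrightarrow> Cr_on r S f"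
proof (induction r arbitrary: f)
  case 0
  then show ?case by (simp add: hol_continuous_on)
next
  case (Suc r)
  have "Cr_on r S (\<lambda>p. fder f p v)" for v
    by (rule Suc.IH[OF Suc.prems(1) hol_fder[OF Suc.prems]])
  moreover have "f differentiable (at p)" if "p \<in> S" for p
    using hol_has_derivative[OF Suc.prems(2) that] by (auto simp: differentiable_def)
  ultimately show ?case by simp
qed

lemma hol_vec_smooth_on:
  assumes "open S" "\<And>i. hol S (\<lambda>p. (F :: complex^'n \<Rightarrow> complex^'m) p $ i)"
  shows "smooth_on S F"
  using assms by (auto simp: smooth_on_def intro!: Cr_on_vec hol_Cr_on)

section \<open>Wirtinger derivatives and the Levi form\<close>

lemma has_derivative_vec_nth:
  "(f has_derivative D) F \<Longrightarrow> ((\<lambda>x. f x $ i) has_derivative (\<lambda>v. D v $ i)) F"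
  by (rule bounded_linear.has_derivative[OF bounded_linear_vec_nth])

lemma jacobian_eqI: "(F has_derivative (\<lambda>v. (A :: complex^'n^'m) *v v)) (at p) \<Longrightarrow> jacobian F (at p) = A"
  unfolding jacobian_def by (simp add: fder_eqI)

lemma holo_on_has_jacobian:
  assumes "holo_on S F" "p \<in> S"
  shows "(F has_derivative (\<lambda>v. jacobian F (at p) *v v)) (at p)"
  using assms jacobian_eqI unfolding holo_on_def by metis

lemma axis_complex_expand:
  "(w :: complex^'n) = (\<Sum>a\<in>UNIV. Re (w $ a) *\<^sub>R axis a 1 + Im (w $ a) *\<^sub>R axis a \<i>)"
proof -
  have "(\<Sum>a\<in>UNIV. Re (w $ a) *\<^sub>R axis a 1 $ i + Im (w $ a) *\<^sub>R axis a \<i> $ i) = w $ i" for i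
  proof -
    have "(\<Sum>a\<in>UNIV. Re (w $ a) *\<^sub>R axis a 1 $ i + Im (w $ a) *\<^sub>R axis a \<i> $ i)
       = (\<Sum>a\<in>UNIV. if a = i then w $ a else 0)"
      by (intro sum.cong) (auto simp: axis_def complex_eq_iff)
    then show ?thesis by simp
  qed
  then show ?thesis by (simp add: vec_eq_iff)
qed

lemma axis_i: "axis a \<i> = \<i> *s (axis a 1 :: complex^'n)"
  by (simp add: vec_eq_iff axis_def)

text \<open>The left sides are twice the complex linear and twice the conjugate linear part of
  \<open>D\<close> at \<open>w\<close>. When \<open>D\<close> is a derivative, the coefficients on
  the right are twice the values of \<open>dz\<close> and \<open>dzbar\<close>.\<close>

lemma wirtinger_expand:
  fixes D :: "complex^'n \<Rightarrow> complex"
  assumes "linear D"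
  shows "D w - \<i> * D (\<i> *s w) = (\<Sum>a\<in>UNIV. (D (axis a 1) - \<i> * D (axis a \<i>)) * w $ a)"
    and "D w + \<i> * D (\<i> *s w) = (\<Sum>a\<in>UNIV. (D (axis a 1) + \<i> * D (axis a \<i>)) * cnj (w $ a))"
proof -
  have e: "D w = (\<Sum>a\<in>UNIV. Re (w $ a) *\<^sub>R D (axis a 1) + Im (w $ a) *\<^sub>R D (axis a \<i>))" for w
    by (subst axis_complex_expand)
      (simp only: linear_sum[OF assms] linear_add[OF assms] linear_scale[OF assms])
  have e2: "D (\<i> *s w) = (\<Sum>a\<in>UNIV. - Im (w $ a) *\<^sub>R D (axis a 1) + Re (w $ a) *\<^sub>R D (axis a \<i>))"
    by (subst e) simp
  show "D w - \<i> * D (\<i> *s w) = (\<Sum>a\<in>UNIV. (D (axis a 1) - \<i> * D (axis a \<i>)) * w $ a)"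
    unfolding e2 unfolding e[of w] sum_distrib_left sum_subtractf[symmetric]
    by (intro sum.cong) (auto simp: complex_eq_iff algebra_simps)
  show "D w + \<i> * D (\<i> *s w) = (\<Sum>a\<in>UNIV. (D (axis a 1) + \<i> * D (axis a \<i>)) * cnj (w $ a))"
    unfolding e2 unfolding e[of w] sum_distrib_left sum.distrib[symmetric]
    by (intro sum.cong) (auto simp: complex_eq_iff algebra_simps)
qed

lemma hol_nth: "holo_on S F \<Longrightarrow> hol S (\<lambda>p. F p $ i)"
  unfolding hol_def holo_on_def
  by (metis has_derivative_vec_nth vector_scalar_commute vector_smult_component)

lemma jacobian_nth: 
  assumes "holo_on S F" "p \<in> S"
  shows "jacobian F (at p) $ i $ j = fder (\<lambda>q. F q $ i) p (axis j 1)"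
proof -
  have "fder (\<lambda>q. F q $ i) p = (\<lambda>v. (jacobian F (at p) *v v) $ i)"
    by (rule fder_eqI[OF has_derivative_vec_nth[OF holo_on_has_jacobian[OF assms]]])
  then show ?thesis by (simp add: matrix_vector_mult_def axis_def if_distrib cong: if_cong)
qed

lemma holo_on_smooth: "open S \<Longrightarrow> holo_on S (F :: complex^'n \<Rightarrow> complex^'m) \<Longrightarrow> smooth_on S F"
  by (rule hol_vec_smooth_on[OF _ hol_nth])

lemma hol_jacobian: 
  assumes "open S" "holo_on S F"
  shows "hol S (\<lambda>p. jacobian F (at p) $ i $ j)"
  by (rule hol_cong[OF assms(1) _ hol_fder[OF assms(1) hol_nth[OF assms(2)]]])
    (simp add: jacobian_nth[OF assms(2)])

section \<open>Calculus of the Wirtinger derivatives\<close>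

lemma dz_cong:
  assumes "open S" "p \<in> S" "\<And>x. x \<in> S \<Longrightarrow> f x = g x"
  shows "dz j f p = dz j g p" "dzbar j f p = dzbar j g p"
  unfolding dz_def dzbar_def using fder_cong_open(1)[OF assms] by simp_all

lemma dz_mult:
  assumes "f differentiable (at p)" "g differentiable (at p)"
  shows "dz j (\<lambda>q. f q * g q) p = dz j f p * g p + f p * dz j g p"
    and "dzbar j (\<lambda>q. f q * g q) p = dzbar j f p * g p + f p * dzbar j g p"
  using fder_eqI[OF has_derivative_mult[OF assms[THEN differentiable_has_fder]]]
  by (auto simp: dz_def dzbar_def field_simps)

lemma dz_sum:
  assumes "\<And>i. i \<in> I \<Longrightarrow> f i differentiable (at p)"
  shows "dz j (\<lambda>q. \<Sum>i\<in>I. f i q) p = (\<Sum>i\<in>I. dz j (f i) p)"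
    and "dzbar j (\<lambda>q. \<Sum>i\<in>I. f i q) p = (\<Sum>i\<in>I. dzbar j (f i) p)"
proof -
  have *: "fder (\<lambda>q. \<Sum>i\<in>I. f i q) p = (\<lambda>v. \<Sum>i\<in>I. fder (f i) p v)"
    by (intro fder_eqI has_derivative_sum differentiable_has_fder assms)
  show "dz j (\<lambda>q. \<Sum>i\<in>I. f i q) p = (\<Sum>i\<in>I. dz j (f i) p)"
    unfolding dz_def * by (simp only: sum_divide_distrib[symmetric] sum_subtractf sum_distrib_left[symmetric])
  show "dzbar j (\<lambda>q. \<Sum>i\<in>I. f i q) p = (\<Sum>i\<in>I. dzbar j (f i) p)"
    unfolding dzbar_def * by (simp only: sum_divide_distrib[symmetric] sum.distrib sum_distrib_left[symmetric])
qed

lemma differentiable_cnj: "f differentiable (at p) \<Longrightarrow> (\<lambda>q. cnj (f q)) differentiable (at p)"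
  using bounded_linear.has_derivative[OF bounded_linear_cnj] unfolding differentiable_def by blast

lemma dz_cnj:
  assumes "f differentiable (at p)"
  shows "dz j (\<lambda>q. cnj (f q)) p = cnj (dzbar j f p)" "dzbar j (\<lambda>q. cnj (f q)) p = cnj (dz j f p)"
  using fder_eqI[OF bounded_linear.has_derivative[OF bounded_linear_cnj differentiable_has_fder[OF assms]]]
  by (auto simp: dz_def dzbar_def)

lemma dz_hol:
  assumes "hol S f" "p \<in> S"
  shows "dz j f p = fder f p (axis j 1)" "dzbar j f p = 0"
  by (simp_all add: dz_def dzbar_def axis_i hol_fder_vsmult[OF assms])

lemma hol_differentiable: "hol S f \<Longrightarrow> p \<in> S \<Longrightarrow> f differentiable (at p)"
  using hol_has_derivative differentiable_def by blast

lemma fder_compose_holo: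
  fixes F :: "complex^'n \<Rightarrow> complex^'m"
  assumes F: "holo_on S F" "p \<in> S" and u: "u differentiable (at (F p))"
  shows "((\<lambda>x. u (F x)) has_derivative (\<lambda>v. fder u (F p) (jacobian F (at p) *v v))) (at p)"
  by (rule has_derivative_compose[OF holo_on_has_jacobian[OF F] differentiable_has_fder[OF u]])

lemma matrix_axis_nth: "(A *v axis k c) $ a = A $ a $ k * (c :: complex)"
  by (simp add: matrix_vector_mult_def axis_def if_distrib cong: if_cong)

text \<open>A Jacobian of a holomorphic map commutes with \<open>\<i>\<close>, so it carries the
  linear and the conjugate linear part of the derivative of \<open>u\<close> separately, without
  mixing them.\<close>

lemma dz_compose_holo:
  fixes F :: "complex^'n \<Rightarrow> complex^'m"
  assumes F: "holo_on S F" "p \<in> S" and u: "u differentiable (at (F p))"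
  shows "dz j (\<lambda>x. u (F x)) p = (\<Sum>a\<in>UNIV. dz a u (F p) * jacobian F (at p) $ a $ j)"
    and "dzbar j (\<lambda>x. u (F x)) p = (\<Sum>a\<in>UNIV. dzbar a u (F p) * cnj (jacobian F (at p) $ a $ j))"
proof -
  let ?D = "fder u (F p)" and ?w = "jacobian F (at p) *v axis j 1"
  have lin: "linear ?D" using differentiable_has_fder[OF u] has_derivative_linear by blast
  have i: "jacobian F (at p) *v axis j \<i> = \<i> *s ?w"
    by (simp add: axis_i vector_scalar_commute)
  note e = fder_eqI[OF fder_compose_holo[OF assms]]
  show "dz j (\<lambda>x. u (F x)) p = (\<Sum>a\<in>UNIV. dz a u (F p) * jacobian F (at p) $ a $ j)"
    using wirtinger_expand(1)[OF lin, of ?w]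
    unfolding dz_def e i by (simp add: matrix_axis_nth sum_divide_distrib)
  show "dzbar j (\<lambda>x. u (F x)) p = (\<Sum>a\<in>UNIV. dzbar a u (F p) * cnj (jacobian F (at p) $ a $ j))"
    using wirtinger_expand(2)[OF lin, of ?w]
    unfolding dzbar_def e i by (simp add: matrix_axis_nth sum_divide_distrib)
qed

section \<open>Pull-back of Levi forms and of constant forms by holomorphic maps\<close>

lemma Cr_on_dzbar:
  assumes "Cr_on (Suc r) S u" "open S" shows "Cr_on r S (dzbar k u)"
proof -
  have "Cr_on r S (\<lambda>p. 1/2 * fder u p (axis k 1) + (\<i>/2) * fder u p (axis k \<i>))"
    using assms by (intro Cr_on_add Cr_on_mult Cr_on_const) auto
  moreover have "dzbar k u = (\<lambda>p. 1/2 * fder u p (axis k 1) + (\<i>/2) * fder u p (axis k \<i>))"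
    by (simp add: dzbar_def fun_eq_iff field_simps)
  ultimately show ?thesis by simp
qed

lemma Cr_on_differentiable: "Cr_on (Suc r) S u \<Longrightarrow> p \<in> S \<Longrightarrow> u differentiable (at p)"
  by simp

lemma pull_nth: "pull A H $ j $ k = (\<Sum>b\<in>UNIV. \<Sum>a\<in>UNIV. A $ a $ j * H $ a $ b * cnj (A $ b $ k))"
  by (simp add: pull_def matrix_matrix_mult_def transpose_def map_matrix_def sum_distrib_right)

text \<open>After \<open>dzbar\<close> the Jacobian appears only conjugated, and \<open>dz\<close>
  annihilates conjugates of holomorphic functions. So second derivatives of \<open>F\<close> never
  arise and the Levi form transforms as a tensor.\<close>

theorem levi_form_compose_holo:
  fixes F :: "complex^'n \<Rightarrow> complex^'n"
  assumes S: "open S" and F: "holo_on S F" "p \<in> S" and T: "open T" "F ` S \<subseteq> T"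
    and u: "Cr_on 2 T u"
  shows "(\<chi> j k. dz j (dzbar k (\<lambda>x. u (F x))) p)
       = pull (jacobian F (at p)) (\<chi> a b. dz a (dzbar b u) (F p))"
proof -
  let ?J = "\<lambda>q. jacobian F (at q)"
  have u1: "Cr_on (Suc (Suc 0)) T u" using u by (simp add: numeral_2_eq_2)
  have "dz j (dzbar k (\<lambda>x. u (F x))) p = (\<Sum>b\<in>UNIV. \<Sum>a\<in>UNIV. dz a (dzbar b u) (F p) * ?J p $ a $ j * cnj (?J p $ b $ k))" for j k
  proof -
    have bdiff: "dzbar b u differentiable (at (F p))" for b
      using Cr_on_differentiable[OF Cr_on_dzbar[OF u1 T(1)]] T(2) F(2) by blast
    have d1: "(\<lambda>q. dzbar b u (F q)) differentiable (at p)" for b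
      using fder_compose_holo[OF F bdiff] differentiable_def by blast
    note hJ = hol_jacobian[OF S F(1)]
    have d2: "(\<lambda>q. cnj (?J q $ b $ k)) differentiable (at p)" for b
      by (intro differentiable_cnj hol_differentiable[OF hJ F(2)])
    have "dz j (dzbar k (\<lambda>x. u (F x))) p = dz j (\<lambda>q. \<Sum>b\<in>UNIV. dzbar b u (F q) * cnj (?J q $ b $ k)) p"
    proof (rule dz_cong(1)[OF S F(2)])
      fix x assume "x \<in> S"
      then show "dzbar k (\<lambda>x. u (F x)) x = (\<Sum>b\<in>UNIV. dzbar b u (F x) * cnj (?J x $ b $ k))"
        using Cr_on_differentiable[OF u1, of "F x"] T(2) by (intro dz_compose_holo(2)[OF F(1)]) auto
    qed
    also have "\<dots> = (\<Sum>b\<in>UNIV. dz j (\<lambda>q. dzbar b u (F q) * cnj (?J q $ b $ k)) p)"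
      by (intro dz_sum(1) differentiable_mult d1 d2)
    also have "\<dots> = (\<Sum>b\<in>UNIV. dz j (\<lambda>q. dzbar b u (F q)) p * cnj (?J p $ b $ k))"
      by (simp add: dz_mult(1)[OF d1 d2] dz_cnj(1)[OF hol_differentiable[OF hJ F(2)]] dz_hol(2)[OF hJ F(2)])
    also have "\<dots> = (\<Sum>b\<in>UNIV. \<Sum>a\<in>UNIV. dz a (dzbar b u) (F p) * ?J p $ a $ j * cnj (?J p $ b $ k))"
      by (simp add: dz_compose_holo(1)[OF F bdiff] sum_distrib_right)
    finally show ?thesis .
  qed
  then show ?thesis by (simp add: vec_eq_iff pull_nth mult_ac)
qed

text \<open>As \<open>H\<close> is constant, \<open>dz\<close> acts only on the plain Jacobian
  factor and \<open>dzbar\<close> only on the conjugated one. The required symmetry of indices is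
  then that of the second derivatives of the components of \<open>F\<close>.\<close>

theorem pull_jacobian_closed:
  fixes F :: "complex^'n \<Rightarrow> complex^'n"
  assumes S: "open S" and F: "holo_on S F"
  shows "closed_form_on S (\<lambda>p. pull (jacobian F (at p)) H)"
  unfolding closed_form_on_def
proof (intro ballI allI)
  fix p j k m assume p: "p \<in> S"
  let ?J = "\<lambda>q. jacobian F (at q)"
  note hJ = hol_jacobian[OF S F]
  note dJ = hol_differentiable[OF hJ p]
  note dcJ = differentiable_cnj[OF dJ]
  have sym: "fder (\<lambda>q. ?J q $ a $ j) p (axis m 1) = fder (\<lambda>q. ?J q $ a $ m) p (axis j 1)" for a j m
  proof -
    have "fder (\<lambda>q. ?J q $ a $ j) p = fder (\<lambda>q. fder (\<lambda>q. F q $ a) q (axis j 1)) p" for j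
      by (rule fder_cong_open(1)[OF S p]) (simp add: jacobian_nth[OF F])
    then show ?thesis using hol_fder_symmetric[OF S hol_nth[OF F] p] by simp
  qed
  have d: "(\<lambda>q. ?J q $ a $ j * H $ a $ b * cnj (?J q $ b $ k)) differentiable (at p)" for a b j k
    by (intro differentiable_mult dJ dcJ differentiable_const)
  have dH: "(\<lambda>q. ?J q $ a $ j * H $ a $ b) differentiable (at p)" for a b j
    by (intro differentiable_mult dJ differentiable_const)
  have dzH: "dz m (\<lambda>q. ?J q $ a $ j * H $ a $ b) p = dz m (\<lambda>q. ?J q $ a $ j) p * H $ a $ b"
     "dzbar m (\<lambda>q. ?J q $ a $ j * H $ a $ b) p = dzbar m (\<lambda>q. ?J q $ a $ j) p * H $ a $ b" for a b j m
    using dz_mult[OF dJ differentiable_const] by (auto simp: dz_def[of _ "\<lambda>q. H $ a $ b"] dzbar_def[of _ "\<lambda>q. H $ a $ b"] frechet_derivative_const)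
  have 1: "dz m (\<lambda>q. pull (?J q) H $ j $ k) p = (\<Sum>b\<in>UNIV. \<Sum>a\<in>UNIV. fder (\<lambda>q. ?J q $ a $ j) p (axis m 1) * H $ a $ b * cnj (?J p $ b $ k))" for m j k
    unfolding pull_nth
    by (simp add: dz_sum(1) d differentiable_sum dz_mult(1)[OF dH dcJ] dzH dz_cnj(1)[OF dJ] dz_hol[OF hJ p])
  have 2: "dzbar m (\<lambda>q. pull (?J q) H $ j $ k) p = (\<Sum>b\<in>UNIV. \<Sum>a\<in>UNIV. ?J p $ a $ j * H $ a $ b * cnj (fder (\<lambda>q. ?J q $ b $ k) p (axis m 1)))" for m j k
    unfolding pull_nth
    by (simp add: dz_sum(2) d differentiable_sum dz_mult(2)[OF dH dcJ] dzH dz_cnj(2)[OF dJ] dz_hol[OF hJ p])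
  show "dz m (\<lambda>q. pull (?J q) H $ j $ k) p = dz j (\<lambda>q. pull (?J q) H $ m $ k) p \<and>
        dzbar m (\<lambda>q. pull (?J q) H $ j $ k) p = dzbar k (\<lambda>q. pull (?J q) H $ j $ m) p"
    unfolding 1 2 using sym by simp
qed

theorem pull_jacobian_smooth:
  fixes F :: "complex^'n \<Rightarrow> complex^'n"
  assumes S: "open S" and F: "holo_on S F"
  shows "smooth_on S (\<lambda>p. pull (jacobian F (at p)) H)"
  unfolding smooth_on_def
proof
  fix r
  note hJ = hol_Cr_on[OF S hol_jacobian[OF S F]]
  show "Cr_on r S (\<lambda>p. pull (jacobian F (at p)) H)"
    by (rule Cr_on_vec, rule Cr_on_vec, unfold pull_nth)
       (intro Cr_on_sum Cr_on_mult hJ Cr_on_const S finite bounded_linear.Cr_on[OF bounded_linear_cnj])+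
qed

section \<open>The Levi form of a periodic function\<close>

lemma has_field_derivative_along:
  fixes g :: "'a::real_normed_vector \<Rightarrow> real"
  assumes "g differentiable (at (p + s *\<^sub>R v))"
  shows "((\<lambda>s. g (p + s *\<^sub>R v)) has_field_derivative fder g (p + s *\<^sub>R v) v) (at s)"
proof -
  note d = differentiable_has_fder[OF assms]
  have "((\<lambda>s. p + s *\<^sub>R v) has_derivative (\<lambda>h. h *\<^sub>R v)) (at s)"
    by (auto intro!: derivative_eq_intros)
  from has_derivative_compose[OF this d]
  have "((\<lambda>s. g (p + s *\<^sub>R v)) has_derivative (\<lambda>h. fder g (p + s *\<^sub>R v) (h *\<^sub>R v))) (at s)" .
  then show ?thesis
    unfolding has_field_derivative_def linear_scale[OF has_derivative_linear[OF d]]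
    by (simp add: mult.commute[of _ "fder g (p + s *\<^sub>R v) v"])
qed

lemma average_has_field_derivative:
  fixes g :: "'a::real_normed_vector \<Rightarrow> real"
  assumes g: "\<And>p. g differentiable (at p)" and c: "continuous_on UNIV (\<lambda>p. fder g p v)"
  shows "((\<lambda>s. integral (cbox 0 1) (\<lambda>t. g (p + s *\<^sub>R v + t *\<^sub>R b))) has_field_derivative
           integral (cbox 0 1) (\<lambda>t. fder g (p + s *\<^sub>R v + t *\<^sub>R b) v)) (at (s::real))"
proof -
  have gc: "continuous_on UNIV g"
    using g by (simp add: continuous_at_imp_continuous_on differentiable_imp_continuous_within)
  have "((\<lambda>s. integral (cbox 0 1) (\<lambda>t. g (p + s *\<^sub>R v + t *\<^sub>R b))) has_field_derivative
           integral (cbox 0 1) (\<lambda>t. fder g (p + s *\<^sub>R v + t *\<^sub>R b) v)) (at s within UNIV)"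
  proof (rule leibniz_rule_field_derivative)
    fix x t :: real
    show "((\<lambda>x. g (p + x *\<^sub>R v + t *\<^sub>R b)) has_field_derivative fder g (p + x *\<^sub>R v + t *\<^sub>R b) v) (at x within UNIV)"
      using has_field_derivative_along[OF g, where p = "p + t *\<^sub>R b" and s = x and v = v] by (simp add: add_ac)
  next
    fix x :: real
    show "(\<lambda>t. g (p + x *\<^sub>R v + t *\<^sub>R b)) integrable_on cbox 0 1"
      by (intro integrable_continuous continuous_on_compose2[OF gc] continuous_intros) auto
  next
    show "continuous_on (UNIV \<times> cbox 0 1) (\<lambda>(x, t). fder g (p + x *\<^sub>R v + t *\<^sub>R b) v)"
      unfolding split_beta
      by (intro continuous_on_compose2[OF c] continuous_intros) auto
  qed auto
  then show ?thesis by simp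
qed

lemma fder_of_real:
  assumes "f differentiable (at p)"
  shows "((\<lambda>q. complex_of_real (f q)) has_derivative (\<lambda>v. complex_of_real (fder f p v))) (at p)"
  by (rule bounded_linear.has_derivative[OF bounded_linear_of_real differentiable_has_fder[OF assms]])

text \<open>Write d(v) for the real derivative in direction v. The sum of the \<open>a $ j\<close>
  times \<open>dz j\<close> is (d(a) - i d(ia)) / 2, that of the \<open>cnj (b $ k)\<close> times
  \<open>dzbar k\<close> is (d(b) + i d(ib)) / 2; the right side is the product of the two,
  multiplied out.\<close>

lemma levi_form_hessian:
  fixes \<psi> :: "complex^'n \<Rightarrow> real"
  assumes C: "Cr_on 2 UNIV \<psi>"
  defines "D2 \<equiv> \<lambda>u v p. fder (\<lambda>q. fder \<psi> q v) p u"
  shows "4 * (\<Sum>j\<in>UNIV. \<Sum>k\<in>UNIV. dz j (dzbar k (\<lambda>p. complex_of_real (\<psi> p))) p * a $ j * cnj (b $ k))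
     = Complex (D2 a b p + D2 (\<i> *s a) (\<i> *s b) p) (D2 a (\<i> *s b) p - D2 (\<i> *s a) b p)"
proof -
  let ?c = "\<lambda>p. complex_of_real (\<psi> p)"
  have C': "Cr_on (Suc (Suc 0)) UNIV \<psi>" using C by (simp add: numeral_2_eq_2)
  have d1: "\<psi> differentiable (at q)" for q using C' by simp
  have d2: "(\<lambda>q. fder \<psi> q v) differentiable (at q)" for q v using C' by simp
  have fc: "fder ?c q = (\<lambda>v. complex_of_real (fder \<psi> q v))" for q
    by (rule fder_eqI[OF fder_of_real[OF d1]])
  have lin1: "linear (\<lambda>v. complex_of_real (fder \<psi> q v))" for q
    using has_derivative_linear[OF fder_of_real[OF d1]] .
  let ?g = "\<lambda>q. (complex_of_real (fder \<psi> q b) + \<i> * complex_of_real (fder \<psi> q (\<i> *s b))) / 2"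
  have g: "?g q = (\<Sum>k\<in>UNIV. dzbar k ?c q * cnj (b $ k))" for q
    unfolding wirtinger_expand(2)[OF lin1] dzbar_def fc by (simp add: sum_divide_distrib)
  have hvw: "((\<lambda>q. (complex_of_real (fder \<psi> q v) + \<i> * complex_of_real (fder \<psi> q w)) / 2) has_derivative
      (\<lambda>u. (complex_of_real (D2 u v p) + \<i> * complex_of_real (D2 u w p)) / 2)) (at p)" for v w
    unfolding D2_def
    by (intro bounded_linear.has_derivative[OF bounded_linear_divide] has_derivative_add fder_of_real[OF d2] has_derivative_mult_right)
  note hg = hvw[of b "\<i> *s b"]
  have dbar: "dzbar k ?c differentiable (at p)" for k
  proof -
    have "dzbar k ?c = (\<lambda>q. (complex_of_real (fder \<psi> q (axis k 1)) + \<i> * complex_of_real (fder \<psi> q (axis k \<i>))) / 2)"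
      by (simp add: fun_eq_iff dzbar_def fc)
    moreover have "\<dots> differentiable (at p)"
      using hvw by (rule differentiableI)
    ultimately show ?thesis by simp
  qed
  have "dz j ?g p = (\<Sum>k\<in>UNIV. dz j (dzbar k ?c) p * cnj (b $ k))" for j
    unfolding g
    by (simp add: dz_sum(1) dz_mult(1) dbar differentiable_mult dz_def[of j "\<lambda>q. cnj (b $ _)"] frechet_derivative_const)
  then have "(\<Sum>j\<in>UNIV. \<Sum>k\<in>UNIV. dz j (dzbar k ?c) p * a $ j * cnj (b $ k)) = (\<Sum>j\<in>UNIV. dz j ?g p * a $ j)"
    by (simp add: sum_distrib_left mult_ac)
  also have "\<dots> = (fder ?g p a - \<i> * fder ?g p (\<i> *s a)) / 2"
    unfolding wirtinger_expand(1)[OF has_derivative_linear[OF hg[folded fder_eqI[OF hg]]]] dz_def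
    by (simp add: sum_divide_distrib)
  finally show ?thesis
    unfolding fder_eqI[OF hg] by (simp add: complex_eq_iff field_simps)
qed

text \<open>The imaginary part of the hermitian form is \<open>\<partial>\<^sub>a\<partial>\<^sub>i\<^sub>b\<psi> - \<partial>\<^sub>i\<^sub>a\<partial>\<^sub>b\<psi>\<close>, up to a factor, and the
  averages of both terms over the parallelogram spanned by the periods \<open>a\<close> and \<open>b\<close> vanish.\<close>

theorem periods_constant_levi_form:
  fixes \<psi> :: "complex^'n \<Rightarrow> real"
  assumes C: "Cr_on 2 UNIV \<psi>"
    and per: "\<And>p. \<psi> (p + a) = \<psi> p" "\<And>p. \<psi> (p + b) = \<psi> p"
    and H: "\<And>p j k. dz j (dzbar k (\<lambda>p. complex_of_real (\<psi> p))) p = H $ j $ k"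
  shows "Im (\<Sum>j\<in>UNIV. \<Sum>k\<in>UNIV. H $ j $ k * a $ j * cnj (b $ k)) = 0"
proof -
  let ?I = "integral (cbox 0 (1::real))"
  define c where "c = Im (4 * (\<Sum>j\<in>UNIV. \<Sum>k\<in>UNIV. H $ j $ k * a $ j * cnj (b $ k)))"
  let ?f = "\<lambda>p. fder \<psi> p (\<i> *s b)" and ?g = "\<lambda>p. fder \<psi> p b"
  have c: "fder ?f p a - fder ?g p (\<i> *s a) = c" for p
    using levi_form_hessian[OF C, of p a b] unfolding H c_def by simp
  have C': "Cr_on (Suc (Suc 0)) UNIV \<psi>" using C by (simp add: numeral_2_eq_2)
  have d1: "\<psi> differentiable (at q)" for q using C' by simp
  have d2: "(\<lambda>q. fder \<psi> q v) differentiable (at q)" for q v using C' by simp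
  have c2: "continuous_on UNIV (\<lambda>p. fder (\<lambda>q. fder \<psi> q v) p u)" for u v using C' by simp
  have c2': "continuous_on (cbox 0 1) (\<lambda>t. fder (\<lambda>q. fder \<psi> q v) (p + t *\<^sub>R b) u)" for u v p
    by (intro continuous_on_compose2[OF c2] continuous_intros) auto
  have g0: "?I (\<lambda>t. ?g (p + t *\<^sub>R b)) = 0" for p
  proof -
    have "((\<lambda>t. ?g (p + t *\<^sub>R b)) has_integral \<psi> (p + 1 *\<^sub>R b) - \<psi> (p + 0 *\<^sub>R b)) {0..1}"
    proof (rule fundamental_theorem_of_calculus)
      show "((\<lambda>t. \<psi> (p + t *\<^sub>R b)) has_vector_derivative ?g (p + x *\<^sub>R b)) (at x within {0..1})" for x
        using has_field_derivative_along[OF d1, where p = p and s = x and v = b]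
        unfolding has_real_derivative_iff_has_vector_derivative
        by (rule has_vector_derivative_at_within)
    qed simp
    then show ?thesis using per(2) by (simp add: integral_unique)
  qed
  \<comment> \<open>By \<open>g0\<close> the mean vanishes for every starting point, so its
    derivative along \<open>\<i> *s a\<close> vanishes as well.\<close>
  have gd: "?I (\<lambda>t. fder ?g (p + t *\<^sub>R b) (\<i> *s a)) = 0" for p
  proof -
    have "((\<lambda>s. ?I (\<lambda>t. ?g (p + s *\<^sub>R (\<i> *s a) + t *\<^sub>R b))) has_field_derivative
        ?I (\<lambda>t. fder ?g (p + 0 *\<^sub>R (\<i> *s a) + t *\<^sub>R b) (\<i> *s a))) (at 0)"
      by (rule average_has_field_derivative[OF d2 c2])
    from DERIV_unique[OF this[unfolded g0] DERIV_const] show ?thesis by simp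
  qed
  have fd: "?I (\<lambda>t. fder ?f (p + t *\<^sub>R b) a) = c" for p
  proof -
    have "?I (\<lambda>t. fder ?f (p + t *\<^sub>R b) a) - ?I (\<lambda>t. fder ?g (p + t *\<^sub>R b) (\<i> *s a))
        = ?I (\<lambda>t. c)"
      by (subst integral_diff[symmetric]) (auto intro: integrable_continuous_real c2'[unfolded cbox_interval] simp: c)
    then show ?thesis unfolding gd by simp
  qed
  \<comment> \<open>As a function of \<open>s\<close> this mean has constant slope \<open>c\<close>
    by \<open>fd\<close>, yet it takes the same value at 0 and 1 because \<open>a\<close> is a
    period. This forces \<open>c = 0\<close>.\<close>
  let ?m = "\<lambda>s. ?I (\<lambda>t. ?f (0 + s *\<^sub>R a + t *\<^sub>R b))"
  have "((\<lambda>s. ?m s - c * s) has_real_derivative 0) (at s)" for s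
  proof -
    have "(?m has_real_derivative c) (at s)"
    proof -
      have "(?m has_real_derivative ?I (\<lambda>t. fder ?f (0 + s *\<^sub>R a + t *\<^sub>R b) a)) (at s)"
        by (rule average_has_field_derivative[OF d2 c2])
      then show ?thesis unfolding fd .
    qed
    then show ?thesis by (auto intro!: derivative_eq_intros)
  qed
  then have "?m 1 - c * 1 = ?m 0 - c * 0"
    by (intro DERIV_isconst_all[of "\<lambda>s. ?m s - c * s"] allI)
  moreover have fper: "?f (x + a) = ?f x" for x
  proof -
    have "((\<lambda>q. \<psi> (q + a)) has_derivative fder \<psi> (x + a)) (at x)"
      by (rule has_derivative_compose[of "\<lambda>q. q + a" "\<lambda>h. h", OF _ differentiable_has_fder[OF d1]])
         (auto intro!: derivative_eq_intros)
    then show ?thesis unfolding per(1) by (metis fder_eqI)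
  qed
  have "?f (0 + 1 *\<^sub>R a + t *\<^sub>R b) = ?f (0 + 0 *\<^sub>R a + t *\<^sub>R b)" for t
    using fper[of "t *\<^sub>R b"] by (simp add: add.commute)
  ultimately have "c = 0" by simp
  then show ?thesis by (simp add: c_def)
qed

section \<open>Zero sets of holomorphic functions\<close>

text \<open>Holomorphy on each complex line separately. It is what \<open>det_fmat_line_hol\<close>
  provides for the determinant, and it suffices for arguments that look at two points at a
  time.\<close>

definition line_hol :: "(complex^'n) set \<Rightarrow> (complex^'n \<Rightarrow> complex) \<Rightarrow> bool" where
  "line_hol S f \<longleftrightarrow> (\<forall>p v. (\<lambda>t. f (p + t *s v)) holomorphic_on {t. p + t *s v \<in> S})"

lemma line_holD: "line_hol S f \<Longrightarrow> (\<lambda>t. f (p + t *s v)) holomorphic_on {t. p + t *s v \<in> S}"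
  by (simp add: line_hol_def)

lemma line_hol_subset:
  assumes "line_hol S f" "T \<subseteq> S" shows "line_hol T f"
  unfolding line_hol_def
proof (intro allI)
  fix p v
  show "(\<lambda>t. f (p + t *s v)) holomorphic_on {t. p + t *s v \<in> T}"
    by (rule holomorphic_on_subset[OF line_holD[OF assms(1)]]) (use assms(2) in auto)
qed

lemma continuous_on_line: "continuous_on A (\<lambda>t. p + t *s (v :: complex^'n))"
  by (intro continuous_intros linear_continuous_on bounded_linear_vsmult_left)

lemma open_line_vimage: "open S \<Longrightarrow> open {t. p + t *s (v :: complex^'n) \<in> S}"
  using continuous_on_line[of UNIV p v] by (simp add: continuous_on_open_vimage vimage_def)

lemma convex_line_vimage:
  assumes "convex S" shows "convex {t. p + t *s (v :: complex^'n) \<in> S}"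
proof (rule convexI, unfold mem_Collect_eq)
  fix x y u w assume *: "p + x *s v \<in> S" "p + y *s v \<in> S" "0 \<le> u" "0 \<le> w" "u + w = (1::real)"
  have p: "p = u *\<^sub>R p + w *\<^sub>R p" using *(5) by (metis scaleR_left.add scaleR_one)
  have "(u *\<^sub>R x + w *\<^sub>R y) *s v = u *\<^sub>R (x *s v) + w *\<^sub>R (y *s v)"
    by (simp add: vec_eq_iff algebra_simps)
  then have "p + (u *\<^sub>R x + w *\<^sub>R y) *s v = u *\<^sub>R (p + x *s v) + w *\<^sub>R (p + y *s v)"
    by (subst p) (simp add: scaleR_add_right)
  then show "p + (u *\<^sub>R x + w *\<^sub>R y) *s v \<in> S"
    using convexD[OF assms *] by simp
qed

lemma open_imp_fsigma:
  assumes "open (S :: complex set)" shows "fsigma S"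
proof -
  obtain C :: "nat \<Rightarrow> complex set" where "\<And>n. compact (C n)" "\<Union>(range C) = S"
    using open_Union_compact_subsets[OF assms] by metis
  then show ?thesis using fsigma.intros[of C] compact_imp_closed by metis
qed

text \<open>The line meets \<open>S\<close> in an open convex set of parameters. There
  \<open>f\<close> is either constant, with the nonzero value at \<open>x\<close>, or a nonconstant
  holomorphic function on a connected set.\<close>

lemma line_hol_countable_zeros:
  assumes S: "open S" "convex S" and f: "line_hol S f" and x: "x \<in> S" "f x \<noteq> 0"
  shows "countable {t. x + t *s v \<in> S \<and> f (x + t *s v) = 0}"
proof (cases "(\<lambda>t. f (x + t *s v)) constant_on {t. x + t *s v \<in> S}")
  case True
  then obtain c where c: "\<And>t. x + t *s v \<in> S \<Longrightarrow> f (x + t *s v) = c"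
    unfolding constant_on_def by auto
  have "{t. x + t *s v \<in> S \<and> f (x + t *s v) = 0} = {}" using c c[of 0] x by auto
  then show ?thesis by (metis countable_empty)
next
  case False
  have "countable {t \<in> {t. x + t *s v \<in> S}. f (x + t *s v) = 0}"
    by (intro holomorphic_countable_zeros line_holD[OF f] open_line_vimage S convex_connected
        convex_line_vimage open_imp_fsigma False)
  then show ?thesis by simp
qed

text \<open>Two points of the set are joined within the complex line through them: an open connected
  part of the plane stays connected when countably many points are removed.\<close>

lemma line_hol_connected_nonzero:
  assumes S: "open S" "convex S" and f: "line_hol S f"
  shows "connected {q \<in> S. f q \<noteq> 0}"
proof (rule connected_iff_connected_component[THEN iffD2], intro ballI)
  fix x y assume x: "x \<in> {q \<in> S. f q \<noteq> 0}" and y: "y \<in> {q \<in> S. f q \<noteq> 0}"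
  define T where "T = {t. x + t *s (y - x) \<in> S}"
  define Z where "Z = {t. x + t *s (y - x) \<in> S \<and> f (x + t *s (y - x)) = 0}"
  have "connected (T - Z)"
    unfolding T_def
  proof (rule connected_open_diff_countable)
    show "countable Z" unfolding Z_def using x by (intro line_hol_countable_zeros[OF S f]) auto
    show "open {t. x + t *s (y - x) \<in> S}" "connected {t. x + t *s (y - x) \<in> S}"
      by (intro open_line_vimage convex_connected convex_line_vimage S)+
  qed simp
  then have "connected ((\<lambda>t. x + t *s (y - x)) ` (T - Z))"
    by (rule connected_continuous_image[OF continuous_on_line])
  moreover have "(\<lambda>t. x + t *s (y - x)) ` (T - Z) \<subseteq> {q \<in> S. f q \<noteq> 0}"
    by (auto simp: T_def Z_def)
  moreover have "0 \<in> T - Z" "1 \<in> T - Z" using x y by (auto simp: T_def Z_def)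
  then have "x \<in> (\<lambda>t. x + t *s (y - x)) ` (T - Z)" "y \<in> (\<lambda>t. x + t *s (y - x)) ` (T - Z)"
    by (force intro: image_eqI[of _ _ 0])+
  ultimately show "connected_component {q \<in> S. f q \<noteq> 0} x y"
    unfolding connected_component_def by blast
qed

text \<open>The line from \<open>x\<close> to \<open>u\<close> meets \<open>U\<close> in an
  uncountable set of zeros, which is too many if \<open>f x\<close> is nonzero.\<close>

lemma line_hol_identity:
  assumes S: "open S" "convex S" and f: "line_hol S f"
    and U: "open U" "u \<in> U" "U \<subseteq> S" "\<And>q. q \<in> U \<Longrightarrow> f q = 0" and x: "x \<in> S"
  shows "f x = 0"
proof (rule ccontr)
  assume nz: "f x \<noteq> 0"
  let ?Z = "{t. x + t *s (u - x) \<in> S \<and> f (x + t *s (u - x)) = 0}"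
  have "open {t. x + t *s (u - x) \<in> U}" by (rule open_line_vimage[OF U(1)])
  moreover have "1 \<in> {t. x + t *s (u - x) \<in> U}" using U(2) by simp
  ultimately have "uncountable {t. x + t *s (u - x) \<in> U}"
    using countable_subset open_contains_ball uncountable_ball by metis
  moreover have "{t. x + t *s (u - x) \<in> U} \<subseteq> ?Z" using U by auto
  ultimately show False
    using line_hol_countable_zeros[OF S f x nz] countable_subset by blast
qed

section \<open>The action of the semi-torus\<close>

locale semi_torus_action =
  fixes \<A> :: "('a::{t2_space,second_countable_topology}, 'n::finite) chart set"
    and \<Lambda> :: "(complex^'n) set"
    and \<rho> :: "complex^'n \<Rightarrow> 'a \<Rightarrow> 'a"
    and G :: "('a \<Rightarrow> 'a) set"
  assumes mfd: "compact_complex_manifold \<A>"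
    and act: "divisorial_semi_torus \<A> \<Lambda> \<rho> G"
begin

lemma connected_X: "connected (UNIV :: 'a set)"
  using mfd unfolding compact_complex_manifold_def complex_manifold_def by blast

lemma chart_ex: obtains a where "a \<in> \<A>" "x \<in> cdom a"
  using mfd unfolding compact_complex_manifold_def complex_manifold_def by blast

lemma chart:
  assumes "a \<in> \<A>"
  shows "open (cdom a)" "open (cmap a ` cdom a)"
    "homeomorphism (cdom a) (cmap a ` cdom a) (cmap a) (cinv a)"
  using mfd assms unfolding compact_complex_manifold_def complex_manifold_def by blast+

lemma cinv_cmap: "a \<in> \<A> \<Longrightarrow> x \<in> cdom a \<Longrightarrow> cinv a (cmap a x) = x"
  using chart(3) unfolding homeomorphism_def by blast

lemma cmap_cinv: "a \<in> \<A> \<Longrightarrow> p \<in> cmap a ` cdom a \<Longrightarrow> cmap a (cinv a p) = p"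
  using chart(3) unfolding homeomorphism_def by blast

lemma cinv_in: "p \<in> cmap a ` cdom a \<Longrightarrow> cinv a p \<in> cdom a"
  by (rule inv_into_into)

lemma continuous_on_cinv: "a \<in> \<A> \<Longrightarrow> continuous_on (cmap a ` cdom a) (cinv a)"
  using chart(3) unfolding homeomorphism_def by blast

lemma open_cinv_image:
  assumes "a \<in> \<A>" "open V" "V \<subseteq> cmap a ` cdom a" shows "open (cinv a ` V)"
proof -
  have "openin (top_of_set (cdom a)) (cinv a ` V)"
    using homeomorphism_imp_open_map[OF homeomorphism_sym[THEN iffD1, OF chart(3)[OF assms(1)]], of V]
      assms by (simp add: openin_open_eq chart(2)[OF assms(1)])
  then show ?thesis using chart(1)[OF assms(1)] openin_open_trans by blast
qed

lemma open_cmap_image: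
  assumes "a \<in> \<A>" "open W" shows "open (cmap a ` (cdom a \<inter> W))"
proof -
  have "openin (top_of_set (cmap a ` cdom a)) (cmap a ` (cdom a \<inter> W))"
    by (rule homeomorphism_imp_open_map[OF chart(3)[OF assms(1)]]) (use assms in auto)
  then show ?thesis using chart(2)[OF assms(1)] openin_open_trans by blast
qed

lemma \<rho>_add: "\<rho> (z + w) x = \<rho> z (\<rho> w x)"
  using act unfolding divisorial_semi_torus_def quotient_subgroup_def by (metis comp_apply)

lemma \<rho>_id_iff: "\<rho> z = id \<longleftrightarrow> z \<in> \<Lambda>"
  using act unfolding divisorial_semi_torus_def quotient_subgroup_def by blast

lemma \<rho>_0 [simp]: "\<rho> 0 x = x"
  using \<rho>_id_iff[of 0] act unfolding divisorial_semi_torus_def semi_torus_lattice_def by simp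

lemma \<rho>_minus [simp]: "\<rho> (- z) (\<rho> z x) = x" "\<rho> z (\<rho> (- z) x) = x"
  using \<rho>_add[of "- z" z x] \<rho>_add[of z "- z" x] by simp_all

lemma \<rho>_commute: "\<rho> z (\<rho> w x) = \<rho> w (\<rho> z x)"
  by (metis \<rho>_add add.commute)

lemma G_eq: "G = range \<rho>"
  using act unfolding divisorial_semi_torus_def quotient_subgroup_def by blast

lemma continuous_\<rho>: "continuous_on UNIV (\<lambda>(z, x). \<rho> z x)"
  using act unfolding divisorial_semi_torus_def quotient_subgroup_def holo_action_def by blast

lemma continuous_on_\<rho>:
  assumes "continuous_on S f" "continuous_on S g" shows "continuous_on S (\<lambda>s. \<rho> (f s) (g s))"
  using continuous_on_compose2[OF continuous_\<rho> continuous_on_Pair[OF assms]] by simp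

section \<open>Derivatives of the action and of its orbit maps\<close>

lemma \<rho>_joint_derivative:
  assumes "a \<in> \<A>" "b \<in> \<A>" "x \<in> cdom a" "\<rho> z x \<in> cdom b"
  obtains A B :: "complex^'n^'n" where
    "((\<lambda>(y, p). cmap b (\<rho> y (cinv a p))) has_derivative (\<lambda>(v, w). A *v v + B *v w)) (at (z, cmap a x))"
  using act assms unfolding divisorial_semi_torus_def quotient_subgroup_def holo_action_def by blast

text \<open>The columns are the generating vector fields of the unit vectors at \<open>x\<close>, so
  the determinant of this matrix decides membership in \<open>D_supp\<close>. Off
  \<open>D_supp\<close> its inverse passes from the chart to the coordinates of the covering space
  of \<open>G\<close>.\<close>

definition fmat :: "('a, 'n) chart \<Rightarrow> 'a \<Rightarrow> complex^'n^'n" where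
  "fmat a x = jacobian (\<lambda>z. cmap a (\<rho> z x)) (at 0)"

text \<open>Since \<open>\<rho> (z + h) x = \<rho> h (\<rho> z x)\<close>, the derivative at
  \<open>z\<close> is the derivative at 0 of the orbit map of the moved point. It therefore depends
  on \<open>z\<close> only through that point.\<close>

lemma orbit_derivative:
  assumes b: "b \<in> \<A>" "\<rho> z x \<in> cdom b"
  shows "((\<lambda>z. cmap b (\<rho> z x)) has_derivative (\<lambda>v. fmat b (\<rho> z x) *v v)) (at z)"
proof -
  obtain a where a: "a \<in> \<A>" "x \<in> cdom a" by (rule chart_ex)
  obtain A B :: "complex^'n^'n" where AB: "((\<lambda>(y, p). cmap b (\<rho> y (cinv a p))) has_derivative (\<lambda>(v, w). A *v v + B *v w)) (at (z, cmap a x))"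
    using \<rho>_joint_derivative[OF a(1) b(1) a(2) b(2)] .
  have "((\<lambda>y. (y, cmap a x)) has_derivative (\<lambda>v. (v, 0))) (at z)"
    by (auto intro!: derivative_eq_intros)
  from has_derivative_compose[OF this AB]
  have D: "((\<lambda>z. cmap b (\<rho> z x)) has_derivative (\<lambda>v. A *v v)) (at z)"
    by (simp add: cinv_cmap[OF a])
  have "((\<lambda>h. z + h) has_derivative (\<lambda>v. v)) (at 0)" by (auto intro!: derivative_eq_intros)
  from has_derivative_compose[OF this, of "\<lambda>z. cmap b (\<rho> z x)" "\<lambda>v. A *v v"] D
  have "((\<lambda>h. cmap b (\<rho> (z + h) x)) has_derivative (\<lambda>v. A *v v)) (at 0)" by simp
  then have "((\<lambda>h. cmap b (\<rho> h (\<rho> z x))) has_derivative (\<lambda>v. A *v v)) (at 0)"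
    by (simp add: add.commute[of z] \<rho>_add)
  then have "fmat b (\<rho> z x) = A" unfolding fmat_def by (rule jacobian_eqI)
  with D show ?thesis by simp
qed

lemma translation_derivative:
  assumes "a \<in> \<A>" "b \<in> \<A>" "x \<in> cdom a" "\<rho> z x \<in> cdom b"
  shows "((cmap b \<circ> \<rho> z \<circ> cinv a) has_derivative
           (\<lambda>v. jacobian (cmap b \<circ> \<rho> z \<circ> cinv a) (at (cmap a x)) *v v)) (at (cmap a x))"
proof -
  obtain A B :: "complex^'n^'n" where AB: "((\<lambda>(y, p). cmap b (\<rho> y (cinv a p))) has_derivative (\<lambda>(v, w). A *v v + B *v w)) (at (z, cmap a x))"
    using \<rho>_joint_derivative[OF assms] .
  have "((\<lambda>p. (z, p)) has_derivative (\<lambda>w. (0, w))) (at (cmap a x))"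
    by (auto intro!: derivative_eq_intros)
  from has_derivative_compose[OF this AB]
  have "((cmap b \<circ> \<rho> z \<circ> cinv a) has_derivative (\<lambda>v. B *v v)) (at (cmap a x))"
    by (simp add: o_def)
  with jacobian_eqI[OF this] show ?thesis by simp
qed

lemma open_orbit_vimage:
  assumes "a \<in> \<A>" shows "open {z. \<rho> z x \<in> cdom a}"
proof -
  have "open ((\<lambda>z. \<rho> z x) -` cdom a)"
    using continuous_on_\<rho>[OF continuous_on_id continuous_on_const, of UNIV x] chart(1)[OF assms]
    by (simp add: continuous_on_open_vimage)
  then show ?thesis by (simp add: vimage_def)
qed

text \<open>Differentiating \<open>\<rho> h (\<rho> z x) = \<rho> z (\<rho> h x)\<close> at
  \<open>h = 0\<close>: as the group is abelian, translations preserve the generating fields. The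
  case \<open>z = 0\<close> is the change of charts.\<close>

lemma fmat_transform:
  assumes "a \<in> \<A>" "b \<in> \<A>" "x \<in> cdom a" "\<rho> z x \<in> cdom b"
  shows "fmat b (\<rho> z x) = jacobian (cmap b \<circ> \<rho> z \<circ> cinv a) (at (cmap a x)) ** fmat a x"
proof -
  let ?J = "jacobian (cmap b \<circ> \<rho> z \<circ> cinv a) (at (cmap a x))"
  have "((\<lambda>h. cmap a (\<rho> h x)) has_derivative (\<lambda>v. fmat a x *v v)) (at 0)"
    using orbit_derivative[of a 0 x] assms by simp
  from has_derivative_compose[OF this, of "cmap b \<circ> \<rho> z \<circ> cinv a" "\<lambda>v. ?J *v v"] translation_derivative[OF assms]
  have "((\<lambda>h. (cmap b \<circ> \<rho> z \<circ> cinv a) (cmap a (\<rho> h x))) has_derivative (\<lambda>v. ?J *v (fmat a x *v v))) (at 0)"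
    by simp
  then have "((\<lambda>h. cmap b (\<rho> h (\<rho> z x))) has_derivative (\<lambda>v. ?J *v (fmat a x *v v))) (at 0)"
  proof (rule has_derivative_transform_within_open)
    show "open {h. \<rho> h x \<in> cdom a}" by (rule open_orbit_vimage[OF assms(1)])
    show "0 \<in> {h. \<rho> h x \<in> cdom a}" using assms by simp
    show "(cmap b \<circ> \<rho> z \<circ> cinv a) (cmap a (\<rho> h x)) = cmap b (\<rho> h (\<rho> z x))" if "h \<in> {h. \<rho> h x \<in> cdom a}" for h
      using that cinv_cmap[OF assms(1)] by (simp add: \<rho>_commute[of z])
  qed
  then show ?thesis unfolding fmat_def[of b] by (intro jacobian_eqI) (simp add: matrix_vector_mul_assoc)
qed

definition U :: "'a set" where "U = - D_supp \<A> \<rho>"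

lemma U_iff:
  assumes "a \<in> \<A>" "x \<in> cdom a" shows "x \<in> U \<longleftrightarrow> det (fmat a x) \<noteq> 0"
proof -
  have f: "(\<chi> i j. fund_field \<rho> (axis j 1) b x $ i) = fmat b x" for b x
    unfolding fund_field_def fmat_def jacobian_def matrix_def by simp
  have "det (fmat a x) \<noteq> 0" if "b \<in> \<A>" "x \<in> cdom b" "det (fmat b x) \<noteq> 0" for b
    using fmat_transform[of a b x 0] assms that by (auto simp: det_mul)
  then show ?thesis unfolding U_def D_supp_def f using assms by auto
qed

lemma U_\<rho>: "\<rho> z x \<in> U \<longleftrightarrow> x \<in> U"
proof -
  have *: "\<rho> z x \<in> U \<Longrightarrow> x \<in> U" for z x
  proof -
    assume u: "\<rho> z x \<in> U"
    obtain a where a: "a \<in> \<A>" "x \<in> cdom a" by (rule chart_ex)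
    obtain b where b: "b \<in> \<A>" "\<rho> z x \<in> cdom b" by (rule chart_ex)
    show "x \<in> U"
      using u fmat_transform[OF a(1) b(1) a(2) b(2)] unfolding U_iff[OF a] U_iff[OF b] by (auto simp: det_mul)
  qed
  from *[of z x] *[of "- z" "\<rho> z x"] show ?thesis by auto
qed

lemma orbit_holo:
  assumes "a \<in> \<A>" shows "holo_on {z. \<rho> z x \<in> cdom a} (\<lambda>z. cmap a (\<rho> z x))"
  unfolding holo_on_def using orbit_derivative[OF assms] by blast

lemma orbit_jacobian:
  assumes "a \<in> \<A>" "\<rho> z x \<in> cdom a"
  shows "jacobian (\<lambda>z. cmap a (\<rho> z x)) (at z) = fmat a (\<rho> z x)"
  by (rule jacobian_eqI[OF orbit_derivative[OF assms]])

text \<open>An entry of \<open>fmat\<close> along the line is the derivative with respect to the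
  group parameter, at 0, of a function \<open>\<Phi>\<close> of two complex variables, the group
  parameter and the line parameter. Joint holomorphy of the action makes \<open>\<Phi>\<close>
  holomorphic, so \<open>hol_fder_line\<close> in dimension 2 shows that the entry is holomorphic in
  the line parameter; the determinant is a polynomial in the entries.\<close>

lemma det_fmat_line_hol:
  assumes a: "a \<in> \<A>" shows "line_hol (cmap a ` cdom a) (\<lambda>p. det (fmat a (cinv a p)))"
  unfolding line_hol_def
proof (intro allI)
  fix p v :: "complex^'n"
  let ?S = "cmap a ` cdom a"
  let ?T = "{t. p + t *s v \<in> ?S}"
  have ent: "(\<lambda>t. fmat a (cinv a (p + t *s v)) $ i $ j) holomorphic_on ?T" for i j
  proof -
    define y :: "complex^2 \<Rightarrow> complex^'n" where "y q = (q $ 1) *s axis j 1" for q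
    define m :: "complex^2 \<Rightarrow> complex^'n" where "m q = p + (q $ 2) *s v" for q
    define \<Phi> where "\<Phi> q = cmap a (\<rho> (y q) (cinv a (m q))) $ i" for q
    define W where "W = {q. m q \<in> ?S \<and> \<rho> (y q) (cinv a (m q)) \<in> cdom a}"
    have cy: "continuous_on A y" for A
      unfolding y_def by (intro bounded_linear.continuous_on[OF bounded_linear_vsmult_left]
          bounded_linear.continuous_on[OF bounded_linear_vec_nth] continuous_on_id)
    have cm: "continuous_on A m" for A
      unfolding m_def by (intro continuous_on_add continuous_on_const bounded_linear.continuous_on[OF bounded_linear_vsmult_left]
          bounded_linear.continuous_on[OF bounded_linear_vec_nth] continuous_on_id)
    have dy: "(y has_derivative (\<lambda>u. (u $ 1) *s axis j 1)) F" for F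
      unfolding y_def
      by (rule bounded_linear.has_derivative[OF bounded_linear_vsmult_left bounded_linear_imp_has_derivative[OF bounded_linear_vec_nth]])
    have dm: "(m has_derivative (\<lambda>u. (u $ 2) *s v)) F" for F
      unfolding m_def
      by (rule has_derivative_eq_rhs, rule has_derivative_add[OF has_derivative_const
          bounded_linear.has_derivative[OF bounded_linear_vsmult_left bounded_linear_imp_has_derivative[OF bounded_linear_vec_nth]]]) simp
    have oS: "open (m -` ?S)" using cm[of UNIV] chart(2)[OF a] by (simp add: continuous_on_open_vimage)
    have W: "open W"
    proof -
      have "continuous_on (m -` ?S) (\<lambda>q. \<rho> (y q) (cinv a (m q)))"
        by (intro continuous_on_\<rho> cy continuous_on_compose2[OF continuous_on_cinv[OF a] cm]) auto
      then have "open ((\<lambda>q. \<rho> (y q) (cinv a (m q))) -` cdom a \<inter> (m -` ?S))"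
        using oS chart(1)[OF a] by (simp add: continuous_on_open_vimage)
      moreover have "(\<lambda>q. \<rho> (y q) (cinv a (m q))) -` cdom a \<inter> (m -` ?S) = W" by (auto simp: W_def)
      ultimately show ?thesis by simp
    qed
    have D: "\<exists>A B :: complex^'n^'n. (\<Phi> has_derivative (\<lambda>u. (A *v ((u $ 1) *s axis j 1) + B *v ((u $ 2) *s v)) $ i)) (at q) \<and>
        A = fmat a (\<rho> (y q) (cinv a (m q)))" if "q \<in> W" for q
    proof -
      have q: "m q \<in> ?S" "\<rho> (y q) (cinv a (m q)) \<in> cdom a" using that by (auto simp: W_def)
      obtain A B :: "complex^'n^'n" where AB:
        "((\<lambda>(y, p). cmap a (\<rho> y (cinv a p))) has_derivative (\<lambda>(v, w). A *v v + B *v w)) (at (y q, m q))"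
        using \<rho>_joint_derivative[OF a a cinv_in[OF q(1)] q(2)] unfolding cmap_cinv[OF a q(1)] .
      have "((\<lambda>q. (y q, m q)) has_derivative (\<lambda>u. ((u $ 1) *s axis j 1, (u $ 2) *s v))) (at q)"
        by (intro has_derivative_Pair dy dm)
      from has_derivative_vec_nth[OF has_derivative_compose[OF this AB], of i]
      have 1: "(\<Phi> has_derivative (\<lambda>u. (A *v ((u $ 1) *s axis j 1) + B *v ((u $ 2) *s v)) $ i)) (at q)"
        by (simp add: \<Phi>_def[abs_def])
      have "((\<lambda>z. (z, m q)) has_derivative (\<lambda>u. (u, 0))) (at (y q))"
        by (auto intro!: derivative_eq_intros)
      from has_derivative_compose[OF this AB]
      have "((\<lambda>z. cmap a (\<rho> z (cinv a (m q)))) has_derivative (\<lambda>u. A *v u)) (at (y q))" by simp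
      then have "A = fmat a (\<rho> (y q) (cinv a (m q)))"
        using orbit_jacobian[OF a q(2)] jacobian_eqI by metis
      with 1 show ?thesis by blast
    qed
    have hol: "hol W \<Phi>"
      unfolding hol_def
    proof
      fix q assume "q \<in> W"
      from D[OF this] obtain A B :: "complex^'n^'n" where
        "(\<Phi> has_derivative (\<lambda>u. (A *v ((u $ 1) *s axis j 1) + B *v ((u $ 2) *s v)) $ i)) (at q)" by blast
      moreover have "(A *v (((\<i> *s u) $ 1) *s axis j 1) + B *v (((\<i> *s u) $ 2) *s v)) $ i
          = \<i> * (A *v ((u $ 1) *s axis j 1) + B *v ((u $ 2) *s v)) $ i" for u :: "complex^2"
        by (simp add: vector_scalar_commute algebra_simps)
      ultimately show "\<exists>D. (\<Phi> has_derivative D) (at q) \<and> (\<forall>v. D (\<i> *s v) = \<i> * D v)" by blast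
    qed
    have "(\<lambda>t. fder \<Phi> (0 + t *s axis 2 1) (axis 1 1)) holomorphic_on {t. 0 + t *s axis 2 1 \<in> W}"
      by (rule hol_fder_line[OF W hol]) simp
    moreover have y0: "y (0 + t *s axis 2 1) = 0" and m0: "m (0 + t *s axis 2 1) = p + t *s v" for t
      by (simp_all add: y_def m_def axis_def)
    have "{t. 0 + t *s axis 2 1 \<in> W} = ?T"
      unfolding W_def mem_Collect_eq y0 m0 using cinv_cmap[OF a] by auto
    moreover have "fder \<Phi> (0 + t *s axis 2 1) (axis 1 1) = fmat a (cinv a (p + t *s v)) $ i $ j" if "t \<in> ?T" for t
    proof -
      have q: "0 + t *s axis 2 1 \<in> W" unfolding W_def mem_Collect_eq y0 m0 using cinv_cmap[OF a] that by auto
      from D[OF q] obtain B :: "complex^'n^'n" where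
        "(\<Phi> has_derivative (\<lambda>u. (fmat a (cinv a (p + t *s v)) *v ((u $ 1) *s axis j 1) + B *v ((u $ 2) *s v)) $ i)) (at (0 + t *s axis 2 1))"
        unfolding y0 m0 by auto
      from fder_eqI[OF this] show ?thesis by (simp add: axis_def[of "1::2"] matrix_axis_nth)
    qed
    ultimately show ?thesis by (metis (no_types, lifting) holomorphic_transform)
  qed
  show "(\<lambda>t. det (fmat a (cinv a (p + t *s v)))) holomorphic_on ?T"
    unfolding det_def by (intro holomorphic_on_sum holomorphic_on_mult holomorphic_on_const holomorphic_on_prod ent)
qed

end

section \<open>The open orbit\<close>

lemma invertible_matrix_inv:
  assumes "invertible A" shows "A ** matrix_inv A = mat 1" "matrix_inv A ** A = mat 1"
proof -
  have "A ** matrix_inv A = mat 1 \<and> matrix_inv A ** A = mat 1"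
    using assms unfolding invertible_def matrix_inv_def by (rule someI_ex)
  then show "A ** matrix_inv A = mat 1" "matrix_inv A ** A = mat 1" by blast+
qed

lemma matrix_inv_det:
  fixes A :: "complex^'n^'n"
  assumes "det A \<noteq> 0" shows "A ** matrix_inv A = mat 1" "matrix_inv A ** A = mat 1"
  using assms invertible_matrix_inv invertible_det_nz by blast+

context semi_torus_action begin

text \<open>The continuous derivative for the inverse function theorem comes from
  \<open>holo_on_smooth\<close>. By \<open>orbit_derivative\<close> the Jacobian of the inverse can
  be expressed at the point \<open>cinv a p\<close> itself, without reference to
  \<open>\<sigma>\<close> or to the base point \<open>x\<close>.\<close>

lemma local_inverse:
  assumes a: "a \<in> \<A>" "x \<in> cdom a" and x: "x \<in> U"
  obtains V \<sigma> where "open V" "cmap a x \<in> V" "V \<subseteq> cmap a ` cdom a" "holo_on V \<sigma>"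
    "\<And>p. p \<in> V \<Longrightarrow> \<rho> (\<sigma> p) x = cinv a p"
    "\<And>p. p \<in> V \<Longrightarrow> jacobian \<sigma> (at p) = matrix_inv (fmat a (cinv a p))"
proof -
  let ?N = "{z. \<rho> z x \<in> cdom a}" and ?o = "\<lambda>z. cmap a (\<rho> z x)"
  have N: "open ?N" "0 \<in> ?N" using open_orbit_vimage[OF a(1)] a(2) by auto
  define f' where "f' z = Blinfun (\<lambda>v. fmat a (\<rho> z x) *v v)" for z
  have lin: "bounded_linear (\<lambda>v. fmat a y *v v)" for y by (rule matrix_vector_mul_bounded_linear)
  have f': "blinfun_apply (f' z) = (\<lambda>v. fmat a (\<rho> z x) *v v)" for z
    unfolding f'_def by (rule bounded_linear_Blinfun_apply[OF lin])
  have der: "(?o has_derivative blinfun_apply (f' z)) (at z)" if "z \<in> ?N" for z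
    using orbit_derivative[OF a(1), of z x] that by (simp add: f')
  have cont: "continuous_on ?N f'"
  proof (rule continuous_on_blinfun_componentwise)
    fix i
    have "Cr_on (Suc 0) ?N ?o"
      using holo_on_smooth[OF N(1) orbit_holo[OF a(1)]] unfolding smooth_on_def by blast
    then have "continuous_on ?N (\<lambda>z. fder ?o z i)" by simp
    then show "continuous_on ?N (\<lambda>z. blinfun_apply (f' z) i)"
      by (rule continuous_on_eq) (use fder_eqI[OF der] in auto)
  qed
  have d0: "det (fmat a x) \<noteq> 0" using x U_iff[OF a] by simp
  let ?i = "Blinfun (\<lambda>v. matrix_inv (fmat a x) *v v)"
  have inv: "?i o\<^sub>L f' 0 = id_blinfun"
    by (rule blinfun_eqI) (simp add: f' bounded_linear_Blinfun_apply[OF matrix_vector_mul_bounded_linear]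
        matrix_vector_mul_assoc matrix_inv_det[OF d0])
  obtain U' V g g' where V: "open U'" "U' \<subseteq> ?N" "0 \<in> U'" "open V" "?o 0 \<in> V" "homeomorphism U' V ?o g"
    "\<And>y. y \<in> V \<Longrightarrow> (g has_derivative (g' y)) (at y)"
    "\<And>y. y \<in> V \<Longrightarrow> g' y = inv (blinfun_apply (f'(g y)))"
    "\<And>y. y \<in> V \<Longrightarrow> bij (blinfun_apply (f'(g y)))"
    using inverse_function_theorem[OF N(1) der cont N(2) inv] by blast
  have gU: "g p \<in> U'" "?o (g p) = p" if "p \<in> V" for p
    using V(6) that unfolding homeomorphism_def by auto
  have \<rho>g: "\<rho> (g p) x = cinv a p" if "p \<in> V" for p
    using gU[OF that] V(2) cinv_cmap[OF a(1)] by fastforce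
  have sub: "V \<subseteq> cmap a ` cdom a"
  proof
    fix p assume "p \<in> V"
    then show "p \<in> cmap a ` cdom a" using gU[of p] V(2) by (metis (no_types, lifting) imageI mem_Collect_eq subsetD)
  qed
  have dg: "(g has_derivative (\<lambda>v. matrix_inv (fmat a (cinv a p)) *v v)) (at p)" if p: "p \<in> V" for p
  proof -
    let ?M = "fmat a (cinv a p)"
    have "cinv a p \<in> U" using \<rho>g[OF p] x U_\<rho> by metis
    then have d: "det ?M \<noteq> 0" using U_iff[OF a(1) cinv_in] sub p by blast
    have "inv (\<lambda>v. ?M *v v) = (\<lambda>v. matrix_inv ?M *v v)"
      by (rule inv_equality) (simp_all add: matrix_vector_mul_assoc matrix_inv_det[OF d])
    then have "g' p = (\<lambda>v. matrix_inv ?M *v v)" using V(8)[OF p] by (simp add: f' \<rho>g[OF p])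
    then show ?thesis using V(7)[OF p] by simp
  qed
  show ?thesis
  proof (rule that[OF V(4) _ sub _ \<rho>g])
    show "cmap a x \<in> V" using V(5) by simp
    show "holo_on V g" unfolding holo_on_def using dg by blast
    show "jacobian g (at p) = matrix_inv (fmat a (cinv a p))" if "p \<in> V" for p
      by (rule jacobian_eqI[OF dg[OF that]])
  qed auto
qed

lemma open_orbit:
  assumes "x \<in> U" shows "open (range (\<lambda>z. \<rho> z x))"
proof (rule topological_space_class.openI)
  fix y assume "y \<in> range (\<lambda>z. \<rho> z x)"
  then obtain z where z: "y = \<rho> z x" by blast
  then have y: "y \<in> U" using assms U_\<rho> by simp
  obtain a where a: "a \<in> \<A>" "y \<in> cdom a" by (rule chart_ex)
  obtain V \<sigma> where V: "open V" "cmap a y \<in> V" "V \<subseteq> cmap a ` cdom a" "\<And>p. p \<in> V \<Longrightarrow> \<rho> (\<sigma> p) y = cinv a p"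
    using local_inverse[OF a y] by metis
  have "cinv a ` V \<subseteq> range (\<lambda>z. \<rho> z x)"
    using V(4) z by (metis (no_types, lifting) \<rho>_add image_subsetI rangeI)
  moreover have "y \<in> cinv a ` V" using V(2) cinv_cmap[OF a] by (metis imageI)
  ultimately show "\<exists>T. open T \<and> y \<in> T \<and> T \<subseteq> range (\<lambda>z. \<rho> z x)"
    using open_cinv_image[OF a(1) V(1) V(3)] by blast
qed

lemma open_U: "open U"
proof (rule topological_space_class.openI)
  fix x assume x: "x \<in> U"
  have "x \<in> range (\<lambda>z. \<rho> z x)" using \<rho>_0[of x] by (metis rangeI)
  then show "\<exists>T. open T \<and> x \<in> T \<and> T \<subseteq> U"
    using open_orbit[OF x] x U_\<rho> by blast
qed

text \<open>If the vector fields are dependent at a point of the open orbit, a real line acts trivially on it.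
  The orbit is then the image of a hyperplane and therefore a null set in each chart.\<close>

lemma U_nonempty: "U \<noteq> {}"
proof -
  obtain x where op: "open ((\<lambda>f. f x) ` G)"
    using act unfolding divisorial_semi_torus_def has_open_orbit_def by blast
  have Geq: "(\<lambda>f. f x) ` G = range (\<lambda>z. \<rho> z x)" unfolding G_eq by auto
  obtain a where a: "a \<in> \<A>" "x \<in> cdom a" by (rule chart_ex)
  have "x \<in> U"
  proof (rule ccontr)
    assume "x \<notin> U"
    then have "det (fmat a x) = 0" using U_iff[OF a] by simp
    then have "\<nexists>B. B ** fmat a x = mat 1"
      using invertible_left_inverse invertible_det_nz by metis
    then obtain v where v: "v \<noteq> 0" "fmat a x *v v = 0"
      unfolding matrix_left_invertible_ker by blast
    let ?h = "\<lambda>t::real. \<rho> (t *\<^sub>R v) x"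
    have ch: "continuous_on S ?h" for S by (intro continuous_on_\<rho> continuous_intros)
    \<comment> \<open>By \<open>fmat_transform\<close> the kernel vector \<open>v\<close> of
      \<open>fmat a x\<close> stays in the kernel along the curve, so the curve has velocity zero in
      every chart.\<close>
    have "?h constant_on UNIV"
    proof (rule locally_constant_imp_constant)
      fix t0 :: real
      obtain b where b: "b \<in> \<A>" "?h t0 \<in> cdom b" by (rule chart_ex)
      have "open (?h -` cdom b)" using ch[of UNIV] chart(1)[OF b(1)] by (simp add: continuous_on_open_vimage)
      then obtain e where e: "0 < e" "ball t0 e \<subseteq> ?h -` cdom b" using b(2) open_contains_ball by blast
      have "((\<lambda>t. cmap b (?h t)) has_derivative (\<lambda>_. 0)) (at t within ball t0 e)" if "t \<in> ball t0 e" for t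
      proof -
        have hb: "?h t \<in> cdom b" using that e by blast
        have "fmat b (?h t) *v v = 0"
          unfolding fmat_transform[OF a(1) b(1) a(2) hb] matrix_vector_mul_assoc[symmetric] v(2) by simp
        then have z: "fmat b (?h t) *v (s *\<^sub>R v) = 0" for s
          by (simp add: linear_scale[OF matrix_vector_mul_linear])
        have "((\<lambda>t. t *\<^sub>R v) has_derivative (\<lambda>s. s *\<^sub>R v)) (at t within ball t0 e)"
          by (auto intro!: derivative_eq_intros)
        from has_derivative_compose[OF this orbit_derivative[OF b(1) hb]] show ?thesis by (simp add: z)
      qed
      from has_derivative_zero_constant[OF convex_ball this]
      obtain c where c: "\<And>t. t \<in> ball t0 e \<Longrightarrow> cmap b (?h t) = c" by blast
      have "?h t = cinv b c" if "t \<in> ball t0 e" for t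
      proof -
        have "?h t \<in> cdom b" using that e by blast
        from cinv_cmap[OF b(1) this] show ?thesis unfolding c[OF that] by simp
      qed
      then have heq: "?h t = ?h t0" if "t \<in> ball t0 e" for t
        using that centre_in_ball[of t0 e] e(1) by simp
      show "\<exists>T. openin (top_of_set UNIV) T \<and> t0 \<in> T \<and> (\<forall>t\<in>T. ?h t = ?h t0)"
      proof (intro exI[of _ "ball t0 e"] conjI ballI)
        show "?h t = ?h t0" if "t \<in> ball t0 e" for t by (rule heq[OF that])
      qed (use e(1) in auto)
    qed simp
    then have h: "?h t = x" for t unfolding constant_on_def by (metis UNIV_I \<rho>_0 scaleR_zero_left)
    let ?P = "{z. v \<bullet> z = 0}" and ?N = "{z. \<rho> z x \<in> cdom a}"
    have orb: "\<exists>z0\<in>?P. \<rho> z x = \<rho> z0 x" for z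
    proof
      let ?s = "(v \<bullet> z) / (v \<bullet> v)"
      show "z - ?s *\<^sub>R v \<in> ?P" using v(1) by (simp add: inner_diff_right)
      show "\<rho> z x = \<rho> (z - ?s *\<^sub>R v) x" using \<rho>_add[of "z - ?s *\<^sub>R v" "?s *\<^sub>R v" x] h by simp
    qed
    let ?W = "cmap a ` (cdom a \<inter> range (\<lambda>z. \<rho> z x))"
    have "?W = (\<lambda>z. cmap a (\<rho> z x)) ` (?P \<inter> ?N)"
    proof (intro equalityI subsetI)
      fix y assume "y \<in> ?W"
      then obtain z where z: "y = cmap a (\<rho> z x)" "\<rho> z x \<in> cdom a" by blast
      obtain z0 where "z0 \<in> ?P" "\<rho> z x = \<rho> z0 x" using orb by blast
      with z show "y \<in> (\<lambda>z. cmap a (\<rho> z x)) ` (?P \<inter> ?N)" by auto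
    qed auto
    moreover have "negligible ((\<lambda>z. cmap a (\<rho> z x)) ` (?P \<inter> ?N))"
    proof (rule negligible_differentiable_image_negligible)
      show "negligible (?P \<inter> ?N)"
        by (rule negligible_subset[OF negligible_hyperplane[of v 0]]) (use v(1) in auto)
      show "(\<lambda>z. cmap a (\<rho> z x)) differentiable_on ?P \<inter> ?N"
        unfolding differentiable_on_def
      proof
        fix z assume "z \<in> ?P \<inter> ?N"
        then have "\<rho> z x \<in> cdom a" by simp
        from differentiableI[OF orbit_derivative[OF a(1) this]]
        show "(\<lambda>z. cmap a (\<rho> z x)) differentiable at z within ?P \<inter> ?N"
          by (rule differentiable_at_withinI)
      qed
    qed simp
    moreover have "open ?W" using open_cmap_image[OF a(1)] op Geq by simp
    moreover have "cmap a x \<in> ?W" using a(2) \<rho>_0[of x] by (metis IntI imageI rangeI)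
    ultimately show False using open_not_negligible by (metis empty_iff)
  qed
  then show ?thesis by blast
qed

lemma clopen_X:
  assumes "open E" "closed E" shows "E = {} \<or> E = (UNIV :: 'a set)"
  using connectedD[OF connected_X assms(1), of "- E"] assms(2) by (auto simp: closed_def)

lemma chart_ball:
  assumes "a \<in> \<A>" "x \<in> cdom a"
  obtains r where "0 < r" "ball (cmap a x) r \<subseteq> cmap a ` cdom a"
    "open (cinv a ` ball (cmap a x) r)" "x \<in> cinv a ` ball (cmap a x) r"
proof -
  obtain r where r: "0 < r" "ball (cmap a x) r \<subseteq> cmap a ` cdom a"
    using chart(2)[OF assms(1)] assms(2) open_contains_ball by (metis imageI)
  have "x \<in> cinv a ` ball (cmap a x) r" using r(1) cinv_cmap[OF assms] by (metis centre_in_ball imageI)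
  with r show ?thesis using open_cinv_image[OF assms(1) open_ball r(2)] that by blast
qed

text \<open>The interior of the complement is open and closed: if it meets a chart ball, the
  determinant vanishes on an open part of that ball and hence on all of it. As \<open>U\<close> is
  nonempty and the manifold connected, this interior is empty.\<close>

lemma U_dense: 
  assumes "open W" "W \<noteq> {}" shows "W \<inter> U \<noteq> {}"
proof -
  let ?I = "interior (- U)"
  have "closed ?I"
    unfolding closed_def
  proof (rule topological_space_class.openI)
    fix x assume x: "x \<in> - ?I"
    obtain a where a: "a \<in> \<A>" "x \<in> cdom a" by (rule chart_ex)
    obtain r where r: "0 < r" "ball (cmap a x) r \<subseteq> cmap a ` cdom a"
      "open (cinv a ` ball (cmap a x) r)" "x \<in> cinv a ` ball (cmap a x) r" using chart_ball[OF a] .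
    let ?B = "ball (cmap a x) r" and ?f = "\<lambda>p. det (fmat a (cinv a p))"
    have f: "?f p = 0 \<longleftrightarrow> cinv a p \<notin> U" if "p \<in> ?B" for p
      using U_iff[OF a(1) cinv_in] that r(2) by blast
    have "cinv a ` ?B \<inter> ?I = {}"
    proof (rule ccontr)
      assume "cinv a ` ?B \<inter> ?I \<noteq> {}"
      then obtain u where u: "u \<in> ?B" "cinv a u \<in> ?I" by blast
      let ?O = "?B \<inter> cmap a ` (cdom a \<inter> ?I)"
      have "u \<in> cmap a ` cdom a" using u r(2) by blast
      from cmap_cinv[OF a(1) this] cinv_in[OF this] u
      have uO: "u \<in> ?O" by (metis IntI imageI)
      have "?f p = 0" if "p \<in> ?O" for p
        using that f cinv_cmap[OF a(1)] interior_subset by fastforce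
      then have "?f p = 0" if "p \<in> ?B" for p
        using line_hol_identity[OF open_ball convex_ball line_hol_subset[OF det_fmat_line_hol[OF a(1)] r(2)], of ?O u p]
          that uO open_cmap_image[OF a(1) open_interior] by blast
      then have "cinv a ` ?B \<subseteq> - U" using f by blast
      then have "x \<in> ?I" using r interior_maximal by blast
      with x show False by blast
    qed
    then show "\<exists>T. open T \<and> x \<in> T \<and> T \<subseteq> - ?I" using r by blast
  qed
  then have "?I = {} \<or> ?I = UNIV"
    using clopen_X open_interior by blast
  then have "?I = {}" using U_nonempty interior_subset by blast
  then show ?thesis using assms interior_maximal[of W "- U"] by blast
qed

lemma U_eq_orbit:
  assumes x: "x \<in> U" shows "U = range (\<lambda>z. \<rho> z x)"
proof -
  let ?O = "range (\<lambda>z. \<rho> z x)"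
  \<comment> \<open>Points near which \<open>U\<close> consists of the orbit \<open>?O\<close> only.
    \<open>E\<close> is open by its form; it will be seen to be closed, so connectedness of the
    manifold spreads the property from \<open>x\<close> to all points.\<close>
  define E where "E = {y. \<exists>T. open T \<and> y \<in> T \<and> T \<inter> U \<subseteq> ?O}"
  have oE: "open E"
  proof (rule topological_space_class.openI)
    fix y assume "y \<in> E"
    then obtain T where "open T" "y \<in> T" "T \<inter> U \<subseteq> ?O" unfolding E_def by blast
    then show "\<exists>T. open T \<and> y \<in> T \<and> T \<subseteq> E" unfolding E_def by blast
  qed
  have xO: "x \<in> ?O" using \<rho>_0[of x] by (metis rangeI)
  have oO': "open (U - ?O)"
  proof (rule topological_space_class.openI)
    fix y assume y: "y \<in> U - ?O"
    have "range (\<lambda>z. \<rho> z y) \<subseteq> U - ?O"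
    proof
      fix u assume "u \<in> range (\<lambda>z. \<rho> z y)"
      then obtain z where z: "u = \<rho> z y" by blast
      have "u \<notin> ?O"
      proof
        assume "u \<in> ?O"
        then obtain w where "u = \<rho> w x" by blast
        then have "y = \<rho> (- z) (\<rho> w x)" using z \<rho>_minus(1)[of z y] by simp
        then have "y = \<rho> (- z + w) x" unfolding \<rho>_add .
        with y show False by blast
      qed
      then show "u \<in> U - ?O" using z y U_\<rho> by simp
    qed
    moreover have "y \<in> range (\<lambda>z. \<rho> z y)" using \<rho>_0[of y] by (metis rangeI)
    ultimately show "\<exists>T. open T \<and> y \<in> T \<and> T \<subseteq> U - ?O" using open_orbit y by blast
  qed
  have "open (- E)"
  proof (rule topological_space_class.openI)
    fix y assume y: "y \<in> - E"
    obtain a where a: "a \<in> \<A>" "y \<in> cdom a" by (rule chart_ex)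
    obtain r where r: "0 < r" "ball (cmap a y) r \<subseteq> cmap a ` cdom a"
      "open (cinv a ` ball (cmap a y) r)" "y \<in> cinv a ` ball (cmap a y) r" using chart_ball[OF a] .
    let ?B = "ball (cmap a y) r" and ?f = "\<lambda>p. det (fmat a (cinv a p))"
    let ?T = "cinv a ` ?B"
    have "connected (cinv a ` {q \<in> ?B. ?f q \<noteq> 0})"
      by (intro connected_continuous_image continuous_on_subset[OF continuous_on_cinv[OF a(1)]]
          line_hol_connected_nonzero line_hol_subset[OF det_fmat_line_hol[OF a(1)] r(2)]) (use r in auto)
    moreover have "cinv a ` {q \<in> ?B. ?f q \<noteq> 0} = ?T \<inter> U"
      using U_iff[OF a(1) cinv_in] r(2) by blast
    ultimately have conn: "connected (?T \<inter> U)" by simp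
    \<comment> \<open>\<open>?O\<close> and \<open>U - ?O\<close> are both open, the latter as a
      union of orbits, so a connected set in \<open>U\<close> lies in one of them. In the second
      case density of \<open>U\<close> keeps every point of \<open>?T\<close> out of
      \<open>E\<close>.\<close>
    have "?T \<inter> U \<subseteq> ?O \<or> ?T \<inter> U \<subseteq> U - ?O"
      using connectedD[OF conn open_orbit[OF x] oO'] by blast
    moreover have "\<not> ?T \<inter> U \<subseteq> ?O" using y r unfolding E_def by blast
    ultimately have disj: "?T \<inter> U \<subseteq> U - ?O" by blast
    have "?T \<subseteq> - E"
    proof
      fix y' assume y': "y' \<in> ?T"
      show "y' \<in> - E"
      proof
        assume "y' \<in> E"
        then obtain T' where T': "open T'" "y' \<in> T'" "T' \<inter> U \<subseteq> ?O" unfolding E_def by blast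
        then have "(T' \<inter> ?T) \<inter> U \<noteq> {}" using U_dense[of "T' \<inter> ?T"] r(3) y' by blast
        with T' disj show False by blast
      qed
    qed
    with r show "\<exists>T. open T \<and> y \<in> T \<and> T \<subseteq> - E" by blast
  qed
  then have "E = {} \<or> E = UNIV"
    using clopen_X oE unfolding closed_def by blast
  moreover have "x \<in> E" unfolding E_def using open_orbit[OF x] xO by blast
  ultimately have "E = UNIV" by blast
  then have "U \<subseteq> ?O" unfolding E_def by blast
  then show ?thesis using x U_\<rho> by auto
qed

lemma stabilizer:
  assumes x: "x \<in> U" shows "\<rho> z x = x \<longleftrightarrow> z \<in> \<Lambda>"
proof
  assume zx: "\<rho> z x = x"
  have "closed {y. \<rho> z y = y}"
    by (intro closed_Collect_eq continuous_on_\<rho> continuous_intros)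
  moreover have "U \<subseteq> {y. \<rho> z y = y}"
    unfolding U_eq_orbit[OF x] using zx by (auto simp: \<rho>_commute[of z])
  ultimately have "- {y. \<rho> z y = y} = {}"
    using U_dense[of "- {y. \<rho> z y = y}"] by auto
  then have "\<rho> z = id" by (auto simp: fun_eq_iff)
  then show "z \<in> \<Lambda>" by (simp add: \<rho>_id_iff)
qed (simp flip: \<rho>_id_iff)

end

section \<open>Invariant tensors\<close>

lemma map_matrix_nth [simp]: "map_matrix f A $ i $ j = f (A $ i $ j)"
  by (simp add: map_matrix_def)

lemma map_matrix_cnj_mult: "map_matrix cnj (A ** B) = map_matrix cnj A ** map_matrix cnj B"
  by (simp add: vec_eq_iff matrix_matrix_mult_def)

lemma pull_mult: "pull (A ** B) H = pull B (pull A H)"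
  by (simp add: pull_def matrix_transpose_mul map_matrix_cnj_mult matrix_mul_assoc)

lemma pull_mat_1 [simp]: "pull (mat 1) (H :: complex^'n^'n) = H"
proof -
  have "map_matrix cnj (mat 1 :: complex^'n^'n) = mat 1" by (simp add: vec_eq_iff mat_def)
  then show ?thesis by (simp add: pull_def transpose_mat)
qed

lemma pull_inverse:
  assumes "A ** B = mat 1" shows "pull B (pull A H) = H"
  by (simp add: assms flip: pull_mult)

lemma linear_pull: "linear (pull A)"
proof (rule linearI)
  show "pull A (H + H') = pull A H + pull A H'" for H H'
    by (simp add: vec_eq_iff pull_nth algebra_simps sum.distrib)
  show "pull A (r *\<^sub>R H) = r *\<^sub>R pull A H" for r H
    by (simp add: vec_eq_iff pull_nth scaleR_sum_right algebra_simps)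
qed

text \<open>Linear in \<open>v\<close> and conjugate linear in \<open>w\<close>. By
  \<open>sesq_pull\<close>, pulling back the matrix amounts to substituting into both
  arguments.\<close>

definition sesq :: "complex^'n^'n \<Rightarrow> complex^'n \<Rightarrow> complex^'n \<Rightarrow> complex" where
  "sesq H v w = (\<Sum>j\<in>UNIV. \<Sum>k\<in>UNIV. H $ j $ k * v $ j * cnj (w $ k))"

lemma sesq_pull: "sesq (pull A H) v w = sesq H (A *v v) (A *v w)"
proof -
  have "sesq (pull A H) v w = (\<Sum>j\<in>UNIV. \<Sum>k\<in>UNIV. \<Sum>b\<in>UNIV. \<Sum>a\<in>UNIV. H $ a $ b * (A $ a $ j * v $ j) * (cnj (A $ b $ k * w $ k)))"
    unfolding sesq_def pull_nth sum_distrib_right by (intro sum.cong refl) simp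
  also have "\<dots> = (\<Sum>b\<in>UNIV. \<Sum>a\<in>UNIV. \<Sum>j\<in>UNIV. \<Sum>k\<in>UNIV. H $ a $ b * (A $ a $ j * v $ j) * (cnj (A $ b $ k * w $ k)))"
  proof -
    have "(\<Sum>j\<in>UNIV. \<Sum>k\<in>UNIV. \<Sum>b\<in>UNIV. \<Sum>a\<in>UNIV. f a b j k) = (\<Sum>b\<in>UNIV. \<Sum>a\<in>UNIV. \<Sum>j\<in>UNIV. \<Sum>k\<in>UNIV. f a b j k)"
      for f :: "'n \<Rightarrow> 'n \<Rightarrow> 'n \<Rightarrow> 'n \<Rightarrow> complex"
    proof -
      have "(\<Sum>j\<in>UNIV. \<Sum>k\<in>UNIV. \<Sum>b\<in>UNIV. \<Sum>a\<in>UNIV. f a b j k)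
        = (\<Sum>j\<in>UNIV. \<Sum>b\<in>UNIV. \<Sum>k\<in>UNIV. \<Sum>a\<in>UNIV. f a b j k)"
        by (intro sum.cong refl sum.swap)
      also have "\<dots> = (\<Sum>b\<in>UNIV. \<Sum>j\<in>UNIV. \<Sum>k\<in>UNIV. \<Sum>a\<in>UNIV. f a b j k)" by (rule sum.swap)
      also have "\<dots> = (\<Sum>b\<in>UNIV. \<Sum>j\<in>UNIV. \<Sum>a\<in>UNIV. \<Sum>k\<in>UNIV. f a b j k)"
        by (intro sum.cong refl sum.swap)
      also have "\<dots> = (\<Sum>b\<in>UNIV. \<Sum>a\<in>UNIV. \<Sum>j\<in>UNIV. \<Sum>k\<in>UNIV. f a b j k)"
        by (intro sum.cong refl sum.swap)
      finally show ?thesis .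
    qed
    then show ?thesis .
  qed
  also have "\<dots> = sesq H (A *v v) (A *v w)"
    unfolding sesq_def
    by (subst sum.swap) (simp add: matrix_vector_mult_def sum_distrib_left sum_distrib_right mult_ac)
  finally show ?thesis .
qed

lemma pos_def_hermitian_iff: "pos_def_hermitian H \<longleftrightarrow> hermitian_mat H \<and> (\<forall>v. v \<noteq> 0 \<longrightarrow> 0 < Re (sesq H v v))"
  unfolding pos_def_hermitian_def sesq_def ..

lemma hermitian_pull: "hermitian_mat H \<Longrightarrow> hermitian_mat (pull A H)"
proof -
  assume h: "hermitian_mat H"
  have "pull A H $ j $ k = cnj (pull A H $ k $ j)" for j k
  proof -
    have "pull A H $ j $ k = (\<Sum>a\<in>UNIV. \<Sum>b\<in>UNIV. A $ a $ j * H $ a $ b * cnj (A $ b $ k))"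
      unfolding pull_nth by (rule sum.swap)
    also have "\<dots> = (\<Sum>a\<in>UNIV. \<Sum>b\<in>UNIV. cnj (A $ b $ k * H $ b $ a * cnj (A $ a $ j)))"
      using h unfolding hermitian_mat_def
      by (intro sum.cong refl) (metis (no_types, lifting) complex_cnj_cnj complex_cnj_mult mult.assoc mult.commute)
    finally show ?thesis unfolding pull_nth by simp
  qed
  then show ?thesis unfolding hermitian_mat_def by blast
qed

lemma pos_def_pull:
  assumes "pos_def_hermitian H" "B ** A = mat 1" shows "pos_def_hermitian (pull A H)"
  unfolding pos_def_hermitian_iff sesq_pull
proof (intro conjI allI impI)
  show "hermitian_mat (pull A H)" using assms hermitian_pull unfolding pos_def_hermitian_def by blast
  fix v :: "complex^'a" assume "v \<noteq> 0"
  then have "A *v v \<noteq> 0" using assms(2) matrix_left_invertible_ker by blast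
  then show "0 < Re (sesq H (A *v v) (A *v v))" using assms unfolding pos_def_hermitian_iff by blast
qed

lemma closed_form_on_local:
  assumes "\<And>p. p \<in> S \<Longrightarrow> \<exists>V h'. open V \<and> p \<in> V \<and> closed_form_on V h' \<and> (\<forall>q\<in>V. h q = h' q)"
  shows "closed_form_on S h"
  unfolding closed_form_on_def
proof (intro ballI allI)
  fix p j k m assume "p \<in> S"
  from assms[OF this] obtain V h' where V: "open V" "p \<in> V" "closed_form_on V h'" "\<And>q. q \<in> V \<Longrightarrow> h q = h' q"
    by metis
  have "dz m (\<lambda>q. h q $ j $ k) p = dz m (\<lambda>q. h' q $ j $ k) p" "dzbar m (\<lambda>q. h q $ j $ k) p = dzbar m (\<lambda>q. h' q $ j $ k) p" for m j k
    by (rule dz_cong[OF V(1,2)], simp add: V(4))+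
  then show "dz m (\<lambda>q. h q $ j $ k) p = dz j (\<lambda>q. h q $ m $ k) p \<and>
        dzbar m (\<lambda>q. h q $ j $ k) p = dzbar k (\<lambda>q. h q $ j $ m) p"
    using V(2,3) unfolding closed_form_on_def by simp
qed

section \<open>Invariant metrics as constant matrices\<close>

context semi_torus_action begin

text \<open>In the coordinates that an orbit map induces on \<open>U\<close> the tensor has the
  constant matrix \<open>H\<close>. Writing this with \<open>fmat\<close> avoids the choice of a
  base point. The coordinates are the original ones of the covering space, before the change by
  \<open>C\<close>.\<close>

definition has_coeff :: "('a, 'n) herm_tensor \<Rightarrow> complex^'n^'n \<Rightarrow> bool" where
  "has_coeff g H \<longleftrightarrow> (\<forall>a\<in>\<A>. \<forall>x\<in>cdom a \<inter> U. g a x = pull (matrix_inv (fmat a x)) H)"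

lemma U_fmat:
  assumes "a \<in> \<A>" "x \<in> cdom a \<inter> U"
  shows "fmat a x ** matrix_inv (fmat a x) = mat 1" "matrix_inv (fmat a x) ** fmat a x = mat 1"
  using matrix_inv_det U_iff[of a x] assms by auto

lemma has_coeffD:
  assumes "has_coeff g H" "a \<in> \<A>" "x \<in> cdom a \<inter> U" shows "pull (fmat a x) (g a x) = H"
  using assms pull_inverse[OF U_fmat(2)[OF assms(2,3)]] unfolding has_coeff_def by simp

lemma has_coeff_unique:
  assumes "has_coeff g H" "has_coeff g H'" shows "H = H'"
proof -
  obtain x where x: "x \<in> U" using U_nonempty by blast
  obtain a where "a \<in> \<A>" "x \<in> cdom a" by (rule chart_ex)
  with has_coeffD[OF assms(1)] has_coeffD[OF assms(2)] x show ?thesis by (metis IntI)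
qed

lemma has_coeff_lincomb:
  assumes "\<And>t. t \<in> T \<Longrightarrow> has_coeff (g t) (H t)"
  shows "has_coeff (\<lambda>a x. \<Sum>t\<in>T. u t *\<^sub>R g t a x) (\<Sum>t\<in>T. u t *\<^sub>R H t)"
  using assms unfolding has_coeff_def
  by (simp add: linear_sum[OF linear_pull] linear_scale[OF linear_pull])

lemma \<rho>_0_eq_id: "\<rho> 0 = id" by (simp add: fun_eq_iff)

text \<open>\<open>H\<close> is the matrix at one point of \<open>U\<close>, read in orbit
  coordinates. Since \<open>U\<close> is a single orbit, invariance carries it to every other point,
  and \<open>fmat_transform\<close> shows that it arrives unchanged.\<close>

lemma invariant_metric_coeff:
  assumes "g \<in> invariant_metrics \<A> G (D_supp \<A> \<rho>)"
  obtains H where "has_coeff g H" "pos_def_hermitian H"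
proof -
  have k: "kaehler_metric \<A> U g" and p: "preserves_tensor \<A> U (\<rho> z) g" for z
    using assms unfolding invariant_metrics_def U_def G_eq by auto
  obtain x where x: "x \<in> U" using U_nonempty by blast
  obtain a where a: "a \<in> \<A>" "x \<in> cdom a" by (rule chart_ex)
  let ?H = "pull (fmat a x) (g a x)"
  have "has_coeff g ?H"
    unfolding has_coeff_def
  proof (intro ballI)
    fix b y assume b: "b \<in> \<A>" and y: "y \<in> cdom b \<inter> U"
    then obtain z where z: "y = \<rho> z x" using U_eq_orbit[OF x] by blast
    have zb: "\<rho> z x \<in> cdom b" using y z by simp
    have "g a x = pull (jacobian (cmap b \<circ> \<rho> z \<circ> cinv a) (at (cmap a x))) (g b y)"
      using p[of z] a b x zb z unfolding preserves_tensor_def by blast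
    then have "?H = pull (fmat b y) (g b y)"
      using fmat_transform[OF a(1) b a(2) zb] z by (simp add: pull_mult)
    then show "g b y = pull (matrix_inv (fmat b y)) ?H"
      using pull_inverse[OF U_fmat(1)[OF b y]] by simp
  qed
  moreover have "pos_def_hermitian (g a x)" using k a x unfolding kaehler_metric_def by blast
  then have "pos_def_hermitian ?H"
    using a x by (intro pos_def_pull[OF _ U_fmat(2)]) auto
  ultimately show ?thesis by (rule that)
qed

text \<open>The default 0 is the one that \<open>kaehler_metric\<close> prescribes for the
  irrelevant arguments.\<close>

definition const_metric :: "complex^'n^'n \<Rightarrow> ('a, 'n) herm_tensor" where
  "const_metric H a x = (if a \<in> \<A> \<and> x \<in> cdom a \<inter> U then pull (matrix_inv (fmat a x)) H else 0)"

lemma const_metric_coeff: "has_coeff (const_metric H) H"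
  unfolding has_coeff_def const_metric_def by simp

lemma const_metric_local:
  assumes a: "a \<in> \<A>" "x \<in> cdom a \<inter> U"
  obtains V \<sigma> where "open V" "cmap a x \<in> V" "V \<subseteq> cmap a ` (cdom a \<inter> U)" "holo_on V \<sigma>"
    "\<And>p. p \<in> V \<Longrightarrow> \<rho> (\<sigma> p) x = cinv a p"
    "\<And>p. p \<in> V \<Longrightarrow> jacobian \<sigma> (at p) = matrix_inv (fmat a (cinv a p))"
proof -
  obtain V \<sigma> where V: "open V" "cmap a x \<in> V" "V \<subseteq> cmap a ` cdom a" "holo_on V \<sigma>"
    "\<And>p. p \<in> V \<Longrightarrow> \<rho> (\<sigma> p) x = cinv a p"
    "\<And>p. p \<in> V \<Longrightarrow> jacobian \<sigma> (at p) = matrix_inv (fmat a (cinv a p))"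
    using local_inverse[of a x] a by blast
  have "V \<subseteq> cmap a ` (cdom a \<inter> U)"
  proof
    fix p assume p: "p \<in> V"
    then have "cinv a p \<in> U" using V(5)[OF p] a U_\<rho> by (metis IntD2)
    moreover have "cinv a p \<in> cdom a" "cmap a (cinv a p) = p"
      using cinv_in[OF subsetD[OF V(3) p]] cmap_cinv[OF a(1) subsetD[OF V(3) p]] by auto
    ultimately show "p \<in> cmap a ` (cdom a \<inter> U)" by (metis IntI imageI)
  qed
  from that[OF V(1,2) this V(4-6)] show ?thesis .
qed

lemma cinv_in_U: 
  assumes "a \<in> \<A>" "p \<in> cmap a ` (cdom a \<inter> U)" shows "cinv a p \<in> cdom a \<inter> U"
  using assms cinv_cmap[OF assms(1)] by auto

lemma const_metric_invariant:
  assumes H: "pos_def_hermitian H"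
  shows "const_metric H \<in> invariant_metrics \<A> G (D_supp \<A> \<rho>)"
proof -
  let ?g = "const_metric H"
  have pres: "preserves_tensor \<A> U (\<rho> z) ?g" for z
    unfolding preserves_tensor_def
  proof (intro ballI impI, elim conjE)
    fix a b x assume a: "a \<in> \<A>" "x \<in> cdom a" and b: "b \<in> \<A>" "\<rho> z x \<in> cdom b" and x: "x \<in> U"
    let ?J = "jacobian (cmap b \<circ> \<rho> z \<circ> cinv a) (at (cmap a x))"
    have bU: "\<rho> z x \<in> cdom b \<inter> U" using b x U_\<rho> by simp
    \<comment> \<open>This exhibits a second left inverse of \<open>fmat a x\<close>, necessarily
      equal to \<open>matrix_inv (fmat a x)\<close>; the equality of the two is the transformation
      rule for the tensor.\<close>
    have "(matrix_inv (fmat b (\<rho> z x)) ** ?J) ** fmat a x = mat 1"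
      using U_fmat(2)[OF b(1) bU] fmat_transform[OF a(1) b(1) a(2) b(2)] by (simp add: matrix_mul_assoc)
    then have "matrix_inv (fmat b (\<rho> z x)) ** ?J = matrix_inv (fmat a x)"
      using U_fmat(1)[OF a(1), of x] a x by (metis IntI matrix_mul_assoc matrix_mul_lid matrix_mul_rid)
    then show "?g a x = pull ?J (?g b (\<rho> z x))"
      using a b bU x by (simp add: const_metric_def flip: pull_mult)
  qed
  have loc: "\<exists>V h'. open V \<and> p \<in> V \<and> closed_form_on V h' \<and> smooth_on V h' \<and> (\<forall>q\<in>V. ?g a (cinv a q) = h' q)"
    if a: "a \<in> \<A>" and p: "p \<in> cmap a ` (cdom a \<inter> U)" for a p
  proof -
    obtain x where x: "p = cmap a x" "x \<in> cdom a \<inter> U" using p by blast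
    obtain V \<sigma> where V: "open V" "cmap a x \<in> V" "V \<subseteq> cmap a ` (cdom a \<inter> U)" "holo_on V \<sigma>"
      "\<And>p. p \<in> V \<Longrightarrow> \<rho> (\<sigma> p) x = cinv a p"
      "\<And>p. p \<in> V \<Longrightarrow> jacobian \<sigma> (at p) = matrix_inv (fmat a (cinv a p))"
      using const_metric_local[OF a x(2)] by metis
    have "?g a (cinv a q) = pull (jacobian \<sigma> (at q)) H" if "q \<in> V" for q
    proof -
      have "cinv a q \<in> cdom a \<inter> U" using cinv_in_U[OF a] V(3) that by blast
      then show ?thesis using a by (simp add: const_metric_def V(6)[OF that])
    qed
    then show ?thesis
      using V(1,2) x(1) pull_jacobian_closed[OF V(1,4)] pull_jacobian_smooth[OF V(1,4)] by blast
  qed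
  have pos: "pos_def_hermitian (?g a x)" if "a \<in> \<A>" "x \<in> cdom a \<inter> U" for a x
    using that pos_def_pull[OF H U_fmat(1)[OF that]] by (simp add: const_metric_def)
  have closed: "closed_form_on (cmap a ` (cdom a \<inter> U)) (\<lambda>p. ?g a (cinv a p))" if a: "a \<in> \<A>" for a
    by (rule closed_form_on_local) (use loc[OF a] in blast)
  have smooth: "smooth_on (cmap a ` (cdom a \<inter> U)) (\<lambda>p. ?g a (cinv a p))" if a: "a \<in> \<A>" for a
    unfolding smooth_on_def
  proof
    fix r show "Cr_on r (cmap a ` (cdom a \<inter> U)) (\<lambda>p. ?g a (cinv a p))"
    proof (rule Cr_on_local)
      fix p assume "p \<in> cmap a ` (cdom a \<inter> U)"
      from loc[OF a this] obtain V h' where V: "open V" "p \<in> V" "smooth_on V h'" "\<And>q. q \<in> V \<Longrightarrow> ?g a (cinv a q) = h' q"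
        by metis
      have "Cr_on r V (\<lambda>p. ?g a (cinv a p))"
        by (rule Cr_on_cong[OF V(1), of h']) (use V(3,4) in \<open>auto simp: smooth_on_def\<close>)
      with V show "\<exists>U. open U \<and> p \<in> U \<and> Cr_on r U (\<lambda>p. ?g a (cinv a p))" by blast
    qed
  qed
  have "kaehler_metric \<A> U ?g"
    unfolding kaehler_metric_def
    using pres[of 0] pos closed smooth unfolding \<rho>_0_eq_id by (auto simp: const_metric_def)
  then show ?thesis
    unfolding invariant_metrics_def G_eq U_def[symmetric] using pres by auto
qed

text \<open>With new coordinates w = C z the orbit map is precomposed with
  \<open>matrix_inv C\<close>, so the constant matrix is pulled back by
  \<open>matrix_inv C\<close>.\<close>

lemma const_coeff:
  assumes g: "has_coeff g H" and x0: "x0 \<in> U"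
  shows "const_coeff_matrix \<A> \<rho> C x0 g (pull (matrix_inv C) H)"
  unfolding const_coeff_matrix_def Let_def
proof (intro allI ballI impI)
  fix w a assume a: "a \<in> \<A>" and w: "\<rho> (matrix_inv C *v w) x0 \<in> cdom a"
  let ?x = "\<rho> (matrix_inv C *v w) x0"
  have "((\<lambda>w. matrix_inv C *v w) has_derivative (\<lambda>v. matrix_inv C *v v)) (at w)"
    by (rule bounded_linear_imp_has_derivative[OF matrix_vector_mul_bounded_linear])
  from has_derivative_compose[OF this orbit_derivative[OF a w]]
  have "jacobian (\<lambda>w'. cmap a (\<rho> (matrix_inv C *v w') x0)) (at w) = fmat a ?x ** matrix_inv C"
    by (intro jacobian_eqI) (simp add: matrix_vector_mul_assoc)
  then show "pull (matrix_inv C) H = pull (jacobian (\<lambda>w'. cmap a (\<rho> (matrix_inv C *v w') x0)) (at w)) (g a ?x)"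
    using has_coeffD[OF g a, of ?x] w x0 U_\<rho> by (simp add: pull_mult)
qed

end

section \<open>Exact invariant forms\<close>

lemma levi_form_compose_holo':
  fixes F :: "complex^'n \<Rightarrow> complex^'n"
  assumes S: "open S" and F: "holo_on S F" "p \<in> S" and T: "open T" "F ` S \<subseteq> T" and u: "Cr_on 2 T u"
    and f: "\<And>x. x \<in> S \<Longrightarrow> f x = u (F x)"
  shows "(\<chi> j k. dz j (dzbar k f) p) = pull (jacobian F (at p)) (\<chi> a b. dz a (dzbar b u) (F p))"
proof -
  have "dzbar k f q = dzbar k (\<lambda>x. u (F x)) q" if "q \<in> S" for k q
    by (rule dz_cong(2)[OF S that f])
  then have "dz j (dzbar k f) p = dz j (dzbar k (\<lambda>x. u (F x))) p" for j k
    by (rule dz_cong(1)[OF S F(2)])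
  then show ?thesis using levi_form_compose_holo[OF S F T u] by simp
qed

text \<open>The mixed derivative of the product of Im(w_a) and Im(w_b) contributes 1/4 at the
  position (a, b) and 1/4 at (b, a). For symmetric real \<open>K\<close> the double sum thus gives
  half of \<open>K\<close>, which the factor 2 makes up for.\<close>

definition im_form :: "complex^'n^'n \<Rightarrow> complex^'n \<Rightarrow> real" where
  "im_form K w = (\<Sum>a\<in>UNIV. \<Sum>b\<in>UNIV. 2 * Re (K $ a $ b) * Im (w $ a) * Im (w $ b))"

lemma bounded_linear_Im_nth: "bounded_linear (\<lambda>w :: complex^'n. Im (w $ a))"
  by (rule bounded_linear_compose[OF bounded_linear_Im bounded_linear_vec_nth])

lemma Cr_on_im_form: 
  assumes "open S" shows "Cr_on r S (im_form K)"
proof -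
  have "Cr_on r S (\<lambda>w. \<Sum>a\<in>UNIV. \<Sum>b\<in>UNIV. 2 * Re (K $ a $ b) * Im (w $ a) * Im (w $ b))"
    by (intro Cr_on_sum Cr_on_mult Cr_on_const assms finite Cr_on_linear[OF bounded_linear_Im_nth])
  then show ?thesis by (simp add: im_form_def[abs_def])
qed

lemma dz_Im_nth:
  "dz j (\<lambda>w. complex_of_real (Im (w $ a))) p = (if j = a then - \<i> / 2 else 0)"
  "dzbar j (\<lambda>w. complex_of_real (Im (w $ a))) p = (if j = a then \<i> / 2 else 0)"
  "(\<lambda>w. complex_of_real (Im (w $ a))) differentiable (at p)"
proof -
  have D: "((\<lambda>w. complex_of_real (Im (w $ a))) has_derivative (\<lambda>w. complex_of_real (Im (w $ a)))) (at p)"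
    by (rule bounded_linear_imp_has_derivative[OF bounded_linear_compose[OF bounded_linear_of_real bounded_linear_Im_nth]])
  show "dz j (\<lambda>w. complex_of_real (Im (w $ a))) p = (if j = a then - \<i> / 2 else 0)"
    "dzbar j (\<lambda>w. complex_of_real (Im (w $ a))) p = (if j = a then \<i> / 2 else 0)"
    unfolding dz_def dzbar_def fder_eqI[OF D] by (auto simp: axis_def)
  show "(\<lambda>w. complex_of_real (Im (w $ a))) differentiable (at p)" using D by (rule differentiableI)
qed

lemma dz_add:
  assumes "f differentiable (at p)" "g differentiable (at p)"
  shows "dz j (\<lambda>q. f q + g q) p = dz j f p + dz j g p"
  using fder_eqI[OF has_derivative_add[OF assms[THEN differentiable_has_fder]]]
  by (simp add: dz_def field_simps)

lemma levi_im_form: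
  fixes K :: "complex^'n^'n"
  assumes sym: "\<And>a b. K $ a $ b = K $ b $ a" and real: "\<And>a b. Im (K $ a $ b) = 0"
  shows "(\<chi> j k. dz j (dzbar k (\<lambda>w. complex_of_real (im_form K w))) p) = K"
proof -
  let ?f = "\<lambda>a w. complex_of_real (Im (w $ a))"
  have R: "complex_of_real (Re (K $ a $ b)) = K $ a $ b" for a b using real by (simp add: complex_eq_iff)
  have eq: "(\<lambda>w. complex_of_real (im_form K w)) = (\<lambda>w. \<Sum>a\<in>UNIV. \<Sum>b\<in>UNIV. (2 * K $ a $ b) * (?f a w * ?f b w))"
    by (simp add: fun_eq_iff im_form_def R mult_ac)
  note d = dz_Im_nth(3)
  define e where "e j a = (if j = a then \<i> / 2 else 0)" for j a :: 'n
  have dI: "dz j (?f a) q = - e j a" "dzbar j (?f a) q = e j a" for j a q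
    unfolding e_def by (simp_all add: dz_Im_nth(1,2))
  have dff: "(\<lambda>w. ?f a w * ?f b w) differentiable (at q)" for a b q by (intro differentiable_mult d)
  have cmul: "dz j (\<lambda>w. c * g w) q = c * dz j g q" "dzbar j (\<lambda>w. c * g w) q = c * dzbar j g q"
    if "g differentiable (at q)" for c j g and q :: "complex^'n"
    using dz_mult[OF differentiable_const[of c] that] by (auto simp: dz_def[of _ "\<lambda>_. c"] dzbar_def[of _ "\<lambda>_. c"] frechet_derivative_const)
  have 1: "dzbar k (\<lambda>w. complex_of_real (im_form K w)) = (\<lambda>q. \<Sum>a\<in>UNIV. \<Sum>b\<in>UNIV. (2 * K $ a $ b) *
      (e k a * ?f b q + e k b * ?f a q))" for k
    unfolding eq
    by (simp add: fun_eq_iff dz_sum(2) differentiable_sum differentiable_mult d cmul(2)[OF dff] dz_mult(2)[OF d d] dI mult.commute)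
  have dl: "(\<lambda>q. c * ?f b q + c' * ?f a q) differentiable (at p)" for a b c c'
    by (intro differentiable_add differentiable_mult d differentiable_const)
  have dl': "dz j (\<lambda>q. c * ?f b q + c' * ?f a q) p = c * dz j (?f b) p + c' * dz j (?f a) p" for a b c c' j
  proof -
    have "dz j (\<lambda>q. c * ?f b q + c' * ?f a q) p = dz j (\<lambda>q. c * ?f b q) p + dz j (\<lambda>q. c' * ?f a q) p"
      by (intro dz_add differentiable_mult differentiable_const d)
    then show ?thesis by (simp add: cmul(1)[OF d])
  qed
  have "dz j (dzbar k (\<lambda>w. complex_of_real (im_form K w))) p = (\<Sum>a\<in>UNIV. \<Sum>b\<in>UNIV. (2 * K $ a $ b) *
      (e k a * (- e j b) + e k b * (- e j a)))" for j k
    unfolding 1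
    by (simp add: dz_sum(1) differentiable_sum differentiable_mult dl cmul(1)[OF dl] dl' dI)
  also have "\<dots> j k = (\<Sum>a\<in>UNIV. \<Sum>b\<in>UNIV. (if k = a then if j = b then K $ a $ b / 2 else 0 else 0) +
        (if j = a then if k = b then K $ a $ b / 2 else 0 else 0))" for j k
    by (intro sum.cong refl) (auto simp: e_def complex_eq_iff)
  also have "\<dots> j k = K $ k $ j / 2 + K $ j $ k / 2" for j k
  proof -
    have "(\<Sum>a\<in>UNIV. \<Sum>b\<in>UNIV. if k = a then if j = b then K $ a $ b / 2 else 0 else 0) = K $ k $ j / 2" for j k
    proof -
      have "(\<Sum>a\<in>UNIV. \<Sum>b\<in>UNIV. if k = a then if j = b then K $ a $ b / 2 else 0 else 0)
        = (\<Sum>a\<in>UNIV. if k = a then K $ k $ j / 2 else 0)"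
        by (intro sum.cong refl) auto
      then show ?thesis by simp
    qed
    then show ?thesis by (simp only: sum.distrib)
  qed
  finally have "dz j (dzbar k (\<lambda>w. complex_of_real (im_form K w))) p = K $ j $ k" for j k
    using sym by simp
  then show ?thesis by (simp add: vec_eq_iff)
qed

section \<open>Testing membership in the real block\<close>

lemma sesq_axis: "sesq H (axis j c) (axis k d) = H $ j $ k * c * cnj d"
proof -
  have "sesq H (axis j c) (axis k d) = (\<Sum>a\<in>UNIV. \<Sum>b\<in>UNIV. if j = a then if k = b then H $ a $ b * c * cnj d else 0 else 0)"
    unfolding sesq_def by (intro sum.cong refl) (auto simp: axis_def)
  also have "\<dots> = (\<Sum>a\<in>UNIV. if j = a then H $ j $ k * c * cnj d else 0)"
    by (intro sum.cong refl) auto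
  finally show ?thesis by simp
qed

lemma linear_Im_sesq_left: "linear (\<lambda>v. Im (sesq H v w))"
  by (rule linearI) (simp_all add: sesq_def algebra_simps sum.distrib sum_distrib_left)

lemma linear_Im_sesq_right: "linear (\<lambda>w. Im (sesq H v w))"
  by (rule linearI) (simp_all add: sesq_def algebra_simps sum.distrib sum_distrib_left)

lemma real_block_iff:
  "K \<in> real_block L \<longleftrightarrow> (\<forall>j k. Im (K $ j $ k) = 0 \<and> (\<not> (j \<in> L \<and> k \<in> L) \<longrightarrow> K $ j $ k = 0))"
proof
  assume "K \<in> real_block L"
  then show "\<forall>j k. Im (K $ j $ k) = 0 \<and> (\<not> (j \<in> L \<and> k \<in> L) \<longrightarrow> K $ j $ k = 0)"
    unfolding real_block_def block_embed_def by (auto simp: complex_is_Real_iff)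
next
  assume *: "\<forall>j k. Im (K $ j $ k) = 0 \<and> (\<not> (j \<in> L \<and> k \<in> L) \<longrightarrow> K $ j $ k = 0)"
  then have "K = block_embed L (\<lambda>j k. K $ j $ k)" unfolding block_embed_def by (auto simp: vec_eq_iff)
  with * show "K \<in> real_block L" unfolding real_block_def by (auto simp: complex_is_Real_iff)
qed

text \<open>The space contains all unit vectors, and their multiples by \<open>\<i>\<close> for
  indices outside \<open>L\<close>. A pair of unit vectors tests the imaginary part of an entry;
  multiplying one of the two by \<open>\<i>\<close> tests the real part.\<close>

lemma real_block_if_Im_sesq_zero:
  assumes "\<And>v w. v \<in> split_real_span L \<Longrightarrow> w \<in> split_real_span L \<Longrightarrow> Im (sesq K v w) = 0"
  shows "K \<in> real_block L"
  unfolding real_block_iff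
proof (intro allI conjI impI)
  fix j k
  have 1: "axis j 1 \<in> split_real_span L" for j unfolding split_real_span_def by (auto simp: axis_def)
  have 2: "axis j \<i> \<in> split_real_span L" if "j \<notin> L" for j
    unfolding split_real_span_def using that by (auto simp: axis_def)
  show im: "Im (K $ j $ k) = 0" using assms[OF 1 1, of j k] by (simp add: sesq_axis)
  assume "\<not> (j \<in> L \<and> k \<in> L)"
  then have "Re (K $ j $ k) = 0"
    using assms[OF 2 1, of j k] assms[OF 1 2, of k j] by (auto simp: sesq_axis)
  with im show "K $ j $ k = 0" by (simp add: complex_eq_iff)
qed

section \<open>Potentials of invariant forms\<close>

context semi_torus_action begin

text \<open>The potential is lifted by the orbit map to a function \<open>\<psi>\<close> on the
  whole covering space. Naturality turns its Levi form into the constant \<open>H\<close>, and the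
  elements of \<open>\<Lambda>\<close>, which fix \<open>x0\<close>, are periods of
  \<open>\<psi>\<close>.\<close>

lemma ddbar_exact_periods:
  assumes h: "has_coeff h H" and ex: "ddbar_exact \<A> U h" and ab: "a \<in> \<Lambda>" "b \<in> \<Lambda>"
  shows "Im (sesq H a b) = 0"
proof -
  obtain \<phi> :: "'a \<Rightarrow> real" where \<phi>: "\<And>a. a \<in> \<A> \<Longrightarrow> smooth_on (cmap a ` (cdom a \<inter> U)) (\<lambda>p. \<phi> (cinv a p))"
    "\<And>a x. a \<in> \<A> \<Longrightarrow> x \<in> cdom a \<inter> U \<Longrightarrow>
       h a x = (\<chi> j k. dz j (dzbar k (\<lambda>p. complex_of_real (\<phi> (cinv a p)))) (cmap a x))"
    using ex unfolding ddbar_exact_def by blast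
  obtain x0 where x0: "x0 \<in> U" using U_nonempty by blast
  define \<psi> where "\<psi> z = \<phi> (\<rho> z x0)" for z
  have loc: "(\<exists>V. open V \<and> z \<in> V \<and> Cr_on 2 V \<psi>) \<and> (\<chi> j k. dz j (dzbar k (\<lambda>z. complex_of_real (\<psi> z))) z) = H" for z
  proof -
    obtain a where a: "a \<in> \<A>" "\<rho> z x0 \<in> cdom a" by (rule chart_ex)
    let ?N = "{z. \<rho> z x0 \<in> cdom a}" and ?F = "\<lambda>z. cmap a (\<rho> z x0)" and ?T = "cmap a ` (cdom a \<inter> U)"
    have N: "open ?N" "z \<in> ?N" using open_orbit_vimage[OF a(1)] a(2) by auto
    have T: "open ?T" by (rule open_cmap_image[OF a(1) open_U])
    have FT: "?F ` ?N \<subseteq> ?T" using x0 U_\<rho> by auto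
    have sm: "Cr_on 2 ?T (\<lambda>p. \<phi> (cinv a p))" using \<phi>(1)[OF a(1)] unfolding smooth_on_def by blast
    have e: "\<psi> z = \<phi> (cinv a (?F z))" if "z \<in> ?N" for z using cinv_cmap[OF a(1)] that by (simp add: \<psi>_def)
    have "Cr_on 2 ?N (\<lambda>z. \<phi> (cinv a (?F z)))"
      by (rule Cr_on_compose[OF holo_on_smooth[OF N(1) orbit_holo[OF a(1)]] N(1) FT sm])
    then have "Cr_on 2 ?N \<psi>" by (rule Cr_on_cong[OF N(1), rotated]) (use e in auto)
    moreover have "(\<chi> j k. dz j (dzbar k (\<lambda>z. complex_of_real (\<psi> z))) z)
        = pull (jacobian ?F (at z)) (\<chi> j k. dz j (dzbar k (\<lambda>p. complex_of_real (\<phi> (cinv a p)))) (?F z))"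
      by (rule levi_form_compose_holo'[OF N(1) orbit_holo[OF a(1)] N(2) T FT])
        (auto intro: bounded_linear.Cr_on[OF bounded_linear_of_real sm T] simp: e)
    moreover have "\<rho> z x0 \<in> cdom a \<inter> U" using a(2) x0 U_\<rho> by simp
    ultimately show ?thesis
      using N has_coeffD[OF h a(1)] \<phi>(2)[OF a(1)] orbit_jacobian[OF a(1)] by auto
  qed
  have "Im (\<Sum>j\<in>UNIV. \<Sum>k\<in>UNIV. H $ j $ k * a $ j * cnj (b $ k)) = 0"
  proof (rule periods_constant_levi_form)
    show "Cr_on 2 UNIV \<psi>" by (rule Cr_on_local) (use loc in blast)
    have "\<rho> a x0 = x0" "\<rho> b x0 = x0" using ab stabilizer[OF x0] by auto
    then show "\<psi> (p + a) = \<psi> p" "\<psi> (p + b) = \<psi> p" for p by (simp_all add: \<psi>_def \<rho>_add)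
    show "dz j (dzbar k (\<lambda>z. complex_of_real (\<psi> z))) p = H $ j $ k" for p j k
      using loc[of p] by (auto simp: vec_eq_iff)
  qed
  then show ?thesis by (simp add: sesq_def)
qed

lemma ddbar_exact_imp_real_block:
  assumes h: "has_coeff h H" and ex: "ddbar_exact \<A> U h"
    and C: "invertible C" "(\<lambda>z. C *v z) ` span \<Lambda> = split_real_span L"
  shows "pull (matrix_inv C) H \<in> real_block L"
proof (rule real_block_if_Im_sesq_zero)
  have sp: "Im (sesq H a b) = 0" if "a \<in> span \<Lambda>" "b \<in> span \<Lambda>" for a b
  proof -
    have "Im (sesq H a b) = 0" if a: "a \<in> span \<Lambda>" and b: "b \<in> \<Lambda>" for a b
      by (rule linear_eq_on_span[OF linear_Im_sesq_left _ _ a, of "\<lambda>_. 0"])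
        (use ddbar_exact_periods[OF h ex _ b] linear_zero in auto)
    then show ?thesis
      by (intro linear_eq_on_span[OF linear_Im_sesq_right _ _ that(2), of "\<lambda>_. 0"])
        (use that(1) linear_zero in auto)
  qed
  fix v w assume "v \<in> split_real_span L" "w \<in> split_real_span L"
  then obtain a b where ab: "a \<in> span \<Lambda>" "b \<in> span \<Lambda>" "v = C *v a" "w = C *v b" using C(2) by blast
  then show "Im (sesq (pull (matrix_inv C) H) v w) = 0"
    using sp[OF ab(1,2)] by (simp add: sesq_pull matrix_vector_mul_assoc invertible_matrix_inv[OF C(1)])
qed

text \<open>For \<open>K\<close> in the block the form involves only imaginary parts of coordinates
  with index in \<open>L\<close>, and these vanish for \<open>w\<close>. This makes
  \<open>im_form\<close> descend to the orbit.\<close>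

lemma im_form_periodic:
  assumes K: "K \<in> real_block L" and w: "w \<in> split_real_span L"
  shows "im_form K (v + w) = im_form K v"
  unfolding im_form_def
proof (intro sum.cong refl)
  fix a b
  show "2 * Re (K $ a $ b) * Im ((v + w) $ a) * Im ((v + w) $ b) = 2 * Re (K $ a $ b) * Im (v $ a) * Im (v $ b)"
  proof (cases "a \<in> L \<and> b \<in> L")
    case True
    then have "Im (w $ a) = 0" "Im (w $ b) = 0"
      using w unfolding split_real_span_def by (auto simp: complex_is_Real_iff)
    then show ?thesis by simp
  next
    case False
    then have "K $ a $ b = 0" using K unfolding real_block_iff by blast
    then show ?thesis by simp
  qed
qed

lemma real_block_imp_ddbar_exact:
  assumes h: "has_coeff h H" and H: "hermitian_mat H"
    and C: "invertible C" "(\<lambda>z. C *v z) ` span \<Lambda> = split_real_span L"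
    and K: "pull (matrix_inv C) H \<in> real_block L"
  shows "ddbar_exact \<A> U h"
proof -
  let ?K = "pull (matrix_inv C) H"
  have HK: "pull C ?K = H" by (rule pull_inverse[OF invertible_matrix_inv(2)[OF C(1)]])
  have Kr: "Im (?K $ a $ b) = 0" for a b using K unfolding real_block_iff by blast
  \<comment> \<open>A hermitian matrix with real entries is symmetric, as
    \<open>levi_im_form\<close> requires.\<close>
  have Ks: "?K $ a $ b = ?K $ b $ a" for a b
    using hermitian_pull[OF H, of "matrix_inv C"] Kr[of b a] unfolding hermitian_mat_def
    by (metis complex_cnj_cancel_iff complex_is_Real_iff Reals_cnj_iff)
  obtain x0 where x0: "x0 \<in> U" using U_nonempty by blast
  \<comment> \<open>Any preimage under the orbit map will do: two of them differ by an element of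
    \<open>\<Lambda>\<close>, which \<open>C\<close> sends into
    \<open>split_real_span L\<close>.\<close>
  define \<phi> where "\<phi> x = im_form ?K (C *v (SOME z. \<rho> z x0 = x))" for x
  have \<phi>: "\<phi> (\<rho> z x0) = im_form ?K (C *v z)" for z
  proof -
    define y where "y = (SOME y. \<rho> y x0 = \<rho> z x0)"
    have "\<rho> y x0 = \<rho> z x0" unfolding y_def by (rule someI) simp
    then have "\<rho> (- z + y) x0 = x0" unfolding \<rho>_add by simp
    then have "- z + y \<in> \<Lambda>" using stabilizer[OF x0] by blast
    then have "C *v (- z + y) \<in> split_real_span L" using C(2) span_base by blast
    from im_form_periodic[OF K this, of "C *v z"]
    have "im_form ?K (C *v y) = im_form ?K (C *v z)"
      by (simp flip: matrix_vector_right_distrib)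
    then show ?thesis unfolding \<phi>_def y_def .
  qed
  have loc: "\<exists>V. open V \<and> p \<in> V \<and> (\<forall>r. Cr_on r V (\<lambda>p. \<phi> (cinv a p))) \<and>
       (\<chi> j k. dz j (dzbar k (\<lambda>p. complex_of_real (\<phi> (cinv a p)))) p) = h a (cinv a p)"
    if a: "a \<in> \<A>" and p: "p \<in> cmap a ` (cdom a \<inter> U)" for a p
  proof -
    obtain x where x: "p = cmap a x" "x \<in> cdom a \<inter> U" using p by blast
    obtain V \<sigma> where V: "open V" "cmap a x \<in> V" "V \<subseteq> cmap a ` (cdom a \<inter> U)" "holo_on V \<sigma>"
      "\<And>p. p \<in> V \<Longrightarrow> \<rho> (\<sigma> p) x = cinv a p"
      "\<And>p. p \<in> V \<Longrightarrow> jacobian \<sigma> (at p) = matrix_inv (fmat a (cinv a p))"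
      using const_metric_local[OF a x(2)] by metis
    obtain z where z: "x = \<rho> z x0" using x(2) U_eq_orbit[OF x0] by blast
    \<comment> \<open>\<open>\<sigma>\<close> inverts the orbit map of \<open>x\<close>; adding
      \<open>z\<close> refers it to the base point \<open>x0\<close>. On \<open>V\<close> the
      potential is then \<open>im_form\<close> composed with a holomorphic map.\<close>
    let ?F = "\<lambda>q. C *v (\<sigma> q + z)"
    have e: "\<phi> (cinv a q) = im_form ?K (?F q)" if "q \<in> V" for q
      using V(5)[OF that] \<phi>[of "\<sigma> q + z"] by (simp add: z \<rho>_add)
    have dF: "(?F has_derivative (\<lambda>v. (C ** jacobian \<sigma> (at q)) *v v)) (at q)" if "q \<in> V" for q
    proof -
      have "((\<lambda>q. \<sigma> q + z) has_derivative (\<lambda>v. jacobian \<sigma> (at q) *v v)) (at q)"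
        using has_derivative_add[OF holo_on_has_jacobian[OF V(4) that] has_derivative_const[of z]] by simp
      from bounded_linear.has_derivative[OF matrix_vector_mul_bounded_linear this]
      show ?thesis by (simp add: matrix_vector_mul_assoc)
    qed
    have hF: "holo_on V ?F" unfolding holo_on_def using dF by blast
    have "Cr_on r V (\<lambda>p. \<phi> (cinv a p))" for r
      by (rule Cr_on_cong[OF V(1) _ Cr_on_compose[OF holo_on_smooth[OF V(1) hF] V(1) subset_UNIV Cr_on_im_form[OF open_UNIV]]])
        (use e in auto)
    moreover have "(\<chi> j k. dz j (dzbar k (\<lambda>p. complex_of_real (\<phi> (cinv a p)))) p)
        = pull (jacobian ?F (at p)) (\<chi> j k. dz j (dzbar k (\<lambda>w. complex_of_real (im_form ?K w))) (?F p))"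
      by (rule levi_form_compose_holo'[OF V(1) hF V(2)[folded x(1)] open_UNIV subset_UNIV])
        (auto intro: bounded_linear.Cr_on[OF bounded_linear_of_real Cr_on_im_form] simp: e)
    then have "(\<chi> j k. dz j (dzbar k (\<lambda>p. complex_of_real (\<phi> (cinv a p)))) p) = pull (matrix_inv (fmat a (cinv a p))) H"
      using V(2) x(1) unfolding levi_im_form[OF Ks Kr]
      by (simp add: jacobian_eqI[OF dF] pull_mult HK V(6))
    moreover have "h a (cinv a p) = pull (matrix_inv (fmat a (cinv a p))) H"
      using h a cinv_in_U[OF a p] unfolding has_coeff_def by blast
    ultimately show ?thesis using V(1,2) x(1) by auto
  qed
  show ?thesis
    unfolding ddbar_exact_def
  proof (intro exI ballI conjI)
    fix a assume a: "a \<in> \<A>"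
    show "smooth_on (cmap a ` (cdom a \<inter> U)) (\<lambda>p. \<phi> (cinv a p))"
      unfolding smooth_on_def
      by (intro allI Cr_on_local) (use loc[OF a] in blast)
    fix x assume x: "x \<in> cdom a \<inter> U"
    then show "h a x = (\<chi> j k. dz j (dzbar k (\<lambda>p. complex_of_real (\<phi> (cinv a p)))) (cmap a x))"
      using loc[OF a, of "cmap a x"] cinv_cmap[OF a] by auto
  qed
qed

end

section \<open>Hermitian matrices\<close>

lemma independent_family:
  fixes k :: "'t \<Rightarrow> 'v::real_vector"
  assumes T: "finite T" and ind: "\<And>u. (\<Sum>t\<in>T. u t *\<^sub>R k t) = 0 \<Longrightarrow> \<forall>t\<in>T. u t = 0"
  shows "inj_on k T" "independent (k ` T)"
proof -
  show inj: "inj_on k T"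
  proof (rule inj_onI, rule ccontr)
    fix s t assume st: "s \<in> T" "t \<in> T" "k s = k t" "s \<noteq> t"
    let ?u = "\<lambda>r. if r = s then 1 else if r = t then - 1 else (0::real)"
    have "(\<Sum>r\<in>T. ?u r *\<^sub>R k r) = (\<Sum>r\<in>{s, t}. ?u r *\<^sub>R k r)"
      using T st by (intro sum.mono_neutral_right) auto
    also have "\<dots> = 0" using st by simp
    finally have "?u s = 0" using ind[of ?u] st by blast
    then show False by simp
  qed
  show "independent (k ` T)"
  proof
    assume "dependent (k ` T)"
    then obtain u where u: "\<exists>v\<in>k ` T. u v \<noteq> 0" "(\<Sum>v\<in>k ` T. u v *\<^sub>R v) = 0"
      using dependent_finite[of "k ` T"] T by auto
    have "(\<Sum>t\<in>T. u (k t) *\<^sub>R k t) = 0" using u(2) by (simp add: sum.reindex[OF inj])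
    from ind[of "\<lambda>t. u (k t)", OF this] u(1) show False by auto
  qed
qed

text \<open>By \<open>ind\<close> the span of the family meets \<open>W\<close> only in 0, so the
  sum of the two is direct, and it lies inside \<open>V\<close>.\<close>

lemma card_independent_mod_subspace:
  fixes k :: "'t \<Rightarrow> 'v::euclidean_space"
  assumes T: "finite T" and V: "subspace V" "W \<subseteq> V" "subspace W" "k ` T \<subseteq> V"
    and ind: "\<And>u. (\<Sum>t\<in>T. u t *\<^sub>R k t) \<in> W \<Longrightarrow> \<forall>t\<in>T. u t = 0"
  shows "card T + dim W \<le> dim V"
proof -
  have ind0: "\<forall>t\<in>T. u t = 0" if "(\<Sum>t\<in>T. u t *\<^sub>R k t) = 0" for u
    using ind[of u] that subspace_0[OF V(3)] by metis
  have fam: "inj_on k T" "independent (k ` T)"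
    by (rule independent_family[OF T], erule ind0)+
  let ?S = "span (k ` T)"
  have "?S \<inter> W = {0}"
  proof (intro equalityI subsetI)
    fix x assume x: "x \<in> ?S \<inter> W"
    then obtain u where u: "x = (\<Sum>v\<in>k ` T. u v *\<^sub>R v)" using span_finite[of "k ` T"] T by auto
    then have "x = (\<Sum>t\<in>T. u (k t) *\<^sub>R k t)" by (simp add: sum.reindex[OF fam(1)])
    with ind[of "\<lambda>t. u (k t)"] x have "\<forall>t\<in>T. u (k t) = 0" by auto
    then show "x \<in> {0}" using \<open>x = (\<Sum>t\<in>T. u (k t) *\<^sub>R k t)\<close> by simp
  qed (use subspace_0[OF V(3)] span_zero in auto)
  then have "dim {x + y |x y. x \<in> ?S \<and> y \<in> W} = dim ?S + dim W"
    using dim_sums_Int[OF subspace_span V(3), of "k ` T"] by simp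
  moreover have "{x + y |x y. x \<in> ?S \<and> y \<in> W} \<subseteq> V"
    using span_minimal[OF V(4,1)] V(1,2) subspace_add by blast
  then have "dim {x + y |x y. x \<in> ?S \<and> y \<in> W} \<le> dim V" by (rule dim_subset)
  moreover have "dim ?S = card T"
    using fam by (simp add: dim_span dim_eq_card_independent card_image)
  ultimately show ?thesis by simp
qed

lemma independent_diff_sum:
  fixes B :: "'v::real_vector set"
  assumes B: "independent B" "finite B" "B0 \<subseteq> B" and s: "(\<Sum>b\<in>B - B0. u b *\<^sub>R b) \<in> span B0"
  shows "\<forall>b\<in>B - B0. u b = 0"
proof -
  have f0: "finite B0" using B finite_subset by blast
  then obtain v where v: "(\<Sum>b\<in>B - B0. u b *\<^sub>R b) = (\<Sum>b\<in>B0. v b *\<^sub>R b)"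
    using s span_finite[OF f0] by auto
  let ?w = "\<lambda>b. if b \<in> B0 then - v b else u b"
  have "(\<Sum>b\<in>B. ?w b *\<^sub>R b) = (\<Sum>b\<in>B - B0. ?w b *\<^sub>R b) + (\<Sum>b\<in>B0. ?w b *\<^sub>R b)"
    using sum.subset_diff[OF B(3,2)] .
  also have "\<dots> = (\<Sum>b\<in>B - B0. u b *\<^sub>R b) + (\<Sum>b\<in>B0. (- v b) *\<^sub>R b)"
    by (intro arg_cong2[where f = "(+)"] sum.cong) auto
  also have "\<dots> = 0" by (simp add: v sum_negf)
  finally have w: "(\<Sum>b\<in>B. ?w b *\<^sub>R b) = 0" .
  show ?thesis
  proof
    fix b assume b: "b \<in> B - B0"
    then have "?w b = 0" by (intro independentD[OF B(1,2) order_refl w]) simp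
    with b show "u b = 0" by simp
  qed
qed

section \<open>Dimensions of the spaces of hermitian matrices\<close>

abbreviation Herm :: "(complex^'n^'n) set" where "Herm \<equiv> {H. hermitian_mat H}"

lemma hermitian_matD: "hermitian_mat H \<Longrightarrow> cnj (H $ k $ j) = H $ j $ k"
  unfolding hermitian_mat_def by metis

lemma hermitian_matI: "(\<And>j k. cnj (H $ k $ j) = H $ j $ k) \<Longrightarrow> hermitian_mat H"
  unfolding hermitian_mat_def by metis

lemma subspace_Herm: "subspace Herm"
proof (rule subspaceI, unfold mem_Collect_eq)
  show "hermitian_mat 0" by (rule hermitian_matI) simp
  show "hermitian_mat (H + K)" if "hermitian_mat H" "hermitian_mat K" for H K :: "complex^'a^'a"
    by (rule hermitian_matI) (simp add: that[THEN hermitian_matD])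
  show "hermitian_mat (r *\<^sub>R H)" if "hermitian_mat H" for r and H :: "complex^'a^'a"
    by (rule hermitian_matI) (simp add: that[THEN hermitian_matD] scaleR_conv_of_real[where 'a = complex])
qed

lemma subspace_real_block: "subspace (real_block L)"
  by (auto simp: subspace_def real_block_iff)

text \<open>Every complex matrix is uniquely a hermitian one plus \<open>\<i>\<close> times a
  hermitian one. The two summands have equal dimension, and the total real dimension is 2
  n^2.\<close>

lemma dim_Herm: "dim (Herm :: (complex^'n^'n) set) = CARD('n)^2"
proof -
  define J :: "complex^'n^'n \<Rightarrow> complex^'n^'n" where "J H = (\<chi> j k. \<i> * H $ j $ k)" for H
  have lin: "linear J" by (rule linearI) (auto simp: J_def vec_eq_iff algebra_simps)
  have inj: "inj J" by (rule injI) (auto simp: J_def vec_eq_iff)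
  have d: "dim (J ` Herm) = dim (Herm :: (complex^'n^'n) set)"
    by (rule dim_image_eq[OF lin]) (use inj in \<open>auto intro: inj_on_subset\<close>)
  have i: "Herm \<inter> J ` Herm = {0}"
  proof (intro equalityI subsetI)
    fix H assume H: "H \<in> Herm \<inter> J ` Herm"
    then obtain K where K: "hermitian_mat K" "H = J K" "hermitian_mat H" by blast
    have "H $ j $ k = 0" for j k
    proof -
      have "\<i> * K $ j $ k = cnj (\<i> * K $ k $ j)"
        using hermitian_matD[OF K(3), of k j] unfolding K(2) J_def by simp
      also have "\<dots> = - \<i> * K $ j $ k" by (simp add: hermitian_matD[OF K(1)])
      finally show ?thesis using K(2) by (simp add: J_def)
    qed
    then show "H \<in> {0}" by (simp add: vec_eq_iff)
  qed (use subspace_0[OF subspace_Herm] subspace_0[OF linear_subspace_image[OF lin subspace_Herm]] in auto)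
  have u: "{x + y |x y. x \<in> Herm \<and> y \<in> J ` Herm} = (UNIV :: (complex^'n^'n) set)"
  proof (intro equalityI subsetI UNIV_I)
    fix H :: "complex^'n^'n"
    let ?X = "\<chi> j k. (H $ j $ k + cnj (H $ k $ j)) / 2" and ?Y = "\<chi> j k. (- \<i> / 2) * (H $ j $ k - cnj (H $ k $ j))"
    have XY: "?X \<in> Herm" "?Y \<in> Herm" by (auto intro!: hermitian_matI simp: complex_eq_iff field_simps)
    have HXY: "H = ?X + J ?Y" by (simp add: J_def vec_eq_iff complex_eq_iff field_simps)
    show "H \<in> {x + y |x y. x \<in> Herm \<and> y \<in> J ` Herm}"
      by (rule CollectI, rule exI[of _ ?X], rule exI[of _ "J ?Y"])
        (rule conjI[OF HXY conjI[OF XY(1) imageI[OF XY(2)]]])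
  qed
  have "DIM(complex^'n^'n) = dim (Herm :: (complex^'n^'n) set) + dim (Herm :: (complex^'n^'n) set)"
    using dim_sums_Int[OF subspace_Herm linear_subspace_image[OF lin subspace_Herm]]
    unfolding d i u by simp
  then show ?thesis by (simp add: power2_eq_square)
qed

text \<open>These are the real symmetric matrices supported on \<open>L \<times> L\<close>, with one
  basis matrix for each unordered pair of indices. The set \<open>P\<close> of ordered
  representatives and its mirror image cover \<open>L \<times> L\<close> and share the diagonal,
  hence 2 |P| = l^2 + l.\<close>

lemma dim_Herm_real_block:
  fixes L :: "'n::finite set"
  shows "2 * dim (Herm \<inter> real_block L) = card L * (card L + 1)"
proof -
  \<comment> \<open>An injection into the naturals, used to order the index type so that one of
    \<open>(j, k)\<close> and \<open>(k, j)\<close> can be selected.\<close>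
  obtain e :: "'n \<Rightarrow> nat" where e: "inj e" using finite_imp_inj_to_nat_seg[of "UNIV :: 'n set"] by auto
  define P where "P = {(j, k). j \<in> L \<and> k \<in> L \<and> e j \<le> e k}"
  define E :: "'n \<times> 'n \<Rightarrow> complex^'n^'n" where
    "E = (\<lambda>(j, k). \<chi> a b. if (a, b) = (j, k) \<or> (a, b) = (k, j) then 1 else 0)"
  have fin: "finite P" by simp
  have ent: "(\<Sum>t\<in>P. u t *\<^sub>R E t) $ a $ b = (if (a, b) \<in> P then complex_of_real (u (a, b)) else if (b, a) \<in> P then complex_of_real (u (b, a)) else 0)" for u a b
  proof -
    \<comment> \<open>At most one of \<open>(a, b)\<close> and \<open>(b, a)\<close> lies in
      \<open>P\<close> when \<open>a\<close> and \<open>b\<close> differ, so at most one summand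
      survives. If neither does, the selected index \<open>(b, a)\<close> lies outside
      \<open>P\<close> and the sum is 0.\<close>
    have "(\<Sum>t\<in>P. u t *\<^sub>R E t) $ a $ b = (\<Sum>t\<in>P. if t = (if (a, b) \<in> P then (a, b) else (b, a)) then complex_of_real (u t) else 0)"
      unfolding sum_component
    proof (intro sum.cong refl)
      fix t assume t: "t \<in> P"
      obtain j k where jk: "t = (j, k)" by (cases t)
      have "a = b" if "e a \<le> e b" "e b \<le> e a" using that e by (simp add: inj_eq)
      then show "(u t *\<^sub>R E t) $ a $ b = (if t = (if (a, b) \<in> P then (a, b) else (b, a)) then complex_of_real (u t) else 0)"
        using t unfolding jk by (auto simp: E_def P_def scaleR_conv_of_real[where 'a = complex])
    qed
    then show ?thesis by (simp add: sum.delta' [OF fin] cong: if_cong)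
  qed
  have ind: "\<forall>t\<in>P. u t = 0" if "(\<Sum>t\<in>P. u t *\<^sub>R E t) = 0" for u
  proof
    fix t assume t: "t \<in> P"
    obtain a b where ab: "t = (a, b)" by (cases t)
    show "u t = 0" using ent[of u a b] that t unfolding ab by simp
  qed
  have fam: "inj_on E P" "independent (E ` P)"
    by (rule independent_family[OF fin], erule ind)+
  have "dim (Herm \<inter> real_block L) = card (E ` P)"
  proof (rule dim_unique[OF _ _ fam(2)])
    show "E ` P \<subseteq> Herm \<inter> real_block L"
      by (auto intro!: hermitian_matI simp: E_def P_def real_block_iff)
    show "Herm \<inter> real_block L \<subseteq> span (E ` P)"
    proof
      fix K :: "complex^'n^'n" assume K: "K \<in> Herm \<inter> real_block L"
      then have Kr: "Im (K $ a $ b) = 0" "\<not> (a \<in> L \<and> b \<in> L) \<Longrightarrow> K $ a $ b = 0" for a b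
        unfolding real_block_iff Int_iff by blast+
      have "cnj (K $ a $ b) = K $ b $ a" for a b using K by (intro hermitian_matD) simp
      then have sym: "K $ b $ a = K $ a $ b" for a b using Kr(1) by (metis complex_cnj_cancel_iff complex_is_Real_iff Reals_cnj_iff)
      have re: "complex_of_real (Re (K $ a $ b)) = K $ a $ b" for a b
        using Kr(1) by (simp add: complex_eq_iff)
      have "K $ a $ b = (\<Sum>t\<in>P. Re (K $ fst t $ snd t) *\<^sub>R E t) $ a $ b" for a b
        using sym[of a b] Kr(2)[of a b] unfolding ent re fst_conv snd_conv by (auto simp: P_def)
      then have "K = (\<Sum>t\<in>P. Re (K $ fst t $ snd t) *\<^sub>R E t)" unfolding vec_eq_iff by blast
      also have "\<dots> \<in> span (E ` P)" by (intro span_sum span_scale span_base imageI)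
      finally show "K \<in> span (E ` P)" .
    qed
  qed (simp)
  moreover have "card (E ` P) = card P" by (rule card_image[OF fam(1)])
  moreover have "2 * card P = card L * (card L + 1)"
  proof -
    have "card (P \<union> prod.swap ` P) + card (P \<inter> prod.swap ` P) = card P + card (prod.swap ` P)"
      using card_Un_Int[of P "prod.swap ` P"] by simp
    moreover have "P \<union> prod.swap ` P = L \<times> L" by (force simp: P_def image_iff)
    moreover have "P \<inter> prod.swap ` P = (\<lambda>j. (j, j)) ` L"
      using e by (auto simp: P_def image_iff inj_eq)
    moreover have "card ((\<lambda>j. (j, j)) ` L) = card L" by (rule card_image) (auto intro: inj_onI)
    moreover have "card (prod.swap ` P) = card P" by (rule card_image) simp
    ultimately show ?thesis by (simp add: card_cartesian_product)
  qed
  ultimately show ?thesis by simp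
qed

lemma sesq_bound: "norm (sesq H v v) \<le> (\<Sum>j\<in>UNIV. \<Sum>k\<in>UNIV. norm (H $ j $ k)) * (norm v)^2"
proof -
  have "norm (sesq H v v) \<le> (\<Sum>j\<in>UNIV. \<Sum>k\<in>UNIV. norm (H $ j $ k * v $ j * cnj (v $ k)))"
    unfolding sesq_def by (rule order_trans[OF norm_sum]) (intro sum_mono norm_sum)
  also have "\<dots> \<le> (\<Sum>j\<in>UNIV. \<Sum>k\<in>UNIV. norm (H $ j $ k) * (norm v)^2)"
    unfolding norm_mult power2_eq_square complex_mod_cnj mult.assoc
    by (intro sum_mono mult_left_mono mult_mono Finite_Cartesian_Product.norm_nth_le) auto
  finally show ?thesis by (simp add: sum_distrib_right)
qed

section \<open>The cone\<close>

lemma sesq_mat_scaleR: "sesq (H + c *\<^sub>R mat 1) v v = sesq H v v + complex_of_real (c * (norm v)^2)"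
proof -
  have 1: "sesq (A + B) v v = sesq A v v + sesq B v v" for A B
    by (simp add: sesq_def algebra_simps sum.distrib)
  have "sesq (c *\<^sub>R mat 1) v v = (\<Sum>j\<in>UNIV. \<Sum>k\<in>UNIV. if k = j then c *\<^sub>R (v $ j * cnj (v $ j)) else 0)"
    unfolding sesq_def by (intro sum.cong refl) (auto simp: mat_def)
  also have "\<dots> = (\<Sum>j\<in>UNIV. complex_of_real (c * (norm (v $ j))^2))"
    by (simp add: scaleR_conv_of_real flip: complex_norm_square)
  also have "\<dots> = complex_of_real (c * (norm v)^2)"
    by (simp add: norm_vec_def L2_set_def sum_nonneg sum_distrib_left)
  finally show ?thesis by (simp add: 1)
qed

text \<open>\<open>M\<close>, the sum of the moduli of the entries, bounds the form on unit vectors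
  by \<open>sesq_bound\<close>. Shifting by \<open>M + 1\<close> leaves at least the square of
  \<open>norm v\<close>, which is positive.\<close>

lemma hermitian_shift_pos_def:
  assumes "hermitian_mat H" obtains c where "0 < c" "pos_def_hermitian (H + c *\<^sub>R mat 1)"
proof -
  define M where "M = (\<Sum>j\<in>UNIV. \<Sum>k\<in>UNIV. norm (H $ j $ k))"
  have M0: "0 \<le> M" unfolding M_def by (intro sum_nonneg) simp
  have "hermitian_mat (mat 1)" by (rule hermitian_matI) (auto simp: mat_def)
  then have "hermitian_mat (H + (M + 1) *\<^sub>R mat 1)"
    using subspace_add[OF subspace_Herm] subspace_scale[OF subspace_Herm] assms by blast
  moreover have "0 < Re (sesq (H + (M + 1) *\<^sub>R mat 1) v v)" if "v \<noteq> 0" for v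
  proof -
    have "- Re (sesq H v v) \<le> M * (norm v)^2"
      using sesq_bound[of H v] abs_Re_le_cmod[of "sesq H v v"] unfolding M_def by linarith
    moreover have "0 < (norm v)^2" using that by simp
    ultimately show ?thesis
      unfolding sesq_mat_scaleR plus_complex.sel Re_complex_of_real distrib_right by linarith
  qed
  ultimately have "pos_def_hermitian (H + (M + 1) *\<^sub>R mat 1)" unfolding pos_def_hermitian_iff by blast
  with M0 show ?thesis by (intro that[of "M + 1"]) auto
qed

text \<open>A hermitian matrix is a positive definite shift of itself minus a multiple of the
  identity; a positive definite multiple of the identity comes from shifting 0. This later allows a
  basis to be completed by matrices of metrics.\<close>

lemma Herm_span_pos_def: "Herm \<subseteq> span {H. pos_def_hermitian H}"
proof
  fix H :: "complex^'n^'n" assume "H \<in> Herm"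
  then obtain c where c: "0 < c" "pos_def_hermitian (H + c *\<^sub>R mat 1)" using hermitian_shift_pos_def by blast
  have "hermitian_mat (0 :: complex^'n^'n)" using subspace_0[OF subspace_Herm] by blast
  then obtain d where d: "0 < d" "pos_def_hermitian ((0 :: complex^'n^'n) + d *\<^sub>R mat 1)"
    by (rule hermitian_shift_pos_def)
  have "(H + c *\<^sub>R mat 1) - (c / d) *\<^sub>R (0 + d *\<^sub>R mat 1) \<in> span {H. pos_def_hermitian H}"
    using c d by (intro span_diff span_scale span_base) auto
  then show "H \<in> span {H. pos_def_hermitian H}" using d(1) by simp
qed

section \<open>Cosets and the generated cone\<close>

lemma coset_eq_iff:
  assumes "subspace W" shows "coset W A = coset W B \<longleftrightarrow> A - B \<in> W"
proof
  assume "coset W A = coset W B"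
  moreover have "A \<in> coset W A" unfolding coset_def using subspace_0[OF assms] by force
  ultimately obtain w where "w \<in> W" "A = B + w" unfolding coset_def by blast
  then show "A - B \<in> W" by simp
next
  have *: "coset W A \<subseteq> coset W B" if "A - B \<in> W" for A B
  proof
    fix x assume "x \<in> coset W A"
    then obtain w where w: "w \<in> W" "x = A + w" unfolding coset_def by blast
    then have "x = B + ((A - B) + w)" by simp
    then show "x \<in> coset W B" unfolding coset_def using subspace_add[OF assms that w(1)] by blast
  qed
  assume "A - B \<in> W"
  moreover from this have "B - A \<in> W" using subspace_neg[OF assms] by fastforce
  ultimately show "coset W A = coset W B" using * by blast
qed

lemma coset_scale:
  assumes "subspace W" "c \<noteq> 0" shows "(\<lambda>x. c *\<^sub>R x) ` coset W A = coset W (c *\<^sub>R A)"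
proof (intro equalityI subsetI)
  fix x assume "x \<in> (\<lambda>x. c *\<^sub>R x) ` coset W A"
  then obtain w where "w \<in> W" "x = c *\<^sub>R (A + w)" unfolding coset_def by blast
  then show "x \<in> coset W (c *\<^sub>R A)"
    unfolding coset_def using subspace_scale[OF assms(1)] by (auto simp: scaleR_add_right)
next
  fix x assume "x \<in> coset W (c *\<^sub>R A)"
  then obtain w where w: "w \<in> W" "x = c *\<^sub>R A + w" unfolding coset_def by blast
  then have "x = c *\<^sub>R (A + inverse c *\<^sub>R w)" using assms(2) by (simp add: scaleR_add_right)
  then show "x \<in> (\<lambda>x. c *\<^sub>R x) ` coset W A"
    unfolding coset_def using subspace_scale[OF assms(1) w(1)] by blast
qed

lemma coset_add:
  assumes "subspace W" shows "{x + y |x y. x \<in> coset W A \<and> y \<in> coset W B} = coset W (A + B)"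
proof (intro equalityI subsetI)
  fix z assume "z \<in> {x + y |x y. x \<in> coset W A \<and> y \<in> coset W B}"
  then obtain v w where "v \<in> W" "w \<in> W" "z = (A + v) + (B + w)" unfolding coset_def by blast
  then have "z = (A + B) + (v + w)" "v + w \<in> W" using subspace_add[OF assms] by auto
  then show "z \<in> coset W (A + B)" unfolding coset_def by blast
next
  fix z assume "z \<in> coset W (A + B)"
  then obtain w where w: "w \<in> W" "z = (A + 0) + (B + w)" unfolding coset_def by (auto simp: add_ac)
  then show "z \<in> {x + y |x y. x \<in> coset W A \<and> y \<in> coset W B}"
    unfolding coset_def using subspace_0[OF assms] by blast
qed

lemma hermitian_add: "hermitian_mat H \<Longrightarrow> hermitian_mat K \<Longrightarrow> hermitian_mat (H + K)"
  using subspace_add[OF subspace_Herm, of H K] by simp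

lemma hermitian_scale: "hermitian_mat H \<Longrightarrow> hermitian_mat (c *\<^sub>R H)"
  using subspace_scale[OF subspace_Herm, of H c] by simp

lemma pos_def_add: "pos_def_hermitian H \<Longrightarrow> pos_def_hermitian K \<Longrightarrow> pos_def_hermitian (H + K)"
proof -
  have "sesq (H + K) v v = sesq H v v + sesq K v v" for v
    by (simp add: sesq_def algebra_simps sum.distrib)
  then show "pos_def_hermitian H \<Longrightarrow> pos_def_hermitian K \<Longrightarrow> pos_def_hermitian (H + K)"
    unfolding pos_def_hermitian_iff by (simp add: hermitian_add add_pos_pos)
qed

lemma pos_def_scale: "pos_def_hermitian H \<Longrightarrow> 0 < c \<Longrightarrow> pos_def_hermitian (c *\<^sub>R H)"
proof -
  have "sesq (c *\<^sub>R H) v v = c *\<^sub>R sesq H v v" for v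
    by (simp add: sesq_def algebra_simps scaleR_sum_right)
  then show "pos_def_hermitian H \<Longrightarrow> 0 < c \<Longrightarrow> pos_def_hermitian (c *\<^sub>R H)"
    unfolding pos_def_hermitian_iff by (simp add: hermitian_scale)
qed

text \<open>Positive definite matrices are already closed under sums and positive multiples, and so
  are their cosets.\<close>

lemma generated_cone_pos_def:
  assumes W: "subspace W"
  shows "generated_cone {coset W H |H. pos_def_hermitian H} = {coset W H |H. pos_def_hermitian H}"
proof (intro equalityI subsetI)
  fix s assume "s \<in> generated_cone {coset W H |H. pos_def_hermitian H}"
  then show "s \<in> {coset W H |H. pos_def_hermitian H}"
  proof induction
    case (scale s c)
    then obtain H where "s = coset W H" "pos_def_hermitian H" by blast
    with scale(2) show ?case using coset_scale[OF W, of c H] pos_def_scale[of H c] by auto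
  next
    case (add s t)
    then obtain H K where "s = coset W H" "pos_def_hermitian H" "t = coset W K" "pos_def_hermitian K" by blast
    then show ?case using coset_add[OF W, of H K] pos_def_add[of H K] by auto
  qed
qed (rule generated_cone.base)

section \<open>Classes of metrics in the adapted coordinates\<close>

locale semi_torus_coordinates = semi_torus_action \<A> \<Lambda> \<rho> G
  for \<A> :: "('a::{t2_space,second_countable_topology}, 'n::finite) chart set"
    and \<Lambda> :: "(complex^'n) set" and \<rho> :: "complex^'n \<Rightarrow> 'a \<Rightarrow> 'a" and G :: "('a \<Rightarrow> 'a) set" +
  fixes C :: "complex^'n^'n" and L :: "'n set"
  assumes inv_C: "invertible C" and C_span: "(\<lambda>z. C *v z) ` span \<Lambda> = split_real_span L"
begin

abbreviation (input) D :: "'a set" where "D \<equiv> D_supp \<A> \<rho>"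
abbreviation metrics :: "('a, 'n) herm_tensor set" where "metrics \<equiv> invariant_metrics \<A> G D"

text \<open>The coefficient matrix in the adapted coordinates w = C z, whereas
  \<open>has_coeff\<close> refers to z; \<open>has_coeff_unique\<close> justifies the
  description.\<close>

definition coeff_mat :: "('a, 'n) herm_tensor \<Rightarrow> complex^'n^'n" where
  "coeff_mat g = pull (matrix_inv C) (THE H. has_coeff g H)"

lemma coeff_mat_eq: "has_coeff g H \<Longrightarrow> coeff_mat g = pull (matrix_inv C) H"
  unfolding coeff_mat_def using has_coeff_unique by (metis the_equality)

lemma metric_coeff:
  assumes "g \<in> metrics"
  shows "has_coeff g (pull C (coeff_mat g))" "pos_def_hermitian (coeff_mat g)"
proof -
  obtain H where H: "has_coeff g H" "pos_def_hermitian H" using invariant_metric_coeff[OF assms] .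
  show "has_coeff g (pull C (coeff_mat g))"
    using H(1) by (simp add: coeff_mat_eq[OF H(1)] pull_inverse[OF invertible_matrix_inv(2)[OF inv_C]])
  show "pos_def_hermitian (coeff_mat g)"
    unfolding coeff_mat_eq[OF H(1)] by (rule pos_def_pull[OF H(2) invertible_matrix_inv(1)[OF inv_C]])
qed

lemma metric_exists:
  assumes "pos_def_hermitian H"
  shows "const_metric (pull C H) \<in> metrics" "coeff_mat (const_metric (pull C H)) = H"
proof -
  show "const_metric (pull C H) \<in> metrics"
    by (intro const_metric_invariant pos_def_pull[OF assms invertible_matrix_inv(2)[OF inv_C]])
  show "coeff_mat (const_metric (pull C H)) = H"
    by (simp add: coeff_mat_eq[OF const_metric_coeff] pull_inverse[OF invertible_matrix_inv(1)[OF inv_C]])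
qed

text \<open>Both directions of the exactness criterion, for arbitrary real combinations. Two
  summands with coefficients 1 and -1 give the equivalence of metrics, general ones the linear
  independence of classes.\<close>

lemma lincomb_exact_iff:
  assumes T: "\<And>t. t \<in> T \<Longrightarrow> g t \<in> metrics"
  shows "ddbar_exact \<A> (- D) (\<lambda>a x. \<Sum>t\<in>T. u t *\<^sub>R g t a x) \<longleftrightarrow> (\<Sum>t\<in>T. u t *\<^sub>R coeff_mat (g t)) \<in> real_block L"
proof -
  let ?H = "\<Sum>t\<in>T. u t *\<^sub>R pull C (coeff_mat (g t))"
  have h: "has_coeff (\<lambda>a x. \<Sum>t\<in>T. u t *\<^sub>R g t a x) ?H"
    by (rule has_coeff_lincomb) (rule metric_coeff(1)[OF T])
  have "hermitian_mat (pull C (coeff_mat (g t)))" if "t \<in> T" for t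
    using metric_coeff(2)[OF T[OF that]] hermitian_pull unfolding pos_def_hermitian_def by blast
  then have herm: "hermitian_mat ?H"
    using subspace_sum[OF subspace_Herm, of T "\<lambda>t. u t *\<^sub>R pull C (coeff_mat (g t))"]
    by (simp add: hermitian_scale)
  have eq: "pull (matrix_inv C) ?H = (\<Sum>t\<in>T. u t *\<^sub>R coeff_mat (g t))"
    by (simp add: linear_sum[OF linear_pull] linear_scale[OF linear_pull]
        pull_inverse[OF invertible_matrix_inv(1)[OF inv_C]])
  show ?thesis
  proof
    assume "ddbar_exact \<A> (- D) (\<lambda>a x. \<Sum>t\<in>T. u t *\<^sub>R g t a x)"
    from ddbar_exact_imp_real_block[OF h this[folded U_def] inv_C C_span]
    show "(\<Sum>t\<in>T. u t *\<^sub>R coeff_mat (g t)) \<in> real_block L" unfolding eq .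
  next
    assume "(\<Sum>t\<in>T. u t *\<^sub>R coeff_mat (g t)) \<in> real_block L"
    from real_block_imp_ddbar_exact[OF h herm inv_C C_span, unfolded eq, OF this]
    show "ddbar_exact \<A> (- D) (\<lambda>a x. \<Sum>t\<in>T. u t *\<^sub>R g t a x)" unfolding U_def .
  qed
qed

lemma equiv_iff: 
  assumes "g \<in> metrics" "g' \<in> metrics"
  shows "(g, g') \<in> kaehler_equiv \<A> G D \<longleftrightarrow> coeff_mat g - coeff_mat g' \<in> real_block L"
proof -
  \<comment> \<open>The difference is written as a combination indexed by the booleans, so that the
    index set has two elements even when \<open>g = g'\<close>.\<close>
  have e: "(\<lambda>a x. \<Sum>b\<in>UNIV. (if b then 1 else - 1) *\<^sub>R (if b then g else g') a x) = (\<lambda>a x. g a x - g' a x)"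
    by (simp add: fun_eq_iff UNIV_bool)
  have "ddbar_exact \<A> (- D) (\<lambda>a x. g a x - g' a x) \<longleftrightarrow> coeff_mat g - coeff_mat g' \<in> real_block L"
    using lincomb_exact_iff[of "UNIV :: bool set" "\<lambda>b. if b then g else g'" "\<lambda>b. if b then 1 else - 1"] assms
    unfolding e by (simp add: UNIV_bool)
  then show ?thesis using assms unfolding kaehler_equiv_def by simp
qed

lemma class_eq:
  assumes "g \<in> metrics"
  shows "kaehler_class \<A> G D g = {g' \<in> metrics. coeff_mat g - coeff_mat g' \<in> real_block L}"
  using assms equiv_iff unfolding kaehler_class_def by (auto simp: kaehler_equiv_def)

lemma class_self: "g \<in> metrics \<Longrightarrow> g \<in> kaehler_class \<A> G D g"
  using subspace_0[OF subspace_real_block] by (simp add: class_eq)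

lemma class_eq_iff:
  assumes "g \<in> metrics" "g' \<in> metrics"
  shows "kaehler_class \<A> G D g = kaehler_class \<A> G D g' \<longleftrightarrow> coeff_mat g - coeff_mat g' \<in> real_block L"
proof
  assume "kaehler_class \<A> G D g = kaehler_class \<A> G D g'"
  then show "coeff_mat g - coeff_mat g' \<in> real_block L" using class_self[OF assms(2)] class_eq[OF assms(1)] by auto
next
  have W: "x + y \<in> real_block L" if "x \<in> real_block L" "y \<in> real_block L" for x y :: "complex^'n^'n"
    using subspace_add[OF subspace_real_block that] .
  assume d1: "coeff_mat g - coeff_mat g' \<in> real_block L"
  then have d2: "coeff_mat g' - coeff_mat g \<in> real_block L" using subspace_neg[OF subspace_real_block] by fastforce
  have "coeff_mat g - coeff_mat h \<in> real_block L \<longleftrightarrow> coeff_mat g' - coeff_mat h \<in> real_block L" for h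
    using W[OF d1, of "coeff_mat g' - coeff_mat h"] W[OF d2, of "coeff_mat g - coeff_mat h"] by auto
  then show "kaehler_class \<A> G D g = kaehler_class \<A> G D g'" unfolding class_eq[OF assms(1)] class_eq[OF assms(2)] by simp
qed

lemma cone_eq: "kaehler_cone \<A> G D = kaehler_class \<A> G D ` metrics"
  unfolding kaehler_cone_def quotient_def kaehler_class_def by auto

text \<open>The map \<Phi> of the theorem. The coset is the same for every representative of a
  class, and the choice of the base point \<open>x0\<close> does not enter.\<close>

definition class_coset :: "('a, 'n) herm_tensor set \<Rightarrow> (complex^'n^'n) set" where
  "class_coset T = coset (real_block L) (coeff_mat (SOME g. g \<in> T))"

lemma class_coset:
  assumes "g \<in> metrics" shows "class_coset (kaehler_class \<A> G D g) = coset (real_block L) (coeff_mat g)"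
proof -
  let ?g = "SOME g'. g' \<in> kaehler_class \<A> G D g"
  have "?g \<in> kaehler_class \<A> G D g" by (rule someI[of "\<lambda>g'. g' \<in> kaehler_class \<A> G D g", OF class_self[OF assms]])
  then have "coeff_mat g - coeff_mat ?g \<in> real_block L" by (simp add: class_eq[OF assms])
  then have "coset (real_block L) (coeff_mat g) = coset (real_block L) (coeff_mat ?g)"
    using coset_eq_iff[OF subspace_real_block] by blast
  then show ?thesis unfolding class_coset_def by simp
qed

lemma cone_description:
  assumes x0: "x0 \<in> - D"
  shows "(\<forall>g \<in> metrics. \<exists>H. const_coeff_matrix \<A> \<rho> C x0 g H \<and>
            class_coset (kaehler_class \<A> G D g) = coset (real_block L) H) \<and>
         inj_on class_coset (kaehler_cone \<A> G D) \<and>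
         class_coset ` kaehler_cone \<A> G D = generated_cone {coset (real_block L) H |H. pos_def_hermitian H}"
proof (intro conjI ballI)
  fix g assume g: "g \<in> metrics"
  have "const_coeff_matrix \<A> \<rho> C x0 g (pull (matrix_inv C) (pull C (coeff_mat g)))"
    by (rule const_coeff[OF metric_coeff(1)[OF g]]) (use x0 in \<open>simp add: U_def\<close>)
  then have "const_coeff_matrix \<A> \<rho> C x0 g (coeff_mat g)"
    by (simp add: pull_inverse[OF invertible_matrix_inv(1)[OF inv_C]])
  with class_coset[OF g] show "\<exists>H. const_coeff_matrix \<A> \<rho> C x0 g H \<and>
      class_coset (kaehler_class \<A> G D g) = coset (real_block L) H" by blast
next
  show "inj_on class_coset (kaehler_cone \<A> G D)"
    unfolding cone_eq
  proof (rule inj_onI)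
    fix S T assume "S \<in> kaehler_class \<A> G D ` metrics" "T \<in> kaehler_class \<A> G D ` metrics"
      and eq: "class_coset S = class_coset T"
    then obtain g h where g: "g \<in> metrics" "S = kaehler_class \<A> G D g"
      and h: "h \<in> metrics" "T = kaehler_class \<A> G D h" by blast
    have "coset (real_block L) (coeff_mat g) = coset (real_block L) (coeff_mat h)"
      using eq unfolding g(2) h(2) class_coset[OF g(1)] class_coset[OF h(1)] .
    then show "S = T"
      unfolding g(2) h(2) class_eq_iff[OF g(1) h(1)] coset_eq_iff[OF subspace_real_block] .
  qed
next
  have "class_coset ` kaehler_cone \<A> G D = (\<lambda>g. coset (real_block L) (coeff_mat g)) ` metrics"
    unfolding cone_eq image_image by (intro image_cong refl class_coset)
  also have "\<dots> = {coset (real_block L) H |H. pos_def_hermitian H}"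
  proof (intro equalityI subsetI)
    fix s assume "s \<in> (\<lambda>g. coset (real_block L) (coeff_mat g)) ` metrics"
    then show "s \<in> {coset (real_block L) H |H. pos_def_hermitian H}" using metric_coeff(2) by blast
  next
    fix s assume "s \<in> {coset (real_block L) H |H. pos_def_hermitian H}"
    then obtain H where H: "pos_def_hermitian H" "s = coset (real_block L) H" by blast
    show "s \<in> (\<lambda>g. coset (real_block L) (coeff_mat g)) ` metrics"
      by (rule image_eqI[OF _ metric_exists(1)[OF H(1)]]) (simp add: metric_exists(2)[OF H(1)] H(2))
  qed
  finally show "class_coset ` kaehler_cone \<A> G D = generated_cone {coset (real_block L) H |H. pos_def_hermitian H}"
    unfolding generated_cone_pos_def[OF subspace_real_block] .
qed

section \<open>Dimension of the cone\<close>

lemma coeff_Herm: "g \<in> metrics \<Longrightarrow> coeff_mat g \<in> Herm"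
  using metric_coeff(2) unfolding pos_def_hermitian_def by blast

lemma subspace_W: "subspace (Herm \<inter> real_block L)"
  by (rule subspace_inter[OF subspace_Herm subspace_real_block])

text \<open>Independent classes have coefficient matrices that are independent modulo
  \<open>Herm \<inter> real_block L\<close> inside the hermitian matrices.\<close>

lemma card_independent_classes:
  assumes T: "T \<subseteq> kaehler_cone \<A> G D" "finite T" "classes_independent \<A> D T"
  shows "card T + dim (Herm \<inter> real_block L) \<le> CARD('n)^2"
proof -
  have "\<exists>g. g \<in> metrics \<and> t = kaehler_class \<A> G D g" if "t \<in> T" for t
    using T(1) that unfolding cone_eq by blast
  then obtain g where g: "\<And>t. t \<in> T \<Longrightarrow> g t \<in> metrics" "\<And>t. t \<in> T \<Longrightarrow> t = kaehler_class \<A> G D (g t)"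
    by metis
  have "card T + dim (Herm \<inter> real_block L) \<le> dim (Herm :: (complex^'n^'n) set)"
  proof (rule card_independent_mod_subspace[OF T(2) subspace_Herm _ subspace_W])
    show "(\<lambda>t. coeff_mat (g t)) ` T \<subseteq> Herm" using coeff_Herm[OF g(1)] by blast
    fix u assume "(\<Sum>t\<in>T. u t *\<^sub>R coeff_mat (g t)) \<in> Herm \<inter> real_block L"
    then have "ddbar_exact \<A> (- D) (\<lambda>a x. \<Sum>t\<in>T. u t *\<^sub>R g t a x)"
      using lincomb_exact_iff[of T g u] g(1) by blast
    moreover have "g t \<in> t" if "t \<in> T" for t using class_self[OF g(1)[OF that]] g(2)[OF that] by simp
    ultimately show "\<forall>t\<in>T. u t = 0" using T(3) unfolding classes_independent_def by blast
  qed blast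
  then show ?thesis by (simp add: dim_Herm)
qed

lemma independent_classes_exist:
  obtains T where "T \<subseteq> kaehler_cone \<A> G D" "finite T" "classes_independent \<A> D T"
    "card T + dim (Herm \<inter> real_block L) = CARD('n)^2"
proof -
  let ?W = "Herm \<inter> real_block L :: (complex^'n^'n) set" and ?P = "{H :: complex^'n^'n. pos_def_hermitian H}"
  obtain B0 where B0: "B0 \<subseteq> ?W" "independent B0" "?W \<subseteq> span B0" "card B0 = dim ?W"
    using basis_exists[of ?W] by metis
  have sW: "span B0 = ?W" using B0 span_minimal[OF B0(1) subspace_W] by blast
  \<comment> \<open>A basis of \<open>?W\<close> is completed by positive definite matrices only,
    since each added vector must be the matrix of a metric. By \<open>Herm_span_pos_def\<close> the
    result is a basis of all hermitian matrices.\<close>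
  obtain B where B: "B0 \<subseteq> B" "B \<subseteq> B0 \<union> ?P" "independent B" "B0 \<union> ?P \<subseteq> span B"
    using maximal_independent_subset_extend[of B0 "B0 \<union> ?P"] B0(2) by blast
  have PH: "?P \<subseteq> Herm" unfolding pos_def_hermitian_def by blast
  have BH: "B \<subseteq> Herm" using B(2) B0(1) PH by blast
  have "Herm \<subseteq> span B"
    using Herm_span_pos_def span_minimal[OF _ subspace_span, of ?P B] B(4) by blast
  then have cB: "card B = CARD('n)^2"
    using dim_unique[OF BH _ B(3) refl] dim_Herm[where 'n = 'n] by simp
  have fB: "finite B" using B(3) independent_imp_finite by blast
  define Q where "Q = B - B0"
  have QP: "pos_def_hermitian H" if "H \<in> Q" for H using that B(2) unfolding Q_def by blast
  have cQ: "card Q + card B0 = card B"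
    unfolding Q_def using B(1) fB by (simp add: card_Diff_subset finite_subset card_mono)
  have indQ: "\<forall>H\<in>Q. u H = 0" if "(\<Sum>H\<in>Q. u H *\<^sub>R H) \<in> ?W" for u
    using independent_diff_sum[OF B(3) fB B(1), of u] that unfolding Q_def sW .
  define cl where "cl H = kaehler_class \<A> G D (const_metric (pull C H))" for H
  note m = metric_exists[OF QP]
  have inj: "inj_on cl Q"
  proof (rule inj_onI, rule ccontr)
    fix H K assume HK: "H \<in> Q" "K \<in> Q" "cl H = cl K" "H \<noteq> K"
    then have "H - K \<in> real_block L"
      using class_eq_iff[OF m(1) m(1), of H K] m(2) unfolding cl_def by simp
    moreover have "H - K \<in> Herm" using subspace_diff[OF subspace_Herm] HK BH unfolding Q_def by blast
    moreover have "(\<Sum>J\<in>Q. (if J = H then 1 else if J = K then - 1 else 0) *\<^sub>R J) = H - K"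
    proof -
      have "(\<Sum>J\<in>Q. (if J = H then 1 else if J = K then - 1 else (0::real)) *\<^sub>R J)
          = (\<Sum>J\<in>{H, K}. (if J = H then 1 else if J = K then - 1 else 0) *\<^sub>R J)"
        using HK fB by (intro sum.mono_neutral_right) (auto simp: Q_def)
      then show ?thesis using HK(4) by simp
    qed
    ultimately have "\<forall>J\<in>Q. (if J = H then 1 else if J = K then - 1 else (0::real)) = 0" by (intro indQ) auto
    then show False using HK(1) by auto
  qed
  have ind: "classes_independent \<A> D (cl ` Q)"
    unfolding classes_independent_def
  proof (intro allI impI, elim conjE)
    fix g :: "('a, 'n) herm_tensor set \<Rightarrow> ('a, 'n) herm_tensor" and u :: "('a, 'n) herm_tensor set \<Rightarrow> real"
    assume g: "\<forall>t\<in>cl ` Q. g t \<in> t"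
      and ex: "ddbar_exact \<A> (- D) (\<lambda>a x. \<Sum>t\<in>cl ` Q. u t *\<^sub>R g t a x)"
    have gH: "g (cl H) \<in> metrics" "H - coeff_mat (g (cl H)) \<in> real_block L" if "H \<in> Q" for H
      using g that class_eq[OF m(1)[OF that]] m(2)[OF that] unfolding cl_def by auto
    have "(\<Sum>H\<in>Q. u (cl H) *\<^sub>R coeff_mat (g (cl H))) \<in> real_block L"
      using lincomb_exact_iff[of "cl ` Q" g u] ex gH(1) by (auto simp: sum.reindex[OF inj])
    \<comment> \<open>The representatives \<open>g\<close> are arbitrary, so their matrices agree
      with the basis vectors \<open>H\<close> only modulo the real block. The correction has to be
      added before \<open>indQ\<close> can be applied.\<close>
    moreover have "(\<Sum>H\<in>Q. u (cl H) *\<^sub>R (H - coeff_mat (g (cl H)))) \<in> real_block L"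
      by (intro subspace_sum subspace_scale subspace_real_block gH(2))
    ultimately have "(\<Sum>H\<in>Q. u (cl H) *\<^sub>R coeff_mat (g (cl H))) + (\<Sum>H\<in>Q. u (cl H) *\<^sub>R (H - coeff_mat (g (cl H)))) \<in> real_block L"
      by (rule subspace_add[OF subspace_real_block])
    then have "(\<Sum>H\<in>Q. u (cl H) *\<^sub>R H) \<in> real_block L"
      by (simp add: sum.distrib[symmetric] scaleR_add_right[symmetric])
    moreover have "(\<Sum>H\<in>Q. u (cl H) *\<^sub>R H) \<in> Herm"
      using BH unfolding Q_def by (intro subspace_sum subspace_scale subspace_Herm) blast
    ultimately have "\<forall>H\<in>Q. u (cl H) = 0" by (intro indQ) blast
    then show "\<forall>t\<in>cl ` Q. u t = 0" by blast
  qed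
  show ?thesis
  proof (rule that[OF _ _ ind])
    show "cl ` Q \<subseteq> kaehler_cone \<A> G D" unfolding cl_def cone_eq using m(1) by blast
    show "finite (cl ` Q)" unfolding Q_def using fB by blast
    show "card (cl ` Q) + dim ?W = CARD('n)^2"
      using cQ cB B0(4) by (simp add: card_image[OF inj])
  qed
qed

lemma cone_dim:
  "ereal_of_enat (kaehler_cone_dim \<A> G D) = ereal (real (CARD('n) ^ 2) - 1 / 2 * real (card L) * (real (card L) + 1))"
proof -
  obtain T where T: "T \<subseteq> kaehler_cone \<A> G D" "finite T" "classes_independent \<A> D T"
    "card T + dim (Herm \<inter> real_block L) = CARD('n)^2"
    by (rule independent_classes_exist)
  have "kaehler_cone_dim \<A> G D = enat (card T)"
    unfolding kaehler_cone_dim_def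
  proof (rule antisym)
    show "(SUP T \<in> {T. T \<subseteq> kaehler_cone \<A> G D \<and> finite T \<and> classes_independent \<A> D T}. enat (card T)) \<le> enat (card T)"
    proof (rule SUP_least)
      fix T' assume "T' \<in> {T. T \<subseteq> kaehler_cone \<A> G D \<and> finite T \<and> classes_independent \<A> D T}"
      then have "card T' + dim (Herm \<inter> real_block L) \<le> CARD('n)^2" using card_independent_classes by blast
      then show "enat (card T') \<le> enat (card T)" using T(4) by simp
    qed
    show "enat (card T) \<le> (SUP T \<in> {T. T \<subseteq> kaehler_cone \<A> G D \<and> finite T \<and> classes_independent \<A> D T}. enat (card T))"
      using T by (intro SUP_upper) blast
  qed
  moreover have "real (card T) = real (CARD('n) ^ 2) - 1 / 2 * real (card L) * (real (card L) + 1)"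
  proof -
    have "2 * (card T + dim (Herm \<inter> real_block L)) = 2 * CARD('n)^2" using T(4) by simp
    then have "2 * card T + card L * (card L + 1) = 2 * CARD('n)^2" unfolding distrib_left dim_Herm_real_block .
    then have "2 * real (card T) + real (card L) * (real (card L) + 1) = 2 * real (CARD('n)^2)"
      by (metis (mono_tags, lifting) of_nat_1 of_nat_add of_nat_mult of_nat_numeral)
    then show ?thesis by simp
  qed
  ultimately show ?thesis by simp
qed

end

theorem theorem4p8:
  fixes \<A> :: "('a::{t2_space,second_countable_topology}, 'n::finite) chart set"
    and \<Lambda> :: "(complex^'n) set"
    and \<rho> :: "complex^'n \<Rightarrow> 'a \<Rightarrow> 'a"
    and G :: "('a \<Rightarrow> 'a) set"
    and C :: "complex^'n^'n"
    and L :: "'n set"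
  assumes X: "compact_complex_manifold \<A>"
    and G: "divisorial_semi_torus \<A> \<Lambda> \<rho> G"
    and coords: "invertible C" "(\<lambda>z. C *v z) ` span \<Lambda> = split_real_span L"
  shows "(\<forall>x0 \<in> - D_supp \<A> \<rho>.
            \<exists>\<Phi>. (\<forall>g \<in> invariant_metrics \<A> G (D_supp \<A> \<rho>).
                    \<exists>H. const_coeff_matrix \<A> \<rho> C x0 g H \<and>
                        \<Phi> (kaehler_class \<A> G (D_supp \<A> \<rho>) g) = coset (real_block L) H) \<and>
                inj_on \<Phi> (kaehler_cone \<A> G (D_supp \<A> \<rho>)) \<and>
                \<Phi> ` kaehler_cone \<A> G (D_supp \<A> \<rho>) =
                  generated_cone {coset (real_block L) H |H. pos_def_hermitian H})
       \<and> ereal_of_enat (kaehler_cone_dim \<A> G (D_supp \<A> \<rho>)) =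
           ereal (real (CARD('n) ^ 2) - 1 / 2 * real (card L) * (real (card L) + 1))"
proof -
  interpret semi_torus_coordinates \<A> \<Lambda> \<rho> G C L
    using X G coords by (intro semi_torus_coordinates.intro semi_torus_action.intro semi_torus_coordinates_axioms.intro)
  show ?thesis
    using cone_description cone_dim by blast
qed

end
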